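(* Let $\mathcal{M}^n([cl])$ denote the set of all diffeomorphism classes of closed smooth $n$-manifolds. Then the cardinality of $\mathcal{M}^n([cl])$ is $\aleph_0$.
   Context: A closed manifold is a compact smooth manifold without boundary (not assumed to be connected). *)

theory Defs
  imports "HOL-Analysis.Analysis"
begin

section \<open>Smooth maps between open subsets of coordinate spaces\<close>

text \<open>
  The model of \<open>\<real>\<^sup>n\<close> is the library's \<open>Euclidean_space n\<close>, a topology on the functions
  \<open>nat \<Rightarrow> real\<close> vanishing at all indices \<open>\<ge> n\<close>. In this way \<open>n\<close> is an ordinary natural number,
  and \<open>n = 0\<close> is included (which \<open>real ^ 'n\<close> would exclude).
\<close>

definition pderiv_at :: "nat \<Rightarrow> ((nat \<Rightarrow> real) \<Rightarrow> real) \<Rightarrow> (nat \<Rightarrow> real) \<Rightarrow> real" where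
  "pderiv_at i f x = deriv (\<lambda>t. f (x(i := t))) (x i)"

fun iter_pderiv :: "nat list \<Rightarrow> ((nat \<Rightarrow> real) \<Rightarrow> real) \<Rightarrow> (nat \<Rightarrow> real) \<Rightarrow> real" where
  "iter_pderiv [] f = f"
| "iter_pderiv (i # is) f = pderiv_at i (iter_pderiv is f)"

text \<open>
  \<open>f\<close> is of class \<open>C\<^sup>\<infinity>\<close> on the open set \<open>U\<close>: all iterated partial derivatives of all orders exist
  and are continuous on \<open>U\<close>. Since \<open>U\<close> is open, the values of \<open>f\<close> outside \<open>U\<close> are irrelevant.
\<close>

definition smooth_real_on :: "nat \<Rightarrow> (nat \<Rightarrow> real) set \<Rightarrow> ((nat \<Rightarrow> real) \<Rightarrow> real) \<Rightarrow> bool" where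
  "smooth_real_on n U f \<longleftrightarrow>
     openin (Euclidean_space n) U \<and>
     (\<forall>is. set is \<subseteq> {..<n} \<longrightarrow>
        continuous_map (subtopology (Euclidean_space n) U) euclideanreal (iter_pderiv is f) \<and>
        (\<forall>i<n. \<forall>x\<in>U. (\<lambda>t. iter_pderiv is f (x(i := t))) field_differentiable at (x i)))"

definition smooth_on :: "nat \<Rightarrow> nat \<Rightarrow> (nat \<Rightarrow> real) set \<Rightarrow> ((nat \<Rightarrow> real) \<Rightarrow> nat \<Rightarrow> real) \<Rightarrow> bool" where
  "smooth_on m n U f \<longleftrightarrow>
     openin (Euclidean_space m) U \<and> f ` U \<subseteq> topspace (Euclidean_space n) \<and>
     (\<forall>j<n. smooth_real_on m U (\<lambda>x. f x j))"


section \<open>Smooth manifolds\<close>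

text \<open>
  A chart is a pair of its domain and its coordinate map; the values of the coordinate map outside
  the domain are irrelevant. Charts take values in open subsets of \<open>\<real>\<^sup>n\<close> (never of a half space),
  so that manifolds are without boundary.
\<close>

type_synonym 'a chart = "'a set \<times> ('a \<Rightarrow> nat \<Rightarrow> real)"
type_synonym 'a manifold = "'a topology \<times> 'a chart set"

definition is_chart :: "nat \<Rightarrow> 'a topology \<Rightarrow> 'a chart \<Rightarrow> bool" where
  "is_chart n X = (\<lambda>(U, \<phi>).
     openin X U \<and> openin (Euclidean_space n) (\<phi> ` U) \<and>
     homeomorphic_map (subtopology X U) (subtopology (Euclidean_space n) (\<phi> ` U)) \<phi>)"

definition smoothly_compatible :: "nat \<Rightarrow> 'a chart \<Rightarrow> 'a chart \<Rightarrow> bool" where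
  "smoothly_compatible n = (\<lambda>(U, \<phi>) (V, \<psi>).
     smooth_on n n (\<phi> ` (U \<inter> V)) (\<psi> \<circ> inv_into U \<phi>) \<and>
     smooth_on n n (\<psi> ` (U \<inter> V)) (\<phi> \<circ> inv_into V \<psi>))"

definition smooth_atlas :: "nat \<Rightarrow> 'a topology \<Rightarrow> 'a chart set \<Rightarrow> bool" where
  "smooth_atlas n X A \<longleftrightarrow>
     (\<forall>c\<in>A. is_chart n X c) \<and> \<Union> (fst ` A) = topspace X \<and>
     (\<forall>c\<in>A. \<forall>d\<in>A. smoothly_compatible n c d)"

text \<open>A smooth structure is a maximal smooth atlas.\<close>

definition smooth_structure :: "nat \<Rightarrow> 'a topology \<Rightarrow> 'a chart set \<Rightarrow> bool" where
  "smooth_structure n X A \<longleftrightarrow>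
     smooth_atlas n X A \<and>
     (\<forall>B. smooth_atlas n X B \<and> A \<subseteq> B \<longrightarrow> B = A)"

definition smooth_manifold :: "nat \<Rightarrow> 'a manifold \<Rightarrow> bool" where
  "smooth_manifold n = (\<lambda>(X, A).
     Hausdorff_space X \<and> second_countable X \<and> smooth_structure n X A)"

definition closed_manifold :: "nat \<Rightarrow> 'a manifold \<Rightarrow> bool" where
  "closed_manifold n M \<longleftrightarrow> smooth_manifold n M \<and> compact_space (fst M)"


section \<open>Diffeomorphisms and diffeomorphism classes\<close>

definition smooth_map :: "nat \<Rightarrow> nat \<Rightarrow> 'a manifold \<Rightarrow> 'b manifold \<Rightarrow> ('a \<Rightarrow> 'b) \<Rightarrow> bool" where
  "smooth_map m n = (\<lambda>(X, A) (Y, B) f.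
     continuous_map X Y f \<and>
     (\<forall>(U, \<phi>)\<in>A. \<forall>(V, \<psi>)\<in>B.
        smooth_on m n (\<phi> ` (U \<inter> f -` V)) (\<psi> \<circ> f \<circ> inv_into U \<phi>)))"

definition diffeomorphic :: "nat \<Rightarrow> 'a manifold \<Rightarrow> 'b manifold \<Rightarrow> bool" where
  "diffeomorphic n M N \<longleftrightarrow>
     (\<exists>f g. smooth_map n n M N f \<and> smooth_map n n N M g \<and>
        (\<forall>x\<in>topspace (fst M). g (f x) = x) \<and> (\<forall>y\<in>topspace (fst N). f (g y) = y))"

text \<open>
  The diffeomorphism classes of the closed smooth \<open>n\<close>-manifolds whose points are drawn from the
  type \<open>'a\<close>. If \<open>'a\<close> has at least the cardinality of the continuum, these represent all
  diffeomorphism classes whatsoever, by \<open>closed_manifold_represented\<close> below.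
\<close>

definition closed_diffeo_classes :: "nat \<Rightarrow> 'a manifold set set" where
  "closed_diffeo_classes n =
     {M. closed_manifold n M} //
     {(M, N). closed_manifold n M \<and> closed_manifold n N \<and> diffeomorphic n M N}"


section \<open>Independence of the type of points\<close>

lemma continuous_map_fun_upd_Euclidean_space:
  assumes "x \<in> topspace (Euclidean_space n)" "i < n"
  shows "continuous_map euclideanreal (Euclidean_space n) (\<lambda>t. x(i := t))"
proof -
  have *: "(\<lambda>t. x(i := t)) = (\<lambda>t j. if j < n then (if j = i then t else x j) else 0)"
    using assms by (auto simp: fun_eq_iff topspace_Euclidean_space)
  show ?thesis
    unfolding * continuous_map_componentwise_Euclidean_space by auto
qed

lemma eventually_fun_upd_in:
  assumes "openin (Euclidean_space n) U" "x \<in> U" "i < n"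
  shows "\<forall>\<^sub>F t in nhds (x i). x(i := t) \<in> U"
proof -
  have "x \<in> topspace (Euclidean_space n)"
    using assms openin_subset by blast
  then have "openin euclideanreal {t \<in> topspace euclideanreal. x(i := t) \<in> U}"
    using assms continuous_map_fun_upd_Euclidean_space openin_continuous_map_preimage by blast
  then have "open {t. x(i := t) \<in> U}" by simp
  moreover have "x i \<in> {t. x(i := t) \<in> U}" using assms by simp
  ultimately show ?thesis
    unfolding eventually_nhds by (intro exI[of _ "{t. x(i := t) \<in> U}"]) auto
qed

lemma iter_pderiv_cong:
  assumes "openin (Euclidean_space n) U" "\<And>x. x \<in> U \<Longrightarrow> f x = g x" "set is \<subseteq> {..<n}" "x \<in> U"
  shows "iter_pderiv is f x = iter_pderiv is g x"
  using assms(3,4)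
proof (induction "is" arbitrary: x)
  case Nil
  then show ?case using assms by simp
next
  case (Cons i "is")
  have "\<forall>\<^sub>F t in nhds (x i). iter_pderiv is f (x(i := t)) = iter_pderiv is g (x(i := t))"
    using eventually_fun_upd_in[OF assms(1), of x i] Cons by (auto elim!: eventually_mono)
  then show ?case
    by (simp add: pderiv_at_def deriv_cong_ev)
qed

lemma smooth_real_on_cong:
  assumes "smooth_real_on n U f" "\<And>x. x \<in> U \<Longrightarrow> f x = g x"
  shows "smooth_real_on n U g"
  unfolding smooth_real_on_def
proof (intro conjI allI impI ballI)
  show U: "openin (Euclidean_space n) U"
    using assms(1) by (simp add: smooth_real_on_def)
  fix "is" assume "is": "set is \<subseteq> {..<n}"
  have eq: "iter_pderiv is f x = iter_pderiv is g x" if "x \<in> U" for x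
    using iter_pderiv_cong U "is" assms(2) that by blast
  have "continuous_map (subtopology (Euclidean_space n) U) euclideanreal (iter_pderiv is f)"
    using assms(1) "is" by (simp add: smooth_real_on_def)
  then show "continuous_map (subtopology (Euclidean_space n) U) euclideanreal (iter_pderiv is g)"
    by (rule continuous_map_eq) (simp add: eq)
  fix i x assume i: "i < n" and x: "x \<in> U"
  have "(\<lambda>t. iter_pderiv is f (x(i := t))) field_differentiable at (x i)"
    using assms(1) "is" i x by (simp add: smooth_real_on_def)
  moreover have "\<forall>\<^sub>F t in nhds (x i). iter_pderiv is f (x(i := t)) = iter_pderiv is g (x(i := t))"
    using eventually_fun_upd_in[OF U x i] by (rule eventually_mono) (rule eq)
  ultimately show "(\<lambda>t. iter_pderiv is g (x(i := t))) field_differentiable at (x i)"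
    unfolding field_differentiable_def by (metis DERIV_cong_ev)
qed

lemma smooth_on_cong:
  assumes "smooth_on m n U f" "\<And>x. x \<in> U \<Longrightarrow> f x = g x"
  shows "smooth_on m n U g"
  using assms unfolding smooth_on_def
  by (auto intro: smooth_real_on_cong simp: image_subset_iff)


lemma is_chart_inj_on: "is_chart n X (U, \<phi>) \<Longrightarrow> inj_on \<phi> U"
  unfolding is_chart_def
  by (auto dest!: homeomorphic_imp_injective_map dest: openin_subset simp: Int_absorb1)

lemma is_chart_subset: "is_chart n X (U, \<phi>) \<Longrightarrow> U \<subseteq> topspace X"
  unfolding is_chart_def by (auto dest: openin_subset)

lemma is_chart_cong:
  assumes "is_chart n X (U, \<phi>)" "\<And>x. x \<in> U \<Longrightarrow> \<phi> x = \<phi>' x"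
  shows "is_chart n X (U, \<phi>')"
proof -
  have im: "\<phi>' ` U = \<phi> ` U" using assms(2) by (auto simp: image_iff)
  show ?thesis
    using assms unfolding is_chart_def prod.case im
    by (auto elim: homeomorphic_map_eq)
qed

lemma smoothly_compatible_sym: "smoothly_compatible n c d \<Longrightarrow> smoothly_compatible n d c"
  unfolding smoothly_compatible_def by (auto simp: Int_commute)

lemma smoothly_compatible_cong:
  assumes "smoothly_compatible n (U, \<phi>) (V, \<psi>)"
    and inj: "inj_on \<phi> U" "inj_on \<psi> V"
    and eqs: "\<And>x. x \<in> U \<Longrightarrow> \<phi> x = \<phi>' x" "\<And>x. x \<in> V \<Longrightarrow> \<psi> x = \<psi>' x"
  shows "smoothly_compatible n (U, \<phi>') (V, \<psi>')"
proof -
  have im: "\<phi>' ` (U \<inter> V) = \<phi> ` (U \<inter> V)" "\<psi>' ` (U \<inter> V) = \<psi> ` (U \<inter> V)"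
    using eqs by (auto simp: image_iff)
  have inv: "inv_into U \<phi>' y = inv_into U \<phi> y" "inv_into V \<psi>' y = inv_into V \<psi> y" for y
    using eqs by (auto simp: inv_into_def intro!: arg_cong[where f = Eps])
  have "smooth_on n n (\<phi>' ` (U \<inter> V)) (\<psi>' \<circ> inv_into U \<phi>')"
    if "smooth_on n n (\<phi> ` (U \<inter> V)) (\<psi> \<circ> inv_into U \<phi>)" and "inj_on \<phi> U"
    using that(1) unfolding im
    by (rule smooth_on_cong) (use eqs(2) that(2) in \<open>auto simp: inv\<close>)
  moreover have "smooth_on n n (\<psi>' ` (U \<inter> V)) (\<phi>' \<circ> inv_into V \<psi>')"
    if "smooth_on n n (\<psi> ` (U \<inter> V)) (\<phi> \<circ> inv_into V \<psi>)" and "inj_on \<psi> V"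
    using that(1) unfolding im
    by (rule smooth_on_cong) (use eqs(1) that(2) in \<open>auto simp: inv\<close>)
  ultimately show ?thesis
    using assms(1) inj unfolding smoothly_compatible_def by auto
qed

lemma smooth_structure_maximal:
  assumes A: "smooth_structure n X A" and c: "is_chart n X c" "smoothly_compatible n c c"
    and comp: "\<And>d. d \<in> A \<Longrightarrow> smoothly_compatible n c d"
  shows "c \<in> A"
proof -
  have "smooth_atlas n X (insert c A)"
    using assms is_chart_subset[of n X "fst c" "snd c"] smoothly_compatible_sym[OF comp]
    unfolding smooth_structure_def smooth_atlas_def by auto
  then have "insert c A = A"
    using A unfolding smooth_structure_def by blast
  then show ?thesis by blast
qed

lemma smooth_structure_cong:
  assumes A: "smooth_structure n X A" and c: "(U, \<phi>) \<in> A" "\<And>x. x \<in> U \<Longrightarrow> \<phi> x = \<phi>' x"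
  shows "(U, \<phi>') \<in> A"
proof -
  have at: "smooth_atlas n X A" using A by (simp add: smooth_structure_def)
  then have ch: "\<And>d. d \<in> A \<Longrightarrow> is_chart n X d"
    and co: "\<And>c d. c \<in> A \<Longrightarrow> d \<in> A \<Longrightarrow> smoothly_compatible n c d"
    by (auto simp: smooth_atlas_def)
  have inj: "\<And>V \<psi>. (V, \<psi>) \<in> A \<Longrightarrow> inj_on \<psi> V"
    using ch is_chart_inj_on by blast
  show ?thesis
  proof (rule smooth_structure_maximal[OF A])
    show "is_chart n X (U, \<phi>')"
      using is_chart_cong ch c by blast
    show "smoothly_compatible n (U, \<phi>') (U, \<phi>')"
      using smoothly_compatible_cong[OF co[OF c(1) c(1)]] c inj by blast
    fix d assume d: "d \<in> A"
    obtain V \<psi> where [simp]: "d = (V, \<psi>)" by fastforce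
    have "smoothly_compatible n (U, \<phi>') (V, \<psi>)"
      by (rule smoothly_compatible_cong[OF co[OF c(1), of "(V, \<psi>)"]]) (use c inj d in auto)
    then show "smoothly_compatible n (U, \<phi>') d" by simp
  qed
qed

lemma closed_manifold_transport:
  fixes h :: "'b \<Rightarrow> 'a"
  assumes M: "closed_manifold n (X, A)" and h: "inj_on h (topspace X)"
  shows "\<exists>N :: 'a manifold. closed_manifold n N \<and> diffeomorphic n (X, A) N"
proof -
  define S where "S = topspace X"
  define g where "g = inv_into S h"
  define Y where "Y = pullback_topology (h ` S) g X"
  define B where "B = {(V, \<psi>). V \<subseteq> h ` S \<and> (g ` V, \<psi> \<circ> h) \<in> A}"
  have gh: "g (h x) = x" if "x \<in> S" for x
    using h that by (simp add: g_def S_def)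
  have hg: "h (g y) = y" and gS: "g y \<in> S" if "y \<in> h ` S" for y
    using that gh by auto
  have topY: "topspace Y = h ` S"
    using gS by (auto simp: Y_def topspace_pullback_topology S_def[symmetric])
  have str: "smooth_structure n X A" and Haus: "Hausdorff_space X"
    and sc: "second_countable X" and comp: "compact_space X"
    using M by (auto simp: closed_manifold_def smooth_manifold_def)
  have at: "smooth_atlas n X A" using str by (simp add: smooth_structure_def)
  have ch: "\<And>d. d \<in> A \<Longrightarrow> is_chart n X d" and cov: "\<Union> (fst ` A) = S"
    and co: "\<And>c d. c \<in> A \<Longrightarrow> d \<in> A \<Longrightarrow> smoothly_compatible n c d"
    using at by (auto simp: smooth_atlas_def S_def)

  have cg: "continuous_map Y X g"
    using continuous_map_pullback[of X X id "h ` S" g] by (simp add: Y_def)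
  have ch': "continuous_map X Y h"
    unfolding Y_def
  proof (rule continuous_map_pullback')
    show "continuous_map X X (g \<circ> h)"
      by (rule continuous_map_eq[of _ _ id]) (auto simp: gh S_def)
  qed (auto simp: S_def)
  have hom: "homeomorphic_maps X Y h g"
    unfolding homeomorphic_maps_def using cg ch' gh hg topY by (auto simp: S_def)
  have homh: "homeomorphic_map X Y h" and homg: "homeomorphic_map Y X g"
    using hom homeomorphic_maps_map by blast+
  have XY: "X homeomorphic_space Y"
    using hom homeomorphic_space_def by blast

  have gV: "h ` g ` V = V" if "V \<subseteq> h ` S" for V
    using that hg by (force simp: image_image)
  have hU: "g ` h ` U = U" if "U \<subseteq> S" for U
    using that gh by (force simp: image_image)

  have gVS: "g ` V \<subseteq> S" if "V \<subseteq> h ` S" for V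
    using that gS by blast

  have pull_chart: "is_chart n X (g ` V, \<psi> \<circ> h)" if "is_chart n Y (V, \<psi>)" for V \<psi>
  proof -
    have V: "V \<subseteq> h ` S" using is_chart_subset[OF that] topY by simp
    have "openin X (g ` V)"
      using that V homeomorphic_map_openness[OF homg, of V] topY by (auto simp: is_chart_def)
    moreover have im: "(\<psi> \<circ> h) ` g ` V = \<psi> ` V"
      using gV[OF V] by (metis image_comp)
    moreover have "homeomorphic_map (subtopology X (g ` V)) (subtopology Y V) h"
      by (rule homeomorphic_map_subtopologies[OF homh])
        (simp add: S_def[symmetric] topY Int_absorb1 gVS gV V)
    ultimately show ?thesis
      using that by (auto simp: is_chart_def intro: homeomorphic_map_compose)
  qed
  have push_chart: "is_chart n Y (V, \<psi>)" if V: "V \<subseteq> h ` S" and c: "is_chart n X (g ` V, \<psi> \<circ> h)" for V \<psi>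
  proof -
    have "openin Y V"
      using c V homeomorphic_map_openness_eq[OF homg, of V] topY by (auto simp: is_chart_def)
    moreover have im: "(\<psi> \<circ> h) ` g ` V = \<psi> ` V"
      using gV[OF V] by (metis image_comp)
    moreover have "homeomorphic_map (subtopology Y V) (subtopology X (g ` V)) g"
      by (rule homeomorphic_map_subtopologies[OF homg])
        (simp add: S_def[symmetric] topY Int_absorb1 gVS V)
    then have "homeomorphic_map (subtopology Y V) (subtopology (Euclidean_space n) (\<psi> ` V)) ((\<psi> \<circ> h) \<circ> g)"
      using c unfolding is_chart_def prod.case im by (blast intro: homeomorphic_map_compose)
    then have "homeomorphic_map (subtopology Y V) (subtopology (Euclidean_space n) (\<psi> ` V)) \<psi>"
      by (rule homeomorphic_map_eq) (use V hg in auto)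
    ultimately show ?thesis
      using c by (simp add: is_chart_def)
  qed

  have trans: "smooth_on n n (\<psi> ` (V \<inter> V')) (\<psi>' \<circ> inv_into V \<psi>) \<longleftrightarrow>
      smooth_on n n ((\<psi> \<circ> h) ` (g ` V \<inter> g ` V')) ((\<psi>' \<circ> h) \<circ> inv_into (g ` V) (\<psi> \<circ> h))"
    if V: "V \<subseteq> h ` S" "V' \<subseteq> h ` S" and inj: "inj_on \<psi> V" for V V' \<psi> \<psi>'
  proof -
    have inj': "inj_on (\<psi> \<circ> h) (g ` V)"
      using inj V hg by (auto simp: inj_on_def subset_iff)
    have "g ` V \<inter> g ` V' = g ` (V \<inter> V')"
      using inj_on_image_Int[of g "h ` S" V V'] V hg inj_on_def by metis
    then have im: "(\<psi> \<circ> h) ` (g ` V \<inter> g ` V') = \<psi> ` (V \<inter> V')"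
      using gV[of "V \<inter> V'"] V by (metis image_comp le_infI1)
    have eq: "((\<psi>' \<circ> h) \<circ> inv_into (g ` V) (\<psi> \<circ> h)) y = (\<psi>' \<circ> inv_into V \<psi>) y"
      if y: "y \<in> \<psi> ` (V \<inter> V')" for y
    proof -
      obtain v where v: "v \<in> V" "y = \<psi> v" using y by auto
      have "inv_into (g ` V) (\<psi> \<circ> h) ((\<psi> \<circ> h) (g v)) = g v"
        using inj' v by (intro inv_into_f_f) auto
      moreover have "(\<psi> \<circ> h) (g v) = y"
        using v V hg by auto
      ultimately show ?thesis
        using v V hg inj by auto
    qed
    show ?thesis
      unfolding im using eq smooth_on_cong by metis
  qed
  have compat: "smoothly_compatible n (V, \<psi>) (V', \<psi>') \<longleftrightarrow>
      smoothly_compatible n (g ` V, \<psi> \<circ> h) (g ` V', \<psi>' \<circ> h)"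
    if "V \<subseteq> h ` S" "V' \<subseteq> h ` S" "inj_on \<psi> V" "inj_on \<psi>' V'" for V V' \<psi> \<psi>'
    using trans[of V V' \<psi> \<psi>'] trans[of V' V \<psi>' \<psi>] that
    unfolding smoothly_compatible_def by (simp add: Int_commute)

  have chB: "is_chart n Y d" if "d \<in> B" for d
    using that push_chart ch by (auto simp: B_def)
  have injB: "inj_on \<psi> V" if "(V, \<psi>) \<in> B" for V \<psi>
    using chB[OF that] is_chart_inj_on by blast
  have push: "(h ` U, \<phi> \<circ> g) \<in> B" if "(U, \<phi>) \<in> A" for U \<phi>
  proof -
    have U: "U \<subseteq> S" using cov that by force
    have "(U, (\<phi> \<circ> g) \<circ> h) \<in> A"
      by (rule smooth_structure_cong[OF str that]) (use U gh in auto)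
    then show ?thesis using U hU[OF U] by (auto simp: B_def)
  qed
  have atB: "smooth_atlas n Y B"
    unfolding smooth_atlas_def
  proof (intro conjI ballI)
    show "\<Union> (fst ` B) = topspace Y"
    proof
      show "\<Union> (fst ` B) \<subseteq> topspace Y" by (auto simp: topY B_def)
      show "topspace Y \<subseteq> \<Union> (fst ` B)"
      proof
        fix y assume "y \<in> topspace Y"
        then obtain x where x: "x \<in> S" "y = h x" using topY by auto
        then obtain U \<phi> where "(U, \<phi>) \<in> A" "x \<in> U" using cov by force
        then show "y \<in> \<Union> (fst ` B)" using push[of U \<phi>] x by force
      qed
    qed
    show "smoothly_compatible n c d" if cd: "c \<in> B" "d \<in> B" for c d
    proof -
      obtain V \<psi> V' \<psi>' where [simp]: "c = (V, \<psi>)" "d = (V', \<psi>')" by fastforce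
      show ?thesis
        using compat[of V V' \<psi> \<psi>'] cd injB co by (auto simp: B_def)
    qed
  qed (rule chB)
  have strB: "smooth_structure n Y B"
    unfolding smooth_structure_def
  proof (intro conjI allI impI atB)
    fix C assume C: "smooth_atlas n Y C \<and> B \<subseteq> C"
    have chC: "\<And>d. d \<in> C \<Longrightarrow> is_chart n Y d"
      and coC: "\<And>c d. c \<in> C \<Longrightarrow> d \<in> C \<Longrightarrow> smoothly_compatible n c d"
      using C by (auto simp: smooth_atlas_def)
    have "c \<in> B" if c: "c \<in> C" for c
    proof -
      obtain V \<psi> where [simp]: "c = (V, \<psi>)" by fastforce
      have chV: "is_chart n Y (V, \<psi>)" using chC[OF c] by simp
      have V: "V \<subseteq> h ` S" using is_chart_subset[OF chV] topY by simp
      have inj: "inj_on \<psi> V" using is_chart_inj_on[OF chV] .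
      have "(g ` V, \<psi> \<circ> h) \<in> A"
      proof (rule smooth_structure_maximal[OF str pull_chart[OF chV]])
        show "smoothly_compatible n (g ` V, \<psi> \<circ> h) (g ` V, \<psi> \<circ> h)"
          using compat[OF V V inj inj] coC[OF c c] by simp
        fix d assume d: "d \<in> A"
        obtain U \<phi> where [simp]: "d = (U, \<phi>)" by fastforce
        have U: "U \<subseteq> S" using cov d by force
        have dB: "(h ` U, \<phi> \<circ> g) \<in> B" using push d by simp
        then have "smoothly_compatible n (V, \<psi>) (h ` U, \<phi> \<circ> g)"
          using coC[OF c, of "(h ` U, \<phi> \<circ> g)"] C by auto
        then have *: "smoothly_compatible n (g ` V, \<psi> \<circ> h) (U, (\<phi> \<circ> g) \<circ> h)"
          using compat[OF V _ inj injB[OF dB]] hU[OF U] U by (simp add: image_mono)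
        have "inj_on (\<psi> \<circ> h) (g ` V)"
          using is_chart_inj_on[OF pull_chart[OF chV]] .
        moreover have "inj_on \<phi> U"
          using ch[OF d] is_chart_inj_on by auto
        then have "inj_on (\<phi> \<circ> g \<circ> h) U"
          using U gh by (auto simp: inj_on_def subset_iff)
        ultimately have "smoothly_compatible n (g ` V, \<psi> \<circ> h) (U, \<phi>)"
          by (rule smoothly_compatible_cong[OF *]) (use U gh in auto)
        then show "smoothly_compatible n (g ` V, \<psi> \<circ> h) d" by simp
      qed
      then show ?thesis using V by (simp add: B_def)
    qed
    then show "C = B" using C by blast
  qed
  have "closed_manifold n (Y, B)"
    using strB Haus sc comp XY homeomorphic_Hausdorff_space[OF XY]
      homeomorphic_space_second_countability[OF XY] homeomorphic_compact_space[OF XY]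
    by (simp add: closed_manifold_def smooth_manifold_def)
  moreover have "diffeomorphic n (X, A) (Y, B)"
    unfolding diffeomorphic_def
  proof (intro exI conjI)
    have "smooth_on n n (\<phi> ` (U \<inter> h -` V)) (\<psi> \<circ> h \<circ> inv_into U \<phi>)"
      if "(U, \<phi>) \<in> A" "(V, \<psi>) \<in> B" for U \<phi> V \<psi>
    proof -
      have V: "V \<subseteq> h ` S" and A: "(g ` V, \<psi> \<circ> h) \<in> A" using that by (auto simp: B_def)
      have U: "U \<subseteq> S" using cov that by force
      have "U \<inter> h -` V = U \<inter> g ` V"
      proof (intro set_eqI iffI)
        fix x assume "x \<in> U \<inter> h -` V"
        then show "x \<in> U \<inter> g ` V" using U gh[of x] by (auto intro!: image_eqI[of x g "h x"])
      qed (use V hg in auto)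
      then show ?thesis
        using co[OF that(1) A] by (simp add: smoothly_compatible_def)
    qed
    then show "smooth_map n n (X, A) (Y, B) h"
      using ch' by (auto simp: smooth_map_def)
    have "smooth_on n n (\<psi> ` (V \<inter> g -` U)) (\<phi> \<circ> g \<circ> inv_into V \<psi>)"
      if "(U, \<phi>) \<in> A" "(V, \<psi>) \<in> B" for U \<phi> V \<psi>
    proof -
      have V: "V \<subseteq> h ` S" using that by (auto simp: B_def)
      have U: "U \<subseteq> S" using cov that by force
      have "V \<inter> g -` U = V \<inter> h ` U"
      proof (intro set_eqI iffI)
        fix x assume "x \<in> V \<inter> g -` U"
        then show "x \<in> V \<inter> h ` U" using V hg[of x] by (auto intro!: image_eqI[of x h "g x"])
      qed (use U gh in auto)
      moreover have "smoothly_compatible n (V, \<psi>) (h ` U, \<phi> \<circ> g)"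
        using atB that(2) push[OF that(1)] unfolding smooth_atlas_def by blast
      ultimately show ?thesis
        by (simp add: smoothly_compatible_def)
    qed
    then show "smooth_map n n (Y, B) (X, A) g"
      using cg by (auto simp: smooth_map_def)
  qed (auto simp: gh hg topY S_def)
  ultimately show ?thesis by blast
qed

lemma second_countable_Hausdorff_lepoll_real:
  assumes "second_countable X" "Hausdorff_space X"
  shows "topspace X \<lesssim> (UNIV :: real set)"
proof -
  obtain \<B> where \<B>: "countable \<B>"
    "\<forall>U x. openin X U \<and> x \<in> U \<longrightarrow> (\<exists>V\<in>\<B>. x \<in> V \<and> V \<subseteq> U)"
    using assms(1) unfolding second_countable_def by (elim exE conjE)
  define F where "F x = to_nat_on \<B> ` {V \<in> \<B>. x \<in> V}" for x
  have "inj_on F (topspace X)"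
  proof (rule inj_onI, rule ccontr)
    fix x y assume x: "x \<in> topspace X" and y: "y \<in> topspace X" and F: "F x = F y" and "x \<noteq> y"
    then obtain U W where U: "openin X U" "openin X W" "x \<in> U" "y \<in> W" "disjnt U W"
      using assms(2) unfolding Hausdorff_space_def by metis
    then obtain V where V: "V \<in> \<B>" "x \<in> V" "V \<subseteq> U" using \<B>(2) by metis
    then have "to_nat_on \<B> V \<in> F y" using F unfolding F_def by blast
    then have "V \<in> {V \<in> \<B>. y \<in> V}"
      using V inj_on_to_nat_on[OF \<B>(1)] unfolding F_def by (auto dest: inj_onD)
    then show False using V U by (auto simp: disjnt_iff)
  qed
  then have "topspace X \<lesssim> (UNIV :: nat set set)"
    unfolding lepoll_def by blast
  then show ?thesis
    using lepoll_trans2 nat_sets_eqpoll_reals by blast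
qed

proposition closed_manifold_represented:
  fixes M :: "'b manifold"
  assumes "(UNIV :: real set) \<lesssim> (UNIV :: 'a set)" "closed_manifold n M"
  shows "\<exists>N :: 'a manifold. closed_manifold n N \<and> diffeomorphic n M N"
proof -
  obtain X A where M: "M = (X, A)" by fastforce
  have "topspace X \<lesssim> (UNIV :: 'a set)"
    using assms second_countable_Hausdorff_lepoll_real lepoll_trans
    by (fastforce simp: M closed_manifold_def smooth_manifold_def)
  then obtain h :: "'b \<Rightarrow> 'a" where "inj_on h (topspace X)"
    unfolding lepoll_def by blast
  then show ?thesis
    using closed_manifold_transport assms(2) unfolding M by blast
qed

end

theory Submission
  imports Defs "HOL-Homology.Invariance_of_Domain"
begin

text \<open>
There are at most countably many classes because the diffeomorphism type of a closed manifold is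
stable under \<open>C\<^sup>1\<close>-small changes of a finite amount of data that lives in a second countable space.

Cover a closed manifold \<open>X\<close> by \<open>k\<close> charts onto the cube of radius \<open>3\<close> whose closed unit cubes still
cover (\<open>cubical_atlas_exists\<close>). Bump functions turn these charts into an explicit embedding \<open>e\<close> of \<open>X\<close>
into \<open>\<real>\<^sup>N\<close> with \<open>N = k (n + 1)\<close>: the \<open>i\<close>-th block of coordinates consists of the \<open>i\<close>-th bump function and of
its products with the coordinates of the \<open>i\<close>-th chart. Each block gives a local left inverse of \<open>e\<close> by
division, and interpolating between these left inverses inside one chart at a time yields a smooth
map \<open>R\<close> from a neighbourhood of \<open>e(X)\<close> to \<open>X\<close> with \<open>R \<circ> e = id\<close> (\<open>smooth_retraction_exists\<close>).

Let \<open>X'\<close> be another closed manifold with the same \<open>k\<close>, with embedding \<open>e'\<close>, and let \<open>f\<^sub>j\<close> and \<open>f'\<^sub>j\<close> be the two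
embeddings in the coordinates of the \<open>j\<close>-th charts. If \<open>f'\<^sub>j\<close> and its first derivatives are so close to
\<open>f\<^sub>j\<close> that \<open>R \<circ> f'\<^sub>j\<close>, read in the \<open>j\<close>-th chart, has Jacobian near the identity, then \<open>R \<circ> e'\<close> is injective with
smooth inverse on every cube. This alone does not make it injective: \<open>X'\<close> might be a double cover lying
close to \<open>X\<close>. One must also know that points of \<open>X'\<close> with the same image lie in a common chart, and
then \<open>R \<circ> e'\<close> is a diffeomorphism, its image being open by invariance of domain, closed by
compactness, and meeting every chart domain (\<open>diffeomorphic_of_close\<close>).

Both requirements say that a compact set (the graph of the first derivatives, or the set of overlapping
pairs) lies in an open set. In a second countable space some member of a fixed countable family of open
sets fits between the two. Three such members together with \<open>k\<close> form a witness, and two manifolds with a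
common witness are diffeomorphic (\<open>same_witness_diffeomorphic\<close>), since the compact sets of the one lie in
the open sets of the other. The witnesses form a countable set.

There are infinitely many classes because of disjoint unions of \<open>K\<close> spheres. They split into \<open>K\<close>
nonempty open pieces, but never into more than \<open>2 K\<close>, since \<open>2 K\<close> connected stereographic chart domains
cover them (this includes \<open>n = 0\<close>, where the sphere has two points). So the unions with \<open>K = 3\<^sup>a\<close> are
pairwise not diffeomorphic.

The dimension is a number and not a type, so the calculus is developed for the partial derivatives of
functions on \<open>nat \<Rightarrow> real\<close>. Smoothness proofs become short through coinduction: a family of continuous
functions is smooth if its partial derivatives are again polynomial expressions in members of the family
and known smooth functions (\<open>smooth_real_on_coinduct_upto\<close>). Coinduction handles products, compositions,
reciprocals, flat functions, inverse matrices and inverse maps alike.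
\<close>


section \<open>Coordinate cubes\<close>

lemma Euclidean_space_eq_top_of_set:
  "Euclidean_space n = top_of_set (topspace (Euclidean_space n))"
  by (simp add: Euclidean_space_def euclidean_product_topology)

lemma continuous_map_Euclidean_subspace:
  assumes "U \<subseteq> topspace (Euclidean_space n)"
  shows "continuous_map (subtopology (Euclidean_space n) U) euclidean f \<longleftrightarrow> continuous_on U f"
proof -
  have "subtopology (Euclidean_space n) U = top_of_set U"
    by (metis Euclidean_space_eq_top_of_set assms inf.absorb2 subtopology_subtopology)
  then show ?thesis by simp
qed

text \<open>
Relative openness in terms of the product topology on the type \<open>nat \<Rightarrow> real\<close> makes the type-class
results on continuity, compactness and second countability available.
\<close>

lemma openin_Euclidean_iff:
  "openin (Euclidean_space n) U \<longleftrightarrow> (\<exists>T. open T \<and> U = topspace (Euclidean_space n) \<inter> T)"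
  by (metis Euclidean_space_eq_top_of_set openin_open)

text \<open>
Cubes are the convenient neighbourhoods here: one walks between two of their points along coordinate
axes without leaving them, so that only partial derivatives occur in estimates.
\<close>

definition cube :: "nat \<Rightarrow> (nat \<Rightarrow> real) \<Rightarrow> real \<Rightarrow> (nat \<Rightarrow> real) set" where
  "cube n c r = {x \<in> topspace (Euclidean_space n). \<forall>i<n. \<bar>x i - c i\<bar> < r}"

lemma openin_cube: "openin (Euclidean_space n) (cube n c r)"
proof -
  have "open {x :: nat \<Rightarrow> real. \<bar>x i - c i\<bar> < r}" for i
    by (intro open_Collect_less continuous_intros continuous_on_product_coordinates)
  then have "open (\<Inter>i\<in>{..<n}. {x :: nat \<Rightarrow> real. \<bar>x i - c i\<bar> < r})"
    by (intro open_INT) auto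
  then show ?thesis
    unfolding openin_Euclidean_iff cube_def
    by (intro exI[of _ "\<Inter>i\<in>{..<n}. {x :: nat \<Rightarrow> real. \<bar>x i - c i\<bar> < r}"]) auto
qed

lemma cube_subset: "cube n c r \<subseteq> topspace (Euclidean_space n)"
  by (auto simp: cube_def)

lemma centre_in_cube: "c \<in> topspace (Euclidean_space n) \<Longrightarrow> 0 < r \<Longrightarrow> c \<in> cube n c r"
  by (auto simp: cube_def)

lemma cube_nhd:
  assumes "openin (Euclidean_space n) U" "x \<in> U"
  obtains r where "r > 0" "cube n x r \<subseteq> U"
proof -
  obtain T where T: "open T" "U = topspace (Euclidean_space n) \<inter> T"
    using assms openin_Euclidean_iff by blast
  have "openin (product_topology (\<lambda>i::nat. euclideanreal) UNIV) T" "x \<in> T"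
    using T assms by (auto simp: euclidean_product_topology)
  from product_topology_open_contains_basis[OF this] obtain X where
    X: "x \<in> (\<Pi>\<^sub>E i\<in>UNIV. X i)" "\<And>i. open (X i)" "(\<Pi>\<^sub>E i\<in>UNIV. X i) \<subseteq> T"
    by auto
  have "\<exists>e>0. ball (x i) e \<subseteq> X i" for i
    using X(1) X(2)[of i] open_contains_ball[of "X i"] by (auto simp: PiE_def)
  then obtain e where e: "\<And>i. e i > 0" "\<And>i. ball (x i) (e i) \<subseteq> X i" by metis
  define r where "r = Min (insert 1 (e ` {..<n}))"
  have r: "r > 0" "\<And>i. i < n \<Longrightarrow> r \<le> e i"
    using e by (auto simp: r_def)
  have "cube n x r \<subseteq> U"
  proof
    fix y assume y: "y \<in> cube n x r"
    have "y i \<in> X i" for i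
    proof (cases "i < n")
      case True
      then have "\<bar>y i - x i\<bar> < e i" using y r(2)[of i] by (force simp: cube_def)
      then show ?thesis using e(2)[of i] by (simp add: dist_real_def subset_iff abs_minus_commute)
    next
      case False
      then have "y i = x i"
        using y assms(2) openin_subset[OF assms(1)] by (simp add: cube_def topspace_Euclidean_space subset_iff)
      then show ?thesis using X(1) by (simp add: PiE_def Pi_iff)
    qed
    then have "y \<in> (\<Pi>\<^sub>E i\<in>UNIV. X i)" by (simp add: PiE_def)
    then have "y \<in> T" using X(3) by blast
    then show "y \<in> U" using y T by (auto simp: cube_def)
  qed
  with r that show ?thesis by blast
qed


section \<open>Smooth functions by coinduction\<close>

lemma smooth_real_on_open: "smooth_real_on n U f \<Longrightarrow> openin (Euclidean_space n) U"
  by (simp add: smooth_real_on_def)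

lemma smooth_real_on_continuous: "smooth_real_on n U f \<Longrightarrow> continuous_on U f"
  unfolding smooth_real_on_def
  by (metis continuous_map_Euclidean_subspace empty_set iter_pderiv.simps(1) openin_subset empty_subsetI)

lemma smooth_real_on_has_pderiv:
  assumes "smooth_real_on n U f" "i < n" "x \<in> U"
  shows "((\<lambda>t. f (x(i := t))) has_real_derivative pderiv_at i f x) (at (x i))"
proof -
  have "(\<lambda>t. iter_pderiv [] f (x(i := t))) field_differentiable at (x i)"
    using assms unfolding smooth_real_on_def by (metis empty_set empty_subsetI)
  then show ?thesis
    by (simp add: pderiv_at_def DERIV_deriv_iff_field_differentiable)
qed

lemma iter_pderiv_pderiv_at: "iter_pderiv is (pderiv_at i f) = iter_pderiv (is @ [i]) f"
  by (induction "is") auto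

lemma smooth_real_on_pderiv:
  assumes "smooth_real_on n U f" "i < n"
  shows "smooth_real_on n U (pderiv_at i f)"
  using assms unfolding smooth_real_on_def iter_pderiv_pderiv_at by simp

text \<open>
The iterated partial derivatives of a member agree on \<open>U\<close> with members, by induction on their order. So
one differentiation step settles all orders at once.
\<close>

lemma smooth_real_on_coinduct:
  assumes U: "openin (Euclidean_space n) U"
    and cont: "\<And>f. f \<in> F \<Longrightarrow> continuous_on U f"
    and der: "\<And>f i. f \<in> F \<Longrightarrow> i < n \<Longrightarrow>
      \<exists>f'\<in>F. \<forall>x\<in>U. ((\<lambda>t. f (x(i := t))) has_real_derivative f' x) (at (x i))"
    and f: "f \<in> F"
  shows "smooth_real_on n U f"
proof -
  have eq: "\<exists>g\<in>F. \<forall>x\<in>U. iter_pderiv is f x = g x" if "set is \<subseteq> {..<n}" for "is"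
    using that
  proof (induction "is")
    case Nil
    then show ?case using f by auto
  next
    case (Cons i "is")
    then obtain g where g: "g \<in> F" "\<forall>x\<in>U. iter_pderiv is f x = g x" by auto
    obtain g' where g': "g' \<in> F"
      "\<forall>x\<in>U. ((\<lambda>t. g (x(i := t))) has_real_derivative g' x) (at (x i))"
      using der[OF g(1), of i] Cons by auto
    have "iter_pderiv (i # is) f x = g' x" if x: "x \<in> U" for x
    proof -
      have "\<forall>\<^sub>F t in nhds (x i). iter_pderiv is f (x(i := t)) = g (x(i := t))"
        using eventually_fun_upd_in[OF U x, of i] Cons(2) g(2) by (auto elim!: eventually_mono)
      then have "iter_pderiv (i # is) f x = deriv (\<lambda>t. g (x(i := t))) (x i)"
        by (simp add: pderiv_at_def deriv_cong_ev)
      then show ?thesis using g'(2) x DERIV_imp_deriv by metis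
    qed
    then show ?case using g' by blast
  qed
  show ?thesis
    unfolding smooth_real_on_def
  proof (intro conjI allI impI ballI U)
    fix "is" assume "is": "set is \<subseteq> {..<n}"
    obtain g where g: "g \<in> F" "\<forall>x\<in>U. iter_pderiv is f x = g x" using eq[OF "is"] by blast
    have "continuous_on U (iter_pderiv is f)"
      using cont[OF g(1)] g(2) continuous_on_cong by metis
    then show "continuous_map (subtopology (Euclidean_space n) U) euclideanreal (iter_pderiv is f)"
      using openin_subset[OF U] by (simp add: continuous_map_Euclidean_subspace)
    fix i x assume i: "i < n" and x: "x \<in> U"
    obtain g' where g': "\<forall>x\<in>U. ((\<lambda>t. g (x(i := t))) has_real_derivative g' x) (at (x i))"
      using der[OF g(1) i] by auto
    have "\<forall>\<^sub>F t in nhds (x i). iter_pderiv is f (x(i := t)) = g (x(i := t))"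
      using eventually_fun_upd_in[OF U x i] g(2) by (auto elim!: eventually_mono)
    then show "(\<lambda>t. iter_pderiv is f (x(i := t))) field_differentiable at (x i)"
      unfolding field_differentiable_def using g' x by (metis DERIV_cong_ev)
  qed
qed

text \<open>
What the derivatives of members of \<open>F\<close> may look like in the next coinduction principle.
\<close>

inductive_set smooth_algebra :: "nat \<Rightarrow> (nat \<Rightarrow> real) set \<Rightarrow> ((nat \<Rightarrow> real) \<Rightarrow> real) set \<Rightarrow> ((nat \<Rightarrow> real) \<Rightarrow> real) set"
  for n U F where
  generator: "f \<in> F \<Longrightarrow> f \<in> smooth_algebra n U F"
| smooth: "smooth_real_on n U f \<Longrightarrow> f \<in> smooth_algebra n U F"
| add: "f \<in> smooth_algebra n U F \<Longrightarrow> g \<in> smooth_algebra n U F \<Longrightarrow> (\<lambda>x. f x + g x) \<in> smooth_algebra n U F"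
| mult: "f \<in> smooth_algebra n U F \<Longrightarrow> g \<in> smooth_algebra n U F \<Longrightarrow> (\<lambda>x. f x * g x) \<in> smooth_algebra n U F"

text \<open>
By the sum and product rules the generated algebra itself satisfies the hypotheses of the plain
coinduction rule.
\<close>

lemma smooth_real_on_coinduct_upto:
  assumes U: "openin (Euclidean_space n) U"
    and cont: "\<And>f. f \<in> F \<Longrightarrow> continuous_on U f"
    and der: "\<And>f i. f \<in> F \<Longrightarrow> i < n \<Longrightarrow>
      \<exists>f'\<in>smooth_algebra n U F. \<forall>x\<in>U. ((\<lambda>t. f (x(i := t))) has_real_derivative f' x) (at (x i))"
    and f: "f \<in> smooth_algebra n U F"
  shows "smooth_real_on n U f"
proof (rule smooth_real_on_coinduct[OF U _ _ f])
  fix f assume "f \<in> smooth_algebra n U F"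
  then show "continuous_on U f"
    by induction (auto intro: cont smooth_real_on_continuous continuous_intros)
next
  fix f i assume "f \<in> smooth_algebra n U F" and i: "i < n"
  then show "\<exists>f'\<in>smooth_algebra n U F. \<forall>x\<in>U.
      ((\<lambda>t. f (x(i := t))) has_real_derivative f' x) (at (x i))"
  proof induction
    case (generator f)
    then show ?case using der i by blast
  next
    case (smooth f)
    then show ?case using i smooth_real_on_has_pderiv smooth_real_on_pderiv smooth_algebra.smooth by blast
  next
    case (add f g)
    obtain f' where f': "f' \<in> smooth_algebra n U F"
      and df: "\<And>x. x \<in> U \<Longrightarrow> ((\<lambda>t. f (x(i := t))) has_real_derivative f' x) (at (x i))"
      using add.IH(1) i by blast
    obtain g' where g': "g' \<in> smooth_algebra n U F"
      and dg: "\<And>x. x \<in> U \<Longrightarrow> ((\<lambda>t. g (x(i := t))) has_real_derivative g' x) (at (x i))"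
      using add.IH(2) i by blast
    show ?case
    proof (intro bexI ballI)
      show "(\<lambda>x. f' x + g' x) \<in> smooth_algebra n U F"
        using f' g' by (rule smooth_algebra.add)
      show "((\<lambda>t. f (x(i := t)) + g (x(i := t))) has_real_derivative f' x + g' x) (at (x i))"
        if "x \<in> U" for x
        using df[OF that] dg[OF that] by (rule DERIV_add)
    qed
  next
    case (mult f g)
    obtain f' where f': "f' \<in> smooth_algebra n U F"
      and df: "\<And>x. x \<in> U \<Longrightarrow> ((\<lambda>t. f (x(i := t))) has_real_derivative f' x) (at (x i))"
      using mult.IH(1) i by blast
    obtain g' where g': "g' \<in> smooth_algebra n U F"
      and dg: "\<And>x. x \<in> U \<Longrightarrow> ((\<lambda>t. g (x(i := t))) has_real_derivative g' x) (at (x i))"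
      using mult.IH(2) i by blast
    show ?case
    proof (intro bexI ballI)
      show "(\<lambda>x. f' x * g x + g' x * f x) \<in> smooth_algebra n U F"
        by (intro smooth_algebra.add smooth_algebra.mult f' g' mult.hyps)
      show "((\<lambda>t. f (x(i := t)) * g (x(i := t))) has_real_derivative f' x * g x + g' x * f x) (at (x i))"
        if "x \<in> U" for x
        using DERIV_mult[OF df[OF that] dg[OF that]] by simp
    qed
  qed
qed

lemma smooth_real_on_const: "openin (Euclidean_space n) U \<Longrightarrow> smooth_real_on n U (\<lambda>x. c)"
  by (rule smooth_real_on_coinduct[where F = "range (\<lambda>c x. c)"]) (auto intro!: exI[of _ "0::real"])

lemma smooth_real_on_coord:
  assumes "openin (Euclidean_space n) U"
  shows "smooth_real_on n U (\<lambda>x. x j)"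
proof (rule smooth_real_on_coinduct_upto[where F = "{\<lambda>x. x j}", OF assms])
  fix f i assume f: "f \<in> {\<lambda>x::nat \<Rightarrow> real. x j}"
  have "(\<lambda>x. if i = j then 1 else 0) \<in> smooth_algebra n U {\<lambda>x. x j}"
    using assms smooth_real_on_const smooth_algebra.smooth by blast
  moreover have "((\<lambda>t. f (x(i := t))) has_real_derivative (if i = j then 1 else 0)) (at (x i))" for x
    using f by (auto intro!: derivative_eq_intros)
  ultimately show "\<exists>f'\<in>smooth_algebra n U {\<lambda>x. x j}. \<forall>x\<in>U. ((\<lambda>t. f (x(i := t))) has_real_derivative f' x) (at (x i))"
    by (intro bexI[of _ "\<lambda>x. if i = j then 1 else 0"]) auto
qed (auto intro: smooth_algebra.generator continuous_on_subset[OF continuous_on_product_coordinates])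

lemma smooth_real_on_add:
  assumes "smooth_real_on n U f" "smooth_real_on n U g"
  shows "smooth_real_on n U (\<lambda>x. f x + g x)"
  using smooth_real_on_open[OF assms(1)]
  by (rule smooth_real_on_coinduct_upto[where F = "{}"])
    (use smooth_algebra.add[OF smooth_algebra.smooth[OF assms(1)] smooth_algebra.smooth[OF assms(2)]] in simp_all)

lemma smooth_real_on_mult:
  assumes "smooth_real_on n U f" "smooth_real_on n U g"
  shows "smooth_real_on n U (\<lambda>x. f x * g x)"
  using smooth_real_on_open[OF assms(1)]
  by (rule smooth_real_on_coinduct_upto[where F = "{}"])
    (use smooth_algebra.mult[OF smooth_algebra.smooth[OF assms(1)] smooth_algebra.smooth[OF assms(2)]] in simp_all)

lemma smooth_real_on_minus: "smooth_real_on n U f \<Longrightarrow> smooth_real_on n U (\<lambda>x. - f x)"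
  using smooth_real_on_mult[OF smooth_real_on_const[OF smooth_real_on_open, of n U f "-1"], of f] by simp

lemma smooth_real_on_diff:
  "smooth_real_on n U f \<Longrightarrow> smooth_real_on n U g \<Longrightarrow> smooth_real_on n U (\<lambda>x. f x - g x)"
  using smooth_real_on_add[of n U f "\<lambda>x. - g x"] smooth_real_on_minus[of n U g] by simp

lemma smooth_real_on_sum:
  assumes "openin (Euclidean_space n) U" "\<And>i. i \<in> I \<Longrightarrow> smooth_real_on n U (f i)"
  shows "smooth_real_on n U (\<lambda>x. \<Sum>i\<in>I. f i x)"
  using assms by (induction I rule: infinite_finite_induct) (auto intro: smooth_real_on_add smooth_real_on_const)

lemma smooth_real_on_prod:
  assumes "openin (Euclidean_space n) U" "\<And>i. i \<in> I \<Longrightarrow> smooth_real_on n U (f i)"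
  shows "smooth_real_on n U (\<lambda>x. \<Prod>i\<in>I. f i x)"
  using assms by (induction I rule: infinite_finite_induct) (auto intro: smooth_real_on_mult smooth_real_on_const)

lemma smooth_real_on_subset:
  assumes "smooth_real_on n U f" "openin (Euclidean_space n) V" "V \<subseteq> U"
  shows "smooth_real_on n V f"
proof (rule smooth_real_on_coinduct[where F = "{f. smooth_real_on n U f}"])
  show "openin (Euclidean_space n) V" by fact
  show "continuous_on V f" if "f \<in> {f. smooth_real_on n U f}" for f
    using that assms smooth_real_on_continuous continuous_on_subset by blast
  show "\<exists>f'\<in>{f. smooth_real_on n U f}. \<forall>x\<in>V. ((\<lambda>t. f (x(i := t))) has_real_derivative f' x) (at (x i))"
    if "f \<in> {f. smooth_real_on n U f}" "i < n" for f i
    using that assms smooth_real_on_has_pderiv smooth_real_on_pderiv by blast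
qed (use assms in auto)

lemma smooth_real_on_local:
  assumes U: "\<And>x. x \<in> U \<Longrightarrow> \<exists>V. x \<in> V \<and> V \<subseteq> U \<and> smooth_real_on n V f"
  shows "smooth_real_on n U f"
proof (rule smooth_real_on_coinduct[where F = "{f. \<forall>x\<in>U. \<exists>V. x \<in> V \<and> V \<subseteq> U \<and> smooth_real_on n V f}"])
  show oU: "openin (Euclidean_space n) U"
    using U by (subst openin_subopen) (metis smooth_real_on_open)
  fix f assume "f \<in> {f. \<forall>x\<in>U. \<exists>V. x \<in> V \<and> V \<subseteq> U \<and> smooth_real_on n V f}"
  then have f: "\<forall>x\<in>U. \<exists>V. x \<in> V \<and> V \<subseteq> U \<and> smooth_real_on n V f" by simp
  show "continuous_on U f"
  proof (rule continuous_on_eq_continuous_within[THEN iffD2], rule ballI)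
    fix x assume "x \<in> U"
    then obtain V where V: "x \<in> V" "V \<subseteq> U" "smooth_real_on n V f" using f by blast
    obtain T where T: "open T" "V = topspace (Euclidean_space n) \<inter> T"
      using smooth_real_on_open[OF V(3)] unfolding openin_Euclidean_iff by blast
    have "U \<inter> T = V" using T V openin_subset[OF oU] by auto
    moreover have "continuous (at x within V) f"
      using smooth_real_on_continuous[OF V(3)] V(1) continuous_on_eq_continuous_within by blast
    ultimately show "continuous (at x within U) f"
      using at_within_nhd[of x T U V] T V(1) by (auto simp: continuous_within)
  qed
  show "\<exists>f'\<in>{f. \<forall>x\<in>U. \<exists>V. x \<in> V \<and> V \<subseteq> U \<and> smooth_real_on n V f}.
      \<forall>x\<in>U. ((\<lambda>t. f (x(i := t))) has_real_derivative f' x) (at (x i))" if "i < n" for i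
  proof (intro bexI[of _ "pderiv_at i f"] ballI CollectI)
    fix x assume "x \<in> U"
    then obtain V where V: "x \<in> V" "V \<subseteq> U" "smooth_real_on n V f" using f by blast
    show "((\<lambda>t. f (x(i := t))) has_real_derivative pderiv_at i f x) (at (x i))"
      by (rule smooth_real_on_has_pderiv[OF V(3) that V(1)])
    show "\<exists>V. x \<in> V \<and> V \<subseteq> U \<and> smooth_real_on n V (pderiv_at i f)"
      using V smooth_real_on_pderiv[OF V(3) that] by blast
  qed
qed (use U in blast)


section \<open>Mean value estimates and the chain rule\<close>

lemma openin_Euclidean_trans:
  assumes "openin (Euclidean_space n) U" "openin (top_of_set U) V"
  shows "openin (Euclidean_space n) V"
proof -
  have "top_of_set U = subtopology (Euclidean_space n) U"
    by (metis Euclidean_space_eq_top_of_set assms(1) inf.absorb2 openin_subset subtopology_subtopology)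
  with assms show ?thesis by (simp add: openin_open_subtopology)
qed

text \<open>
Changing the coordinates one at a time reduces the estimate to the mean value theorem on intervals; the
intermediate points agree with \<open>x\<close> below an index and with \<open>y\<close> from it on.
\<close>

lemma pderiv_bound_imp_lipschitz:
  assumes der: "\<And>z i. z \<in> cube n c r \<Longrightarrow> i < n \<Longrightarrow>
      ((\<lambda>t. h (z(i := t))) has_real_derivative D i z) (at (z i))"
    and bound: "\<And>z i. z \<in> cube n c r \<Longrightarrow> i < n \<Longrightarrow> \<bar>D i z\<bar> \<le> K"
    and x: "x \<in> cube n c r" and y: "y \<in> cube n c r"
  shows "\<bar>h x - h y\<bar> \<le> K * (\<Sum>i<n. \<bar>x i - y i\<bar>)"
proof -
  define w where "w m = (\<lambda>i. if i < m then x i else y i)" for m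
  have w_in: "(w m)(m := t) \<in> cube n c r" if "m < n" "\<bar>t - c m\<bar> < r" for m t
    using that x y by (auto simp: w_def cube_def topspace_Euclidean_space)
  have step: "\<bar>h (w (Suc m)) - h (w m)\<bar> \<le> K * \<bar>x m - y m\<bar>" if m: "m < n" for m
  proof -
    define S where "S = {c m - r <..< c m + r}"
    have S: "t \<in> S \<longleftrightarrow> \<bar>t - c m\<bar> < r" for t by (auto simp: S_def)
    have xy: "x m \<in> S" "y m \<in> S" using x y m by (auto simp: cube_def S)
    have "((\<lambda>t. h ((w m)(m := t))) has_real_derivative D m ((w m)(m := t))) (at t within S)"
      if "t \<in> S" for t
      using der[OF w_in[OF m, of t] m] that S by (simp add: has_field_derivative_at_within)
    moreover have "norm (D m ((w m)(m := t))) \<le> K" if "t \<in> S" for t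
      using bound[OF w_in[OF m, of t] m] that S by simp
    moreover have "convex S" by (simp add: S_def)
    ultimately have "norm (h ((w m)(m := x m)) - h ((w m)(m := y m))) \<le> K * norm (x m - y m)"
      using xy by (intro field_differentiable_bound[of S "\<lambda>t. h ((w m)(m := t))"])
    moreover have "(w m)(m := x m) = w (Suc m)" "(w m)(m := y m) = w m"
      by (auto simp: w_def less_Suc_eq)
    ultimately show ?thesis by simp
  qed
  have ends: "w n = x" "w 0 = y"
    using x y by (auto simp: w_def cube_def topspace_Euclidean_space fun_eq_iff)
  have "h x - h y = (\<Sum>m<n. h (w (Suc m)) - h (w m))"
    using ends by (simp add: sum_lessThan_telescope[of "\<lambda>m. h (w m)" n])
  also have "\<bar>\<dots>\<bar> \<le> (\<Sum>m<n. K * \<bar>x m - y m\<bar>)"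
    by (intro order_trans[OF sum_abs] sum_mono) (auto intro: step)
  finally show ?thesis by (simp add: sum_distrib_left)
qed

lemma continuous_at_cube:
  fixes f :: "nat \<Rightarrow> (nat \<Rightarrow> real) \<Rightarrow> real"
  assumes U: "openin (Euclidean_space n) U" and cont: "\<And>i. i < m \<Longrightarrow> continuous_on U (f i)"
    and x: "x \<in> U" and e: "e > (0::real)"
  shows "\<exists>r>0. cube n x r \<subseteq> U \<and> (\<forall>y\<in>cube n x r. \<forall>i<m. \<bar>f i y - f i x\<bar> < e)"
proof -
  have o: "openin (Euclidean_space n) {y \<in> U. f i y \<in> {f i x - e <..< f i x + e}}" if "i < m" for i
  proof -
    have "openin (top_of_set U) (U \<inter> f i -` {f i x - e <..< f i x + e})"
      using continuous_openin_preimage_gen[OF cont[OF that], of "{f i x - e <..< f i x + e}"] by simp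
    moreover have "U \<inter> f i -` {f i x - e <..< f i x + e} = {y \<in> U. f i y \<in> {f i x - e <..< f i x + e}}"
      by blast
    ultimately show ?thesis using openin_Euclidean_trans[OF U] by simp
  qed
  have "openin (Euclidean_space n) (U \<inter> (\<Inter>i\<in>{..<m}. {y \<in> U. f i y \<in> {f i x - e <..< f i x + e}}))"
    (is "openin _ ?V")
  proof (cases "m = 0")
    case False
    then show ?thesis using o U by (intro openin_Int openin_INT2) auto
  qed (use U in simp)
  moreover have "x \<in> ?V" using x e by auto
  ultimately obtain r where r: "r > 0" "cube n x r \<subseteq> ?V" by (rule cube_nhd)
  have "\<bar>f i y - f i x\<bar> < e" if "y \<in> cube n x r" "i < m" for y i
  proof -
    have "f i y \<in> {f i x - e <..< f i x + e}" using r(2) that by auto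
    then show ?thesis by auto
  qed
  with r show ?thesis by blast
qed

text \<open>
The Lipschitz estimate, applied to the difference of \<open>f\<close> and its linear part at \<open>x\<close>, whose partial
derivatives are small near \<open>x\<close> by continuity.
\<close>

lemma smooth_real_on_frechet:
  assumes f: "smooth_real_on n U f" and x: "x \<in> U" and e: "e > 0"
  shows "\<exists>r>0. cube n x r \<subseteq> U \<and> (\<forall>y\<in>cube n x r.
      \<bar>f y - f x - (\<Sum>i<n. pderiv_at i f x * (y i - x i))\<bar> \<le> e * (\<Sum>i<n. \<bar>y i - x i\<bar>))"
proof -
  have "continuous_on U (pderiv_at i f)" if "i < n" for i
    using smooth_real_on_continuous smooth_real_on_pderiv f that by blast
  then obtain r where
    r: "r > 0" "cube n x r \<subseteq> U" "\<And>y i. y \<in> cube n x r \<Longrightarrow> i < n \<Longrightarrow> \<bar>pderiv_at i f y - pderiv_at i f x\<bar> < e"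
    using continuous_at_cube[OF smooth_real_on_open[OF f], of n "\<lambda>i. pderiv_at i f", OF _ x e] by blast
  define h where "h z = f z - (\<Sum>i<n. pderiv_at i f x * z i)" for z
  have "\<bar>f y - f x - (\<Sum>i<n. pderiv_at i f x * (y i - x i))\<bar> \<le> e * (\<Sum>i<n. \<bar>y i - x i\<bar>)"
    if y: "y \<in> cube n x r" for y
  proof -
    have "x \<in> cube n x r" using r x openin_subset[OF smooth_real_on_open[OF f]] centre_in_cube by blast
    moreover have "((\<lambda>t. h (z(i := t))) has_real_derivative (pderiv_at i f z - pderiv_at i f x)) (at (z i))"
      if z: "z \<in> cube n x r" and i: "i < n" for z i
    proof -
      have "((\<lambda>t. (z(i := t)) j) has_real_derivative (if j = i then 1 else 0)) (at (z i))" for j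
        by (cases "j = i") (auto intro!: derivative_eq_intros)
      then have "((\<lambda>t. \<Sum>j<n. pderiv_at j f x * (z(i := t)) j) has_real_derivative
          (\<Sum>j<n. pderiv_at j f x * (if j = i then 1 else 0))) (at (z i))"
        by (intro DERIV_sum DERIV_cmult)
      then have "((\<lambda>t. \<Sum>j<n. pderiv_at j f x * (z(i := t)) j) has_real_derivative pderiv_at i f x) (at (z i))"
        using i by (simp add: if_distrib[of "\<lambda>u. _ * u"] cong: if_cong del: fun_upd_apply)
      then show ?thesis
        unfolding h_def using smooth_real_on_has_pderiv[OF f i, of z] z r(2)
        by (intro DERIV_diff) auto
    qed
    moreover have "\<bar>pderiv_at i f z - pderiv_at i f x\<bar> \<le> e" if "z \<in> cube n x r" "i < n" for z i
      using r(3)[OF that] by simp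
    ultimately have "\<bar>h y - h x\<bar> \<le> e * (\<Sum>i<n. \<bar>y i - x i\<bar>)"
      using y pderiv_bound_imp_lipschitz[of n x r h "\<lambda>i z. pderiv_at i f z - pderiv_at i f x" e y x] by blast
    then show ?thesis
      by (simp add: h_def sum_subtractf algebra_simps)
  qed
  then show ?thesis using r(1,2) by (intro exI[of _ r] conjI ballI)
qed

text \<open>
The linearization error along the curve is a small multiple of its displacement, which is of the
order of \<open>t - t0\<close>; the error therefore does not contribute to the difference quotient.
\<close>

lemma smooth_real_on_chain:
  assumes a: "smooth_real_on m V a" and ct: "c t0 \<in> V"
    and top: "\<forall>\<^sub>F t in at t0. c t \<in> topspace (Euclidean_space m)"
    and c': "\<And>l. l < m \<Longrightarrow> ((\<lambda>t. c t l) has_real_derivative c' l) (at t0)"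
  shows "((\<lambda>t. a (c t)) has_real_derivative (\<Sum>l<m. pderiv_at l a (c t0) * c' l)) (at t0)"
proof -
  define err where "err t = a (c t) - a (c t0) - (\<Sum>l<m. pderiv_at l a (c t0) * (c t l - c t0 l))" for t
  have slope: "((\<lambda>t. (c t l - c t0 l) / (t - t0)) \<longlongrightarrow> c' l) (at t0)" if "l < m" for l
    using c'[OF that] by (simp add: has_field_derivative_iff)
  have "((\<lambda>t. err t / (t - t0)) \<longlongrightarrow> 0) (at t0)"
  proof (rule tendstoI)
    fix e :: real assume e: "e > 0"
    define B where "B = (\<Sum>l<m. \<bar>c' l\<bar>) + 1"
    have B: "B > 0" by (auto simp: B_def intro: add_nonneg_pos sum_nonneg)
    have eB: "e / (2 * B) > 0" using e B by simp
    obtain r where r: "r > 0" "\<forall>y\<in>cube m (c t0) r.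
      \<bar>a y - a (c t0) - (\<Sum>i<m. pderiv_at i a (c t0) * (y i - c t0 i))\<bar> \<le> (e / (2 * B)) * (\<Sum>i<m. \<bar>y i - c t0 i\<bar>)"
      using smooth_real_on_frechet[OF a ct eB] by (elim exE conjE)
    have "\<forall>\<^sub>F t in at t0. \<forall>l\<in>{..<m}. \<bar>c t l - c t0 l\<bar> < r"
    proof (intro eventually_ball_finite ballI)
      fix l assume "l \<in> {..<m}"
      then have "((\<lambda>t. c t l) \<longlongrightarrow> c t0 l) (at t0)"
        using DERIV_isCont[OF c'] by (auto simp: isCont_def)
      from tendstoD[OF this r(1)] show "\<forall>\<^sub>F t in at t0. \<bar>c t l - c t0 l\<bar> < r"
        by (simp add: dist_real_def)
    qed auto
    then have near: "\<forall>\<^sub>F t in at t0. c t \<in> cube m (c t0) r"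
      using top by eventually_elim (auto simp: cube_def)
    have "((\<lambda>t. \<Sum>l<m. \<bar>(c t l - c t0 l) / (t - t0)\<bar>) \<longlongrightarrow> (\<Sum>l<m. \<bar>c' l\<bar>)) (at t0)"
      using slope by (intro tendsto_sum tendsto_rabs) auto
    then have "\<forall>\<^sub>F t in at t0. (\<Sum>l<m. \<bar>(c t l - c t0 l) / (t - t0)\<bar>) < B"
      by (rule order_tendstoD) (simp add: B_def)
    then show "\<forall>\<^sub>F t in at t0. dist (err t / (t - t0)) 0 < e"
      using near
    proof eventually_elim
      case (elim t)
      have "\<bar>err t\<bar> \<le> (e / (2 * B)) * (\<Sum>l<m. \<bar>c t l - c t0 l\<bar>)"
        using r(2)[rule_format, OF elim(2)] by (simp add: err_def)
      then have "\<bar>err t / (t - t0)\<bar> \<le> (e / (2 * B)) * (\<Sum>l<m. \<bar>c t l - c t0 l\<bar>) / \<bar>t - t0\<bar>"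
        unfolding abs_divide by (rule divide_right_mono) simp
      also have "\<dots> = (e / (2 * B)) * (\<Sum>l<m. \<bar>(c t l - c t0 l) / (t - t0)\<bar>)"
        by (simp add: abs_divide flip: sum_divide_distrib)
      also have "\<dots> \<le> (e / (2 * B)) * B"
        using elim(1) e B by (intro mult_left_mono) auto
      also have "\<dots> < e" using e B by simp
      finally show ?case by simp
    qed
  qed
  moreover have "((\<lambda>t. \<Sum>l<m. pderiv_at l a (c t0) * ((c t l - c t0 l) / (t - t0)))
      \<longlongrightarrow> (\<Sum>l<m. pderiv_at l a (c t0) * c' l)) (at t0)"
    using slope by (intro tendsto_sum tendsto_mult_left) auto
  ultimately have "((\<lambda>t. err t / (t - t0) + (\<Sum>l<m. pderiv_at l a (c t0) * ((c t l - c t0 l) / (t - t0))))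
      \<longlongrightarrow> 0 + (\<Sum>l<m. pderiv_at l a (c t0) * c' l)) (at t0)"
    by (rule tendsto_add)
  moreover have "err t / (t - t0) + (\<Sum>l<m. pderiv_at l a (c t0) * ((c t l - c t0 l) / (t - t0)))
      = (a (c t) - a (c t0)) / (t - t0)" for t
    unfolding err_def times_divide_eq_right sum_divide_distrib[symmetric] add_divide_distrib[symmetric]
    by simp
  ultimately show ?thesis by (simp add: has_field_derivative_iff)
qed

lemma smooth_algebra_sum:
  assumes "openin (Euclidean_space n) U" "\<And>i. i \<in> I \<Longrightarrow> f i \<in> smooth_algebra n U F"
  shows "(\<lambda>x. \<Sum>i\<in>I. f i x) \<in> smooth_algebra n U F"
  using assms
  by (induction I rule: infinite_finite_induct)
    (auto intro: smooth_algebra.add smooth_algebra.smooth smooth_real_on_const)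


section \<open>Smooth maps between open sets\<close>

lemma smooth_on_open: "smooth_on m n U f \<Longrightarrow> openin (Euclidean_space m) U"
  by (simp add: smooth_on_def)

lemma smooth_on_component: "smooth_on m n U f \<Longrightarrow> j < n \<Longrightarrow> smooth_real_on m U (\<lambda>x. f x j)"
  by (simp add: smooth_on_def)

lemma smooth_on_in: "smooth_on m n U f \<Longrightarrow> x \<in> U \<Longrightarrow> f x \<in> topspace (Euclidean_space n)"
  by (auto simp: smooth_on_def)

lemma smooth_on_continuous:
  assumes f: "smooth_on m n U f"
  shows "continuous_on U f"
proof (rule continuous_on_coordinatewise_then_product)
  fix j
  show "continuous_on U (\<lambda>x. f x j)"
  proof (cases "j < n")
    case True
    then show ?thesis using smooth_real_on_continuous smooth_on_component[OF f] by blast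
  next
    case False
    then have "f x j = 0" if "x \<in> U" for x
      using smooth_on_in[OF f that] by (simp add: topspace_Euclidean_space)
    then show ?thesis by (simp cong: continuous_on_cong)
  qed
qed

lemma smooth_on_preimage_open:
  assumes f: "smooth_on m n U f" and W: "openin (Euclidean_space n) W"
  shows "openin (Euclidean_space m) (U \<inter> f -` W)"
proof -
  obtain T where T: "open T" "W = topspace (Euclidean_space n) \<inter> T"
    using W unfolding openin_Euclidean_iff by blast
  have "openin (top_of_set U) (U \<inter> f -` T)"
    using continuous_openin_preimage_gen[OF smooth_on_continuous[OF f] T(1)] .
  moreover have "U \<inter> f -` W = U \<inter> f -` T"
    using T(2) smooth_on_in[OF f] by auto
  ultimately show ?thesis
    using openin_Euclidean_trans[OF smooth_on_open[OF f]] by metis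
qed

text \<open>
Coinduction with the family of all composites with \<open>k\<close>, which the chain rule keeps within the algebra.
\<close>

lemma smooth_real_on_compose:
  assumes k: "smooth_on n m U k" and a: "smooth_real_on m V a" and kU: "k ` U \<subseteq> V"
  shows "smooth_real_on n U (\<lambda>x. a (k x))"
proof (rule smooth_real_on_coinduct_upto[where F = "{\<lambda>x. a (k x) |a. smooth_real_on m V a}"])
  show U: "openin (Euclidean_space n) U" by (rule smooth_on_open[OF k])
  show "(\<lambda>x. a (k x)) \<in> smooth_algebra n U {\<lambda>x. a (k x) |a. smooth_real_on m V a}"
    using a by (auto intro: smooth_algebra.generator)
  fix f assume "f \<in> {\<lambda>x. a (k x) |a. smooth_real_on m V a}"
  then obtain b where b: "f = (\<lambda>x. b (k x))" "smooth_real_on m V b" by blast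
  show "continuous_on U f"
    unfolding b(1)
    by (rule continuous_on_compose2[OF smooth_real_on_continuous[OF b(2)] smooth_on_continuous[OF k] kU])
  fix i assume i: "i < n"
  let ?f' = "\<lambda>x. \<Sum>l<m. pderiv_at l b (k x) * pderiv_at i (\<lambda>x. k x l) x"
  have "?f' \<in> smooth_algebra n U {\<lambda>x. a (k x) |a. smooth_real_on m V a}"
  proof (intro smooth_algebra_sum U smooth_algebra.mult)
    fix l assume l: "l \<in> {..<m}"
    show "(\<lambda>x. pderiv_at l b (k x)) \<in> smooth_algebra n U {\<lambda>x. a (k x) |a. smooth_real_on m V a}"
      using smooth_real_on_pderiv[OF b(2)] l by (auto intro!: smooth_algebra.generator)
    show "pderiv_at i (\<lambda>x. k x l) \<in> smooth_algebra n U {\<lambda>x. a (k x) |a. smooth_real_on m V a}"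
      using smooth_real_on_pderiv[OF smooth_on_component[OF k] i] l by (auto intro!: smooth_algebra.smooth)
  qed
  moreover have "((\<lambda>t. f (x(i := t))) has_real_derivative ?f' x) (at (x i))" if x: "x \<in> U" for x
  proof -
    have "\<forall>\<^sub>F t in at (x i). x(i := t) \<in> U"
      using eventually_fun_upd_in[OF U x i] by (simp add: eventually_nhds_conv_at)
    then have "\<forall>\<^sub>F t in at (x i). k (x(i := t)) \<in> topspace (Euclidean_space m)"
      by eventually_elim (use smooth_on_in[OF k] in auto)
    moreover have "((\<lambda>t. k (x(i := t)) l) has_real_derivative pderiv_at i (\<lambda>x. k x l) x) (at (x i))" if "l < m" for l
      by (rule smooth_real_on_has_pderiv[OF smooth_on_component[OF k that] i x])
    ultimately show ?thesis
      unfolding b(1) using smooth_real_on_chain[OF b(2), of "\<lambda>t. k (x(i := t))" "x i"] x kU by auto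
  qed
  ultimately show "\<exists>f'\<in>smooth_algebra n U {\<lambda>x. a (k x) |a. smooth_real_on m V a}.
      \<forall>x\<in>U. ((\<lambda>t. f (x(i := t))) has_real_derivative f' x) (at (x i))"
    by (intro bexI[of _ ?f'] ballI)
qed

lemma smooth_on_compose:
  assumes "smooth_on l m U f" "smooth_on m n V g" "f ` U \<subseteq> V"
  shows "smooth_on l n U (\<lambda>x. g (f x))"
  using assms smooth_real_on_compose[OF assms(1) _ assms(3)] unfolding smooth_on_def by blast

lemma smooth_on_subset: "smooth_on m n U f \<Longrightarrow> openin (Euclidean_space m) V \<Longrightarrow> V \<subseteq> U \<Longrightarrow> smooth_on m n V f"
  unfolding smooth_on_def using smooth_real_on_subset by blast

lemma smooth_on_local:
  assumes "\<And>x. x \<in> U \<Longrightarrow> \<exists>V. x \<in> V \<and> V \<subseteq> U \<and> smooth_on m n V f"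
  shows "smooth_on m n U f"
  unfolding smooth_on_def
proof (intro conjI allI impI)
  show "openin (Euclidean_space m) U"
    using assms by (subst openin_subopen) (metis smooth_on_open)
  show "f ` U \<subseteq> topspace (Euclidean_space n)"
    using assms smooth_on_in by (metis image_subsetI)
  show "smooth_real_on m U (\<lambda>x. f x j)" if j: "j < n" for j
    by (rule smooth_real_on_local) (use assms smooth_on_component[OF _ j] in metis)
qed

lemma smooth_on_id: "openin (Euclidean_space n) U \<Longrightarrow> smooth_on n n U (\<lambda>x. x)"
  using openin_subset unfolding smooth_on_def by (auto intro: smooth_real_on_coord)

lemma smooth_onI:
  assumes "openin (Euclidean_space m) U" "\<And>j. j < n \<Longrightarrow> smooth_real_on m U (f j)"
  shows "smooth_on m n U (\<lambda>x j. if j < n then f j x else 0)"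
  using assms unfolding smooth_on_def by (auto simp: topspace_Euclidean_space)


section \<open>Division and a smooth step function\<close>

text \<open>
The function \<open>\<phi>\<close> of one variable is given as a member of a family closed under derivatives, which is how
its smoothness enters.
\<close>

lemma smooth_real_on_compose_real:
  assumes f: "smooth_real_on n U f" and fS: "f ` U \<subseteq> S"
    and der: "\<And>\<phi>. \<phi> \<in> \<Phi> \<Longrightarrow> \<exists>\<phi>'\<in>\<Phi>. \<forall>t\<in>S. (\<phi> has_real_derivative \<phi>' t) (at t)"
    and \<phi>: "\<phi> \<in> \<Phi>"
  shows "smooth_real_on n U (\<lambda>x. \<phi> (f x))"
proof (rule smooth_real_on_coinduct_upto[where F = "{\<lambda>x. \<phi> (f x) |\<phi>. \<phi> \<in> \<Phi>}", OF smooth_real_on_open[OF f]])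
  show "(\<lambda>x. \<phi> (f x)) \<in> smooth_algebra n U {\<lambda>x. \<phi> (f x) |\<phi>. \<phi> \<in> \<Phi>}"
    using \<phi> by (auto intro: smooth_algebra.generator)
  fix g assume "g \<in> {\<lambda>x. \<phi> (f x) |\<phi>. \<phi> \<in> \<Phi>}"
  then obtain \<psi> where g: "g = (\<lambda>x. \<psi> (f x))" "\<psi> \<in> \<Phi>" by blast
  obtain \<psi>' where \<psi>': "\<psi>' \<in> \<Phi>" "\<And>t. t \<in> S \<Longrightarrow> (\<psi> has_real_derivative \<psi>' t) (at t)"
    using der[OF g(2)] by blast
  have "continuous_on S \<psi>"
    using \<psi>'(2) DERIV_isCont by (intro continuous_at_imp_continuous_on) blast
  then show "continuous_on U g"
    unfolding g(1) using continuous_on_compose2[OF _ smooth_real_on_continuous[OF f] fS] by blast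
  fix i assume i: "i < n"
  have "(\<lambda>x. \<psi>' (f x) * pderiv_at i f x) \<in> smooth_algebra n U {\<lambda>x. \<phi> (f x) |\<phi>. \<phi> \<in> \<Phi>}"
    by (intro smooth_algebra.mult smooth_algebra.smooth[OF smooth_real_on_pderiv[OF f i]] smooth_algebra.generator)
      (use \<psi>' in auto)
  moreover have "((\<lambda>t. g (x(i := t))) has_real_derivative \<psi>' (f x) * pderiv_at i f x) (at (x i))" if x: "x \<in> U" for x
  proof -
    have "(\<psi> has_real_derivative \<psi>' (f x)) (at (f (x(i := x i))))"
      using \<psi>'(2)[of "f x"] fS x by auto
    from DERIV_chain2[OF this smooth_real_on_has_pderiv[OF f i x]] show ?thesis
      by (simp add: g(1))
  qed
  ultimately show "\<exists>f'\<in>smooth_algebra n U {\<lambda>x. \<phi> (f x) |\<phi>. \<phi> \<in> \<Phi>}.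
      \<forall>x\<in>U. ((\<lambda>t. g (x(i := t))) has_real_derivative f' x) (at (x i))"
    by (intro bexI[of _ "\<lambda>x. \<psi>' (f x) * pderiv_at i f x"] ballI)
qed

lemma smooth_real_on_inverse:
  assumes f: "smooth_real_on n U f" and nz: "\<And>x. x \<in> U \<Longrightarrow> f x \<noteq> 0"
  shows "smooth_real_on n U (\<lambda>x. inverse (f x))"
proof -
  define \<Phi> where "\<Phi> = {\<lambda>t::real. c * inverse t ^ k |c k. True}"
  have "smooth_real_on n U (\<lambda>x. (\<lambda>t. 1 * inverse t ^ 1) (f x))"
  proof (rule smooth_real_on_compose_real[OF f, where S = "- {0}" and \<Phi> = \<Phi>])
    show "f ` U \<subseteq> - {0}" using nz by auto
    show "(\<lambda>t. 1 * inverse t ^ 1) \<in> \<Phi>" unfolding \<Phi>_def by blast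
    fix \<phi> assume "\<phi> \<in> \<Phi>"
    then obtain c k where \<phi>: "\<phi> = (\<lambda>t. c * inverse t ^ k)" unfolding \<Phi>_def by blast
    have "(\<phi> has_real_derivative (- c * real k) * inverse t ^ (k + 1)) (at t)" if "t \<noteq> 0" for t
      unfolding \<phi> using that
      by (auto intro!: derivative_eq_intros) (cases k; simp add: power2_eq_square field_simps)+
    moreover have "(\<lambda>t. (- c * real k) * inverse t ^ (k + 1)) \<in> \<Phi>" unfolding \<Phi>_def by blast
    ultimately show "\<exists>\<phi>'\<in>\<Phi>. \<forall>t\<in>- {0}. (\<phi> has_real_derivative \<phi>' t) (at t)" by force
  qed
  then show ?thesis by simp
qed

lemma smooth_real_on_divide:
  assumes "smooth_real_on n U f" "smooth_real_on n U g" "\<And>x. x \<in> U \<Longrightarrow> g x \<noteq> 0"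
  shows "smooth_real_on n U (\<lambda>x. f x / g x)"
  using smooth_real_on_mult[OF assms(1) smooth_real_on_inverse[OF assms(2,3)]] by (simp add: divide_inverse)

text \<open>
The products of \<open>exp (- 1 / t)\<close> with polynomials in \<open>1 / t\<close>, extended by zero: the closure of the standard
flat function under differentiation.
\<close>

definition flat_poly :: "real poly \<Rightarrow> real \<Rightarrow> real" where
  "flat_poly p t = (if t \<le> 0 then 0 else poly p (1 / t) * exp (- (1 / t)))"

lemma poly_times_exp_minus_tendsto_0: "((\<lambda>s. poly p s * exp (- s)) \<longlongrightarrow> (0::real)) at_top"
proof -
  have "((\<lambda>s. \<Sum>i\<le>Polynomial.degree p. Polynomial.coeff p i * (s ^ i / exp s)) \<longlongrightarrow> (\<Sum>i\<le>Polynomial.degree p. Polynomial.coeff p i * 0)) at_top"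
    by (intro tendsto_sum tendsto_mult_left tendsto_power_div_exp_0)
  moreover have "(\<Sum>i\<le>Polynomial.degree p. Polynomial.coeff p i * (s ^ i / exp s)) = poly p s * exp (- s)" for s
    by (simp add: poly_altdef sum_distrib_right exp_minus divide_inverse mult.assoc)
  ultimately show ?thesis by simp
qed

text \<open>
For \<open>t > 0\<close> this is the product rule, with \<open>s = 1 / t\<close> contributing the factor \<open>- s\<^sup>2\<close> that accounts for the
polynomial \<open>[:0, 0, 1:]\<close>. At \<open>t = 0\<close> the difference quotient is a polynomial in \<open>s\<close> times \<open>exp (- s)\<close>.
\<close>

lemma flat_poly_has_derivative:
  "(flat_poly p has_real_derivative flat_poly ([:0, 0, 1:] * (p - pderiv p)) t) (at t)"
proof -
  consider "t < 0" | "t = 0" | "t > 0" by linarith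
  then show ?thesis
  proof cases
    case 1
    have ev: "\<forall>\<^sub>F s in nhds t. flat_poly p s = 0"
      using eventually_nhds_in_open[of "{..<0::real}" t] 1 by (auto elim!: eventually_mono simp: flat_poly_def)
    show ?thesis
      by (subst DERIV_cong_ev[OF refl ev refl]) (use 1 in \<open>auto simp: flat_poly_def\<close>)
  next
    case 3
    have ev: "\<forall>\<^sub>F s in nhds t. flat_poly p s = poly p (1 / s) * exp (- (1 / s))"
      using eventually_nhds_in_open[of "{0::real<..}" t] 3 by (auto elim!: eventually_mono simp: flat_poly_def)
    have "((\<lambda>s. poly p (1 / s)) has_real_derivative poly (pderiv p) (1 / t) * (- 1 / t\<^sup>2)) (at t)"
      by (rule DERIV_chain2[OF poly_DERIV]) (use 3 in \<open>auto intro!: derivative_eq_intros simp: power2_eq_square\<close>)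
    moreover have "((\<lambda>s. exp (- (1 / s))) has_real_derivative exp (- (1 / t)) * (1 / t\<^sup>2)) (at t)"
      using 3 by (auto intro!: derivative_eq_intros simp: power2_eq_square)
    ultimately have "((\<lambda>s. poly p (1 / s) * exp (- (1 / s))) has_real_derivative
        (poly (pderiv p) (1 / t) * (- 1 / t\<^sup>2)) * exp (- (1 / t)) + (exp (- (1 / t)) * (1 / t\<^sup>2)) * poly p (1 / t)) (at t)"
      by (rule DERIV_mult)
    moreover have "(poly (pderiv p) (1 / t) * (- 1 / t\<^sup>2)) * exp (- (1 / t)) + (exp (- (1 / t)) * (1 / t\<^sup>2)) * poly p (1 / t)
        = flat_poly ([:0, 0, 1:] * (p - pderiv p)) t"
      using 3 by (simp add: flat_poly_def power2_eq_square field_simps)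
    ultimately show ?thesis
      by (subst DERIV_cong_ev[OF refl ev refl]) simp
  next
    case 2
    have "((\<lambda>s. flat_poly p s / s) \<longlongrightarrow> 0) (at_left 0)"
      by (rule tendsto_eventually) (auto simp: eventually_at_filter flat_poly_def)
    moreover have "((\<lambda>s. flat_poly p s / s) \<longlongrightarrow> 0) (at_right 0)"
    proof (rule Lim_transform_eventually)
      show "((\<lambda>s. poly ([:0, 1:] * p) (inverse s) * exp (- inverse s)) \<longlongrightarrow> 0) (at_right 0)"
        by (rule filterlim_compose[OF poly_times_exp_minus_tendsto_0 filterlim_inverse_at_top_right])
      show "\<forall>\<^sub>F s in at_right 0. poly ([:0, 1:] * p) (inverse s) * exp (- inverse s) = flat_poly p s / s"
        by (auto simp: eventually_at_filter flat_poly_def inverse_eq_divide)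
    qed
    ultimately have "((\<lambda>s. flat_poly p s / s) \<longlongrightarrow> 0) (at 0)"
      using filterlim_at_split by blast
    then show ?thesis
      using 2 by (simp add: has_field_derivative_iff flat_poly_def)
  qed
qed

definition smooth_step :: "real \<Rightarrow> real" where
  "smooth_step t = flat_poly 1 t / (flat_poly 1 t + flat_poly 1 (1 - t))"

lemma flat_poly_1: "flat_poly 1 t \<ge> 0" "t > 0 \<Longrightarrow> flat_poly 1 t > 0" "t \<le> 0 \<Longrightarrow> flat_poly 1 t = 0"
  by (auto simp: flat_poly_def)

lemma smooth_step_denominator: "flat_poly 1 t + flat_poly 1 (1 - t) > 0"
  using flat_poly_1(1)[of t] flat_poly_1(1)[of "1 - t"] flat_poly_1(2)[of t] flat_poly_1(2)[of "1 - t"] by linarith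

lemma smooth_step_values:
  "t \<le> 0 \<Longrightarrow> smooth_step t = 0" "t \<ge> 1 \<Longrightarrow> smooth_step t = 1"
  "0 \<le> smooth_step t" "smooth_step t \<le> 1"
proof -
  show "t \<le> 0 \<Longrightarrow> smooth_step t = 0" by (simp add: smooth_step_def flat_poly_1)
  show "t \<ge> 1 \<Longrightarrow> smooth_step t = 1" using flat_poly_1(2)[of t] by (simp add: smooth_step_def flat_poly_1(3))
  show "0 \<le> smooth_step t" "smooth_step t \<le> 1"
    using flat_poly_1(1)[of t] flat_poly_1(1)[of "1 - t"] smooth_step_denominator[of t]
    by (auto simp: smooth_step_def divide_le_eq_1)
qed

lemma smooth_real_on_smooth_step:
  assumes f: "smooth_real_on n U f"
  shows "smooth_real_on n U (\<lambda>x. smooth_step (f x))"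
proof -
  have flat: "smooth_real_on n U (\<lambda>x. flat_poly 1 (g x))" if "smooth_real_on n U g" for g
  proof (rule smooth_real_on_compose_real[OF that, where S = UNIV and \<Phi> = "range flat_poly"])
    show "\<exists>\<phi>'\<in>range flat_poly. \<forall>t\<in>UNIV. (\<phi> has_real_derivative \<phi>' t) (at t)" if "\<phi> \<in> range flat_poly" for \<phi>
      using that flat_poly_has_derivative by blast
  qed auto
  have "smooth_real_on n U (\<lambda>x. 1 - f x)"
    by (intro smooth_real_on_diff smooth_real_on_const[OF smooth_real_on_open[OF f]] f)
  then have "smooth_real_on n U (\<lambda>x. flat_poly 1 (f x) + flat_poly 1 (1 - f x))"
    by (intro smooth_real_on_add flat f)
  then show ?thesis
    unfolding smooth_step_def
    by (rule smooth_real_on_divide[OF flat[OF f]]) (use smooth_step_denominator in \<open>metis less_irrefl\<close>)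
qed


section \<open>The inverse function theorem near the identity\<close>

text \<open>
The bound \<open>1 / (n + 1)\<close> on the entries makes the difference to the identity a contraction for the
\<open>l\<^sup>1\<close>-norm, with factor \<open>n / (n + 1)\<close>. All later estimates come from this.
\<close>

definition near_identity :: "nat \<Rightarrow> (nat \<Rightarrow> nat \<Rightarrow> real) \<Rightarrow> bool" where
  "near_identity n A \<longleftrightarrow> (\<forall>i<n. \<forall>j<n. \<bar>A i j - (if i = j then 1 else 0)\<bar> < 1 / (real n + 1))"

text \<open>
For \<open>S\<close> the \<open>l\<^sup>1\<close>-norm of \<open>v\<close> this is \<open>S \<le> \<parallel>A v\<parallel> + S n / (n + 1)\<close>.
\<close>

lemma near_identity_lower_bound:
  assumes A: "near_identity n A"
  shows "(\<Sum>j<n. \<bar>v j\<bar>) \<le> (real n + 1) * (\<Sum>i<n. \<bar>\<Sum>j<n. A i j * v j\<bar>)"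
proof -
  define S where "S = (\<Sum>j<n. \<bar>v j\<bar>)"
  have "\<bar>v i\<bar> \<le> \<bar>\<Sum>j<n. A i j * v j\<bar> + S / (real n + 1)" if i: "i < n" for i
  proof -
    have "(\<Sum>j<n. (A i j - (if i = j then 1 else 0)) * v j) = (\<Sum>j<n. A i j * v j) - (\<Sum>j<n. if i = j then v j else 0)"
      by (simp add: left_diff_distrib sum_subtractf if_distrib[of "\<lambda>u. u * _"] cong: if_cong)
    then have "v i = (\<Sum>j<n. A i j * v j) - (\<Sum>j<n. (A i j - (if i = j then 1 else 0)) * v j)"
      using i by simp
    moreover have "\<bar>\<Sum>j<n. (A i j - (if i = j then 1 else 0)) * v j\<bar> \<le> (\<Sum>j<n. (1 / (real n + 1)) * \<bar>v j\<bar>)"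
    proof (rule order_trans[OF sum_abs sum_mono])
      fix j assume "j \<in> {..<n}"
      then have "\<bar>A i j - (if i = j then 1 else 0)\<bar> \<le> 1 / (real n + 1)"
        using A i unfolding near_identity_def by (meson lessThan_iff less_imp_le)
      then show "\<bar>(A i j - (if i = j then 1 else 0)) * v j\<bar> \<le> (1 / (real n + 1)) * \<bar>v j\<bar>"
        unfolding abs_mult by (rule mult_right_mono) simp
    qed
    moreover have "(\<Sum>j<n. (1 / (real n + 1)) * \<bar>v j\<bar>) = S / (real n + 1)"
      by (simp add: S_def sum_divide_distrib)
    ultimately show ?thesis by linarith
  qed
  then have "S \<le> (\<Sum>i<n. \<bar>\<Sum>j<n. A i j * v j\<bar> + S / (real n + 1))"
    unfolding S_def by (intro sum_mono) auto
  also have "\<dots> = (\<Sum>i<n. \<bar>\<Sum>j<n. A i j * v j\<bar>) + n * (S / (real n + 1))"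
    by (simp add: sum.distrib)
  finally have "S - n * (S / (real n + 1)) \<le> (\<Sum>i<n. \<bar>\<Sum>j<n. A i j * v j\<bar>)" by simp
  moreover have "S - n * (S / (real n + 1)) = S / (real n + 1)" by (simp add: field_simps)
  ultimately show ?thesis unfolding S_def[symmetric] by (simp add: field_simps)
qed

lemma near_identity_kernel:
  assumes A: "near_identity n A" and 0: "\<And>i. i < n \<Longrightarrow> (\<Sum>j<n. A i j * v j) = 0" and j: "j < n"
  shows "v j = 0"
proof -
  have "(\<Sum>j<n. \<bar>v j\<bar>) \<le> 0"
    using near_identity_lower_bound[OF A, of v] 0 by simp
  then have "\<forall>j\<in>{..<n}. \<bar>v j\<bar> = 0"
    using sum_nonneg_eq_0_iff[of "{..<n}" "\<lambda>j. \<bar>v j\<bar>"] by (simp add: order_antisym sum_nonneg)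
  then show ?thesis using j by simp
qed

text \<open>
An injective linear self-map of \<open>\<real>\<^sup>n\<close> has open image by invariance of domain. The image contains small
multiples of the unit vectors, whose preimages are the columns of the inverse up to scaling.
\<close>

lemma near_identity_right_inverse:
  assumes A: "near_identity n A"
  shows "\<exists>B. \<forall>i<n. \<forall>m<n. (\<Sum>j<n. A i j * B j m) = (if i = m then 1 else 0)"
proof -
  let ?E = "topspace (Euclidean_space n)"
  define L where "L v = (\<lambda>i. if i < n then \<Sum>j<n. A i j * v j else 0)" for v :: "nat \<Rightarrow> real"
  have inj: "inj_on L ?E"
  proof (rule inj_onI)
    fix u v assume u: "u \<in> ?E" "v \<in> ?E" "L u = L v"
    have "(\<Sum>j<n. A i j * (u j - v j)) = 0" if "i < n" for i
      using fun_cong[OF u(3), of i] that by (simp add: L_def right_diff_distrib sum_subtractf)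
    from near_identity_kernel[OF A this] have "u j = v j" if "j < n" for j using that by fastforce
    moreover have "u j = v j" if "\<not> j < n" for j using u that by (simp add: topspace_Euclidean_space)
    ultimately show "u = v" by blast
  qed
  have "continuous_on ?E (\<lambda>v. \<Sum>j<n. A i j * v j)" for i
    by (intro continuous_intros continuous_on_subset[OF continuous_on_product_coordinates]) auto
  then have "continuous_map (Euclidean_space n) euclideanreal (\<lambda>v. \<Sum>j<n. A i j * v j)" for i
    by (metis Euclidean_space_eq_top_of_set continuous_map_iff_continuous)
  then have "continuous_map (Euclidean_space n) (Euclidean_space n) L"
    unfolding L_def continuous_map_componentwise_Euclidean_space by blast
  then have "openin (Euclidean_space n) (L ` ?E)"
    by (intro invariance_of_domain_Euclidean_space inj) simp_all
  moreover have "(\<lambda>i. 0) \<in> L ` ?E"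
    by (rule image_eqI[of _ _ "\<lambda>i. 0"]) (auto simp: L_def topspace_Euclidean_space)
  ultimately obtain r where r: "r > 0" "cube n (\<lambda>i. 0) r \<subseteq> L ` ?E" by (rule cube_nhd)
  have "\<exists>v. L v = (\<lambda>i. if i = m then r / 2 else 0)" if "m < n" for m
  proof -
    have "(\<lambda>i. if i = m then r / 2 else 0) \<in> cube n (\<lambda>i. 0) r"
      using r(1) that by (auto simp: cube_def topspace_Euclidean_space)
    then show ?thesis using r(2) by (metis imageE subsetD)
  qed
  then obtain v where v: "\<And>m. m < n \<Longrightarrow> L (v m) = (\<lambda>i. if i = m then r / 2 else 0)" by metis
  have "(\<Sum>j<n. A i j * (v m j * (2 / r))) = (if i = m then 1 else 0)" if "i < n" "m < n" for i m
  proof -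
    have "(\<Sum>j<n. A i j * v m j) = (if i = m then r / 2 else 0)"
      using fun_cong[OF v[OF that(2)], of i] that by (simp add: L_def)
    moreover have "(\<Sum>j<n. A i j * (v m j * (2 / r))) = (\<Sum>j<n. A i j * v m j) * (2 / r)"
      by (simp only: sum_distrib_right mult.assoc)
    ultimately show ?thesis using r(1) by simp
  qed
  then show ?thesis by (intro exI[of _ "\<lambda>j m. v m j * (2 / r)"]) blast
qed

lemma sum_delta_mult:
  fixes f :: "nat \<Rightarrow> real"
  shows "j < n \<Longrightarrow> (\<Sum>b<n. (if j = b then 1 else 0) * f b) = f j"
    and "j < n \<Longrightarrow> (\<Sum>b<n. f b * (if b = j then 1 else 0)) = f j"
  by (simp_all add: if_distrib[of "\<lambda>u. u * _"] if_distrib[of "\<lambda>u. _ * u"] cong: if_cong)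

text \<open>
The right inverse is also a left inverse because \<open>A\<close> has trivial kernel and \<open>A (B A - 1) = 0\<close>. The lower
bound for \<open>A\<close>, applied to the columns of \<open>B\<close>, bounds the entries of \<open>B\<close>.
\<close>

lemma near_identity_inverse:
  assumes A: "near_identity n A"
  shows "\<exists>B. \<forall>i<n. \<forall>m<n. (\<Sum>j<n. A i j * B j m) = (if i = m then 1 else 0) \<and>
      (\<Sum>j<n. B i j * A j m) = (if i = m then 1 else 0) \<and> \<bar>B i m\<bar> \<le> real n + 1"
proof -
  obtain B where B: "\<And>i m. i < n \<Longrightarrow> m < n \<Longrightarrow> (\<Sum>j<n. A i j * B j m) = (if i = m then 1 else 0)"
    using near_identity_right_inverse[OF A] by blast
  have "(\<Sum>j<n. B i j * A j m) = (if i = m then 1 else 0)" if im: "i < n" "m < n" for i m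
  proof -
    define v where "v i = (\<Sum>j<n. B i j * A j m) - (if i = m then 1 else 0)" for i
    have "(\<Sum>i<n. A k i * v i) = 0" if k: "k < n" for k
    proof -
      have "(\<Sum>i<n. A k i * (\<Sum>j<n. B i j * A j m)) = (\<Sum>j<n. (\<Sum>i<n. A k i * B i j) * A j m)"
        unfolding sum_distrib_left sum_distrib_right
        by (subst sum.swap) (simp add: mult.assoc)
      also have "\<dots> = (\<Sum>j<n. (if k = j then 1 else 0) * A j m)"
        using B[OF k] by (intro sum.cong) auto
      also have "\<dots> = A k m" by (rule sum_delta_mult(1)[OF k])
      finally show ?thesis
        using sum_delta_mult(2)[OF im(2), of "A k"] by (simp add: v_def right_diff_distrib sum_subtractf)
    qed
    from near_identity_kernel[OF A this im(1)] show ?thesis by (simp add: v_def)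
  qed
  moreover have "\<bar>B i m\<bar> \<le> real n + 1" if im: "i < n" "m < n" for i m
  proof -
    have "\<bar>B i m\<bar> \<le> (\<Sum>j<n. \<bar>B j m\<bar>)"
      using im by (intro member_le_sum) auto
    also have "\<dots> \<le> (real n + 1) * (\<Sum>i<n. \<bar>\<Sum>j<n. A i j * B j m\<bar>)"
      by (rule near_identity_lower_bound[OF A])
    also have "(\<Sum>i<n. \<bar>\<Sum>j<n. A i j * B j m\<bar>) = (\<Sum>i<n. if i = m then 1 else 0)"
      using B[OF _ im(2)] by (intro sum.cong) auto
    finally show ?thesis using im by simp
  qed
  ultimately show ?thesis using B by blast
qed

text \<open>
The resolvent identity \<open>B' - B = - B' (A' - A) B\<close>.
\<close>

lemma inverse_matrix_diff:
  fixes A A' B B' :: "nat \<Rightarrow> nat \<Rightarrow> real"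
  assumes B': "\<And>i m. i < n \<Longrightarrow> m < n \<Longrightarrow> (\<Sum>j<n. B' i j * A' j m) = (if i = m then 1 else 0)"
    and B: "\<And>i m. i < n \<Longrightarrow> m < n \<Longrightarrow> (\<Sum>j<n. A i j * B j m) = (if i = m then 1 else 0)"
    and jm: "j < n" "m < n"
  shows "B' j m - B j m = - (\<Sum>a<n. \<Sum>b<n. B' j a * (A' a b - A a b) * B b m)"
proof -
  have "(\<Sum>a<n. \<Sum>b<n. B' j a * A' a b * B b m) = (\<Sum>b<n. (\<Sum>a<n. B' j a * A' a b) * B b m)"
    unfolding sum_distrib_right by (rule sum.swap)
  also have "\<dots> = (\<Sum>b<n. (if j = b then 1 else 0) * B b m)"
    using B'[OF jm(1)] by (intro sum.cong) auto
  also have "\<dots> = B j m" by (rule sum_delta_mult(1)[OF jm(1)])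
  finally have 1: "(\<Sum>a<n. \<Sum>b<n. B' j a * A' a b * B b m) = B j m" .
  have "(\<Sum>a<n. \<Sum>b<n. B' j a * A a b * B b m) = (\<Sum>a<n. B' j a * (\<Sum>b<n. A a b * B b m))"
    by (simp add: sum_distrib_left mult.assoc)
  also have "\<dots> = (\<Sum>a<n. B' j a * (if a = m then 1 else 0))"
    using B[OF _ jm(2)] by (intro sum.cong) auto
  also have "\<dots> = B' j m" by (rule sum_delta_mult(2)[OF jm(2)])
  finally have 2: "(\<Sum>a<n. \<Sum>b<n. B' j a * A a b * B b m) = B' j m" .
  show ?thesis
    using 1 2 by (simp add: right_diff_distrib left_diff_distrib sum_subtractf)
qed

lemma continuous_on_fun_upd_tendsto:
  assumes f: "continuous_on U f" and U: "openin (Euclidean_space n) U" and x: "x \<in> U" and i: "i < n"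
  shows "((\<lambda>t. f (x(i := t))) \<longlongrightarrow> (f x :: real)) (at (x i))"
proof (rule tendstoI)
  fix e :: real assume "e > 0"
  then obtain r where r: "r > 0" "\<forall>y\<in>cube n x r. \<forall>i<1::nat. \<bar>f y - f x\<bar> < e"
    using continuous_at_cube[OF U, of 1 "\<lambda>_. f" x e] f x by blast
  have "\<forall>\<^sub>F t in at (x i). dist t (x i) < r"
    using r(1) eventually_at_ball[of r "x i" UNIV] by (auto elim!: eventually_mono simp: dist_commute)
  then show "\<forall>\<^sub>F t in at (x i). dist (f (x(i := t))) (f x) < e"
  proof eventually_elim
    case (elim t)
    then have "x(i := t) \<in> cube n x r"
      using r(1) x i openin_subset[OF U] by (auto simp: cube_def topspace_Euclidean_space dist_real_def)
    then show ?case using r(2) by (force simp: dist_real_def simp del: fun_upd_apply)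
  qed
qed

text \<open>
The resolvent identity and the uniform bound on the entries of \<open>B\<close> give continuity; divided by the
increment it gives the derivative \<open>- B (\<partial>A) B\<close>, a polynomial in the entries of \<open>B\<close> and smooth functions, and
coinduction applies.
\<close>

lemma smooth_inverse_matrix:
  assumes U: "openin (Euclidean_space n) U"
    and A: "\<And>i j. i < n \<Longrightarrow> j < n \<Longrightarrow> smooth_real_on n U (A i j)"
    and near: "\<And>x. x \<in> U \<Longrightarrow> near_identity n (\<lambda>i j. A i j x)"
  shows "\<exists>B. (\<forall>i<n. \<forall>j<n. smooth_real_on n U (B i j)) \<and>
    (\<forall>x\<in>U. \<forall>i<n. \<forall>m<n. (\<Sum>j<n. A i j x * B j m x) = (if i = m then 1 else 0) \<and> \<bar>B i m x\<bar> \<le> real n + 1)"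
proof -
  have "\<forall>x. \<exists>B. x \<in> U \<longrightarrow> (\<forall>i<n. \<forall>m<n. (\<Sum>j<n. A i j x * B j m) = (if i = m then 1 else 0) \<and>
      (\<Sum>j<n. B i j * A j m x) = (if i = m then 1 else 0) \<and> \<bar>B i m\<bar> \<le> real n + 1)"
    using near_identity_inverse[OF near] by blast
  from choice[OF this] obtain B0 where B0: "\<forall>x. x \<in> U \<longrightarrow> (\<forall>i<n. \<forall>m<n.
      (\<Sum>j<n. A i j x * B0 x j m) = (if i = m then 1 else 0) \<and>
      (\<Sum>j<n. B0 x i j * A j m x) = (if i = m then 1 else 0) \<and> \<bar>B0 x i m\<bar> \<le> real n + 1)"
    by blast
  define B where "B i j x = B0 x i j" for i j x
  have AB: "(\<Sum>j<n. A i j x * B j m x) = (if i = m then 1 else 0)"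
    and BA: "(\<Sum>j<n. B i j x * A j m x) = (if i = m then 1 else 0)"
    and bound: "\<bar>B i m x\<bar> \<le> real n + 1" if "x \<in> U" "i < n" "m < n" for x i m
    using B0 that by (auto simp: B_def)
  have diff: "B j m y - B j m x = - (\<Sum>a<n. \<Sum>b<n. B j a y * (A a b y - A a b x) * B b m x)"
    if "x \<in> U" "y \<in> U" "j < n" "m < n" for x y j m
    by (rule inverse_matrix_diff) (use BA AB that in auto)
  have cont: "continuous_on U (B j m)" if jm: "j < n" "m < n" for j m
    unfolding continuous_on_def
  proof (rule ballI, rule LIM_zero_cancel)
    fix x assume x: "x \<in> U"
    have ev: "\<forall>\<^sub>F y in at x within U. norm (B j m y - B j m x) \<le>
        (\<Sum>a<n. \<Sum>b<n. (real n + 1) * \<bar>A a b y - A a b x\<bar> * (real n + 1))"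
      unfolding eventually_at_topological
    proof (intro exI[of _ UNIV] conjI ballI impI)
      fix y assume y: "y \<in> U"
      have "\<bar>B j m y - B j m x\<bar> \<le> (\<Sum>a<n. \<Sum>b<n. \<bar>B j a y * (A a b y - A a b x) * B b m x\<bar>)"
        unfolding diff[OF x y jm] abs_minus_cancel
        by (intro order_trans[OF sum_abs] sum_mono) auto
      also have "\<dots> \<le> (\<Sum>a<n. \<Sum>b<n. (real n + 1) * \<bar>A a b y - A a b x\<bar> * (real n + 1))"
        unfolding abs_mult using x y jm by (intro sum_mono mult_mono bound) auto
      finally show "norm (B j m y - B j m x) \<le> (\<Sum>a<n. \<Sum>b<n. (real n + 1) * \<bar>A a b y - A a b x\<bar> * (real n + 1))"
        by simp
    qed auto
    have "((\<lambda>y. A a b y - A a b x) \<longlongrightarrow> 0) (at x within U)" if "a < n" "b < n" for a b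
      using smooth_real_on_continuous[OF A[OF that]] x by (intro LIM_zero) (auto simp: continuous_on_def)
    then have "((\<lambda>y. \<Sum>a<n. \<Sum>b<n. (real n + 1) * \<bar>A a b y - A a b x\<bar> * (real n + 1)) \<longlongrightarrow>
        (\<Sum>a<n. \<Sum>b<n. (real n + 1) * \<bar>0\<bar> * (real n + 1))) (at x within U)"
      by (intro tendsto_sum tendsto_mult tendsto_const tendsto_rabs) auto
    then show "((\<lambda>y. B j m y - B j m x) \<longlongrightarrow> 0) (at x within U)"
      by (intro Lim_null_comparison[OF ev]) simp
  qed
  define F where "F = {B j m |j m. j < n \<and> m < n}"
  have "smooth_real_on n U f" if "f \<in> F" for f
  proof (rule smooth_real_on_coinduct_upto[OF U, where F = F])
    show "f \<in> smooth_algebra n U F" using that by (rule smooth_algebra.generator)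
    fix f assume "f \<in> F"
    then obtain j m where f: "f = B j m" and jm: "j < n" "m < n" unfolding F_def by blast
    show "continuous_on U f" using cont jm f by blast
    fix i assume i: "i < n"
    let ?f' = "\<lambda>x. \<Sum>a<n. \<Sum>b<n. (- 1) * (B j a x * pderiv_at i (A a b) x * B b m x)"
    have "?f' \<in> smooth_algebra n U F"
      using jm i
      by (intro smooth_algebra_sum U smooth_algebra.mult smooth_algebra.smooth[OF smooth_real_on_const]
          smooth_algebra.smooth[OF smooth_real_on_pderiv] A smooth_algebra.generator)
        (auto simp: F_def)
    moreover have "((\<lambda>t. f (x(i := t))) has_real_derivative ?f' x) (at (x i))" if x: "x \<in> U" for x
      unfolding has_field_derivative_iff
    proof (rule Lim_transform_eventually)
      have "((\<lambda>t. B j a (x(i := t))) \<longlongrightarrow> B j a x) (at (x i))" if "a < n" for a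
        by (rule continuous_on_fun_upd_tendsto[OF cont[OF jm(1) that] U x i])
      moreover have "((\<lambda>t. (A a b (x(i := t)) - A a b x) / (t - x i)) \<longlongrightarrow> pderiv_at i (A a b) x) (at (x i))"
        if "a < n" "b < n" for a b
        using smooth_real_on_has_pderiv[OF A[OF that] i x] by (simp add: has_field_derivative_iff)
      ultimately show "((\<lambda>t. \<Sum>a<n. \<Sum>b<n. (- 1) * (B j a (x(i := t)) * ((A a b (x(i := t)) - A a b x) / (t - x i)) * B b m x)) \<longlongrightarrow> ?f' x) (at (x i))"
        by (intro tendsto_sum tendsto_mult tendsto_const) auto
      have "\<forall>\<^sub>F t in at (x i). x(i := t) \<in> U"
        using eventually_fun_upd_in[OF U x i] by (simp add: eventually_nhds_conv_at)
      then show "\<forall>\<^sub>F t in at (x i). (\<Sum>a<n. \<Sum>b<n. (- 1) * (B j a (x(i := t)) * ((A a b (x(i := t)) - A a b x) / (t - x i)) * B b m x))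
          = (f (x(i := t)) - f (x(i := x i))) / (t - x i)"
      proof eventually_elim
        case (elim t)
        have "(\<Sum>a<n. \<Sum>b<n. (- 1) * (B j a (x(i := t)) * ((A a b (x(i := t)) - A a b x) / (t - x i)) * B b m x))
          = - (\<Sum>a<n. \<Sum>b<n. B j a (x(i := t)) * (A a b (x(i := t)) - A a b x) * B b m x) / (t - x i)"
          by (simp add: sum_divide_distrib sum_negf del: fun_upd_apply)
        also have "\<dots> = (B j m (x(i := t)) - B j m x) / (t - x i)"
          using diff[OF x elim jm] by simp
        finally show ?case by (simp add: f)
      qed
    qed
    ultimately show "\<exists>f'\<in>smooth_algebra n U F. \<forall>x\<in>U. ((\<lambda>t. f (x(i := t))) has_real_derivative f' x) (at (x i))"
      by (intro bexI[of _ ?f'] ballI)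
  qed
  then have "\<forall>i<n. \<forall>j<n. smooth_real_on n U (B i j)" unfolding F_def by blast
  then show ?thesis using AB bound by (intro exI[of _ B]) blast
qed

definition jacobian_matrix :: "((nat \<Rightarrow> real) \<Rightarrow> nat \<Rightarrow> real) \<Rightarrow> (nat \<Rightarrow> real) \<Rightarrow> nat \<Rightarrow> nat \<Rightarrow> real" where
  "jacobian_matrix f x l i = pderiv_at i (\<lambda>x. f x l) x"

text \<open>
\<open>G\<close> minus the identity strictly contracts \<open>l\<^sup>1\<close>-distances on the cube.
\<close>

lemma near_identity_imp_inj_on:
  assumes G: "smooth_on n n (cube n c r) G"
    and near: "\<And>x. x \<in> cube n c r \<Longrightarrow> near_identity n (jacobian_matrix G x)"
  shows "inj_on G (cube n c r)"
proof (rule inj_onI)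
  fix x y assume x: "x \<in> cube n c r" and y: "y \<in> cube n c r" and eq: "G x = G y"
  define S where "S = (\<Sum>i<n. \<bar>x i - y i\<bar>)"
  have "\<bar>x l - y l\<bar> \<le> (1 / (real n + 1)) * S" if l: "l < n" for l
  proof -
    have "\<bar>(G x l - x l) - (G y l - y l)\<bar> \<le> (1 / (real n + 1)) * S"
      unfolding S_def
    proof (rule pderiv_bound_imp_lipschitz[OF _ _ x y, where D = "\<lambda>i z. jacobian_matrix G z l i - (if l = i then 1 else 0)"])
      fix z i assume z: "z \<in> cube n c r" and i: "i < n"
      show "\<bar>jacobian_matrix G z l i - (if l = i then 1 else 0)\<bar> \<le> 1 / (real n + 1)"
        using near[OF z] l i unfolding near_identity_def by (meson less_imp_le)
      have "((\<lambda>t. (z(i := t)) l) has_real_derivative (if l = i then 1 else 0)) (at (z i))"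
        by (cases "l = i") (auto intro!: derivative_eq_intros)
      with smooth_real_on_has_pderiv[OF smooth_on_component[OF G l] i z]
      show "((\<lambda>t. G (z(i := t)) l - (z(i := t)) l) has_real_derivative
          jacobian_matrix G z l i - (if l = i then 1 else 0)) (at (z i))"
        unfolding jacobian_matrix_def by (rule DERIV_diff)
    qed
    then show ?thesis using eq by simp
  qed
  then have "S \<le> (\<Sum>l<n. (1 / (real n + 1)) * S)"
    unfolding S_def by (intro sum_mono) auto
  also have "\<dots> = S - S / (real n + 1)" by (simp add: field_simps)
  finally have "S / (real n + 1) \<le> 0" by simp
  then have "S \<le> 0" by (simp add: divide_le_0_iff)
  then have "\<forall>j\<in>{..<n}. \<bar>x j - y j\<bar> = 0"
    unfolding S_def using sum_nonneg_eq_0_iff[of "{..<n}" "\<lambda>j. \<bar>x j - y j\<bar>"] by (simp add: order_antisym sum_nonneg)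
  then have "x j = y j" if "j < n" for j using that by simp
  moreover have "x j = y j" if "\<not> j < n" for j using x y that by (simp add: cube_def topspace_Euclidean_space)
  ultimately show "x = y" by blast
qed

lemma open_injective_image:
  assumes r: "smooth_on n n U r" and inj: "inj_on r U"
  shows "openin (Euclidean_space n) (r ` U)"
proof (rule invariance_of_domain_Euclidean_space[OF smooth_on_open[OF r] _ inj])
  have "U \<subseteq> topspace (Euclidean_space n)" using openin_subset[OF smooth_on_open[OF r]] .
  then show "continuous_map (subtopology (Euclidean_space n) U) (Euclidean_space n) r"
    using smooth_on_continuous[OF r] smooth_on_in[OF r]
    by (auto simp: cm_Euclidean_space_iff_continuous_on Int_absorb1)
qed

lemma continuous_on_injective_inverse:
  assumes r: "smooth_on n n U r" and inj: "inj_on r U"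
  shows "continuous_on (r ` U) (inv_into U r)"
proof (rule continuous_on_inverse_open_map[OF smooth_on_continuous[OF r] refl])
  fix V assume "openin (top_of_set U) V"
  then have V: "openin (Euclidean_space n) V" "V \<subseteq> U"
    using openin_Euclidean_trans[OF smooth_on_open[OF r]] openin_subset[of "top_of_set U" V] by auto
  then have "openin (Euclidean_space n) (r ` V)"
    using open_injective_image[OF smooth_on_subset[OF r]] inj inj_on_subset by blast
  then obtain T where "open T" "r ` V = topspace (Euclidean_space n) \<inter> T"
    unfolding openin_Euclidean_iff by blast
  moreover have "r ` U \<subseteq> topspace (Euclidean_space n)" using smooth_on_in[OF r] by blast
  ultimately show "openin (top_of_set (r ` U)) (r ` V)"
    unfolding openin_open using V(2) by (intro exI[of _ T]) blast
qed (use inj in auto)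

text \<open>
Let \<open>c t\<close> be the preimage of \<open>r x\<close> with its \<open>m\<close>-th coordinate replaced by \<open>t\<close>, let \<open>h = t - r x m\<close>, and let
\<open>v = c t - x - h B\<^sub>m\<close> with \<open>B\<^sub>m\<close> the \<open>m\<close>-th column of \<open>B\<close>. The Jacobian maps \<open>v\<close> to the linearization error of
\<open>r\<close>, which is small compared to \<open>c t - x\<close>. The lower bound for the Jacobian shows first that \<open>c t - x\<close> is
of the order of \<open>h\<close>, and then that \<open>v\<close> is small compared to \<open>h\<close>.
\<close>

lemma inverse_has_pderiv:
  assumes r: "smooth_on n n U r" and inj: "inj_on r U"
    and near: "near_identity n (jacobian_matrix r x)" and x: "x \<in> U"
    and B: "\<And>i m. i < n \<Longrightarrow> m < n \<Longrightarrow> (\<Sum>j<n. jacobian_matrix r x i j * B j m) = (if i = m then 1 else 0)"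
    and bound: "\<And>i m. i < n \<Longrightarrow> m < n \<Longrightarrow> \<bar>B i m\<bar> \<le> real n + 1"
    and m: "m < n" and l: "l < n"
  shows "((\<lambda>t. inv_into U r ((r x)(m := t)) l) has_real_derivative B l m) (at (r x m))"
proof -
  define c where "c t = inv_into U r ((r x)(m := t))" for t
  have oV: "openin (Euclidean_space n) (r ` U)" by (rule open_injective_image[OF r inj])
  have cx: "c (r x m) = x" using inj x by (simp add: c_def)
  have evU: "\<forall>\<^sub>F t in at (r x m). (r x)(m := t) \<in> r ` U"
    using eventually_fun_upd_in[OF oV _ m, of "r x"] x by (simp add: eventually_nhds_conv_at)
  have clim: "((\<lambda>t. c t j) \<longlongrightarrow> x j) (at (r x m))" for j
  proof -
    have "continuous_on (r ` U) (\<lambda>y. inv_into U r y j)"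
      by (rule continuous_on_product_then_coordinatewise[OF continuous_on_injective_inverse[OF r inj]])
    from continuous_on_fun_upd_tendsto[OF this oV _ m, of "r x"] show ?thesis
      using x inj by (simp add: c_def)
  qed
  define N where "N = real n + 1"
  have N: "N \<ge> 1" by (simp add: N_def)
  have "((\<lambda>t. (c t l - x l) / (t - r x m) - B l m) \<longlongrightarrow> 0) (at (r x m))"
  proof (rule tendstoI)
    fix e :: real assume e: "e > 0"
    \<comment> \<open>The first bound lets the error be absorbed into half of \<open>S\<close> below; the second one makes the final bound less than \<open>e\<close>.\<close>
    define d where "d = min (1 / (2 * N * N)) (e / (4 * N * N * N * N))"
    have d: "d > 0" "N * N * d \<le> 1 / 2" "2 * N * N * N * N * d < e"
    proof -
      show "d > 0" using e N by (simp add: d_def)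
      have "N * N * d \<le> N * N * (1 / (2 * N * N))" by (intro mult_left_mono) (use N in \<open>auto simp: d_def\<close>)
      then show "N * N * d \<le> 1 / 2" using N by simp
      have "2 * N * N * N * N * d \<le> 2 * N * N * N * N * (e / (4 * N * N * N * N))"
        by (intro mult_left_mono) (use N in \<open>auto simp: d_def\<close>)
      then show "2 * N * N * N * N * d < e" using N e by simp
    qed
    define good where "good j s \<longleftrightarrow> s > 0 \<and> (\<forall>y\<in>cube n x s.
        \<bar>r y j - r x j - (\<Sum>i<n. jacobian_matrix r x j i * (y i - x i))\<bar> \<le> d * (\<Sum>i<n. \<bar>y i - x i\<bar>))" for j s
    have "\<exists>s. good j s" if "j < n" for j
      using smooth_real_on_frechet[OF smooth_on_component[OF r that] x d(1)] unfolding jacobian_matrix_def good_def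
      by (elim exE conjE) (rule exI, rule conjI, assumption+)
    then obtain s0 where s0: "\<And>j. j < n \<Longrightarrow> good j (s0 j)" by metis
    have s: "s0 j > 0" "\<And>y. y \<in> cube n x (s0 j) \<Longrightarrow>
        \<bar>r y j - r x j - (\<Sum>i<n. jacobian_matrix r x j i * (y i - x i))\<bar> \<le> d * (\<Sum>i<n. \<bar>y i - x i\<bar>)"
      if "j < n" for j
      using s0[OF that] by (auto simp: good_def)
    have "\<forall>\<^sub>F t in at (r x m). \<forall>j\<in>{..<n}. \<forall>i\<in>{..<n}. \<bar>c t i - x i\<bar> < s0 j"
    proof (intro eventually_ball_finite ballI)
      fix j i assume "j \<in> {..<n}" "i \<in> {..<n}"
      with tendstoD[OF clim[of i] s(1)[of j]] show "\<forall>\<^sub>F t in at (r x m). \<bar>c t i - x i\<bar> < s0 j"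
        by (simp add: dist_real_def)
    qed auto
    then show "\<forall>\<^sub>F t in at (r x m). dist ((c t l - x l) / (t - r x m) - B l m) 0 < e"
      using evU eventually_neq_at_within[of "r x m" "r x m" UNIV]
    proof eventually_elim
      case (elim t)
      define h where "h = t - r x m"
      have h: "h \<noteq> 0" using elim(3) by (simp add: h_def)
      have ctU: "c t \<in> U" and rct: "r (c t) = (r x)(m := t)"
        using elim(2) by (auto simp: c_def inv_into_into f_inv_into_f)
      then have "c t \<in> topspace (Euclidean_space n)"
        using openin_subset[OF smooth_on_open[OF r]] by blast
      then have ct: "c t \<in> cube n x (s0 j)" if "j < n" for j
        using elim(1) that by (auto simp: cube_def)
      define S where "S = (\<Sum>i<n. \<bar>c t i - x i\<bar>)"
      define v where "v i = c t i - x i - h * B i m" for i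
      have Av: "\<bar>\<Sum>i<n. jacobian_matrix r x j i * v i\<bar> \<le> d * S" if j: "j < n" for j
      proof -
        have "(\<Sum>i<n. jacobian_matrix r x j i * v i) = (\<Sum>i<n. jacobian_matrix r x j i * (c t i - x i)) - h * (\<Sum>i<n. jacobian_matrix r x j i * B i m)"
          by (simp add: v_def right_diff_distrib sum_subtractf sum_distrib_left mult.left_commute)
        also have "h * (\<Sum>i<n. jacobian_matrix r x j i * B i m) = r (c t) j - r x j"
          unfolding B[OF j m] rct by (simp add: h_def)
        finally show ?thesis using s(2)[OF j ct[OF j]] unfolding S_def by linarith
      qed
      have "(\<Sum>i<n. \<bar>v i\<bar>) \<le> N * (\<Sum>j<n. \<bar>\<Sum>i<n. jacobian_matrix r x j i * v i\<bar>)"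
        unfolding N_def by (rule near_identity_lower_bound[OF near])
      also have "\<dots> \<le> N * (\<Sum>j<n. d * S)"
        using N Av by (intro mult_left_mono sum_mono) auto
      also have "\<dots> \<le> N * (N * (d * S))"
        using d(1) by (intro mult_left_mono) (auto simp: N_def S_def sum_nonneg distrib_right)
      finally have v1: "(\<Sum>i<n. \<bar>v i\<bar>) \<le> N * N * d * S" by (simp add: mult.assoc)
      have "S \<le> (\<Sum>i<n. \<bar>v i\<bar> + \<bar>h\<bar> * N)"
        unfolding S_def
      proof (rule sum_mono)
        fix i assume "i \<in> {..<n}"
        then have "\<bar>h * B i m\<bar> \<le> \<bar>h\<bar> * N"
          unfolding abs_mult N_def using bound m by (intro mult_left_mono) auto
        then show "\<bar>c t i - x i\<bar> \<le> \<bar>v i\<bar> + \<bar>h\<bar> * N" unfolding v_def by linarith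
      qed
      also have "\<dots> \<le> (\<Sum>i<n. \<bar>v i\<bar>) + N * (\<bar>h\<bar> * N)"
        using N by (simp add: sum.distrib N_def distrib_right)
      also have "\<dots> \<le> S / 2 + N * (\<bar>h\<bar> * N)"
      proof -
        have "N * N * d * S \<le> 1 / 2 * S"
          using d(2) by (rule mult_right_mono) (simp add: S_def sum_nonneg)
        then show ?thesis using v1 by simp
      qed
      finally have S: "S \<le> 2 * N * N * \<bar>h\<bar>" by (simp add: field_simps)
      have "\<bar>v l\<bar> \<le> (\<Sum>i<n. \<bar>v i\<bar>)" using l by (intro member_le_sum) auto
      also have "\<dots> \<le> N * N * d * (2 * N * N * \<bar>h\<bar>)"
        using v1 S d(1) N by (meson mult_left_mono mult_nonneg_nonneg order_trans less_imp_le zero_le_one)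
      also have "\<dots> = (2 * N * N * N * N * d) * \<bar>h\<bar>" by simp
      also have "\<dots> < e * \<bar>h\<bar>" using d(3) h by (intro mult_strict_right_mono) auto
      finally have "\<bar>v l / h\<bar> < e" using h by (simp add: abs_divide field_simps)
      moreover have "v l / h = (c t l - x l) / h - B l m" using h by (simp add: v_def diff_divide_distrib)
      ultimately show ?case unfolding h_def[symmetric] by simp
    qed
  qed
  then have "((\<lambda>t. (c t l - x l) / (t - r x m)) \<longlongrightarrow> B l m) (at (r x m))" by (rule LIM_zero_cancel)
  then show ?thesis
    unfolding has_field_derivative_iff c_def[symmetric] cx .
qed

text \<open>
Composites with the inverse map form a family closed under partial derivatives, since the
Jacobian of the inverse is a smooth matrix composed with the inverse.
\<close>

proposition smooth_on_inverse:
  assumes r: "smooth_on n n U r" and inj: "inj_on r U"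
    and near: "\<And>x. x \<in> U \<Longrightarrow> near_identity n (jacobian_matrix r x)"
  shows "smooth_on n n (r ` U) (inv_into U r)"
proof -
  have U: "openin (Euclidean_space n) U" by (rule smooth_on_open[OF r])
  have V: "openin (Euclidean_space n) (r ` U)" by (rule open_injective_image[OF r inj])
  let ?k = "inv_into U r"
  have "smooth_real_on n U (\<lambda>x. jacobian_matrix r x i j)" if "i < n" "j < n" for i j
    using smooth_real_on_pderiv[OF smooth_on_component[OF r that(1)] that(2)] by (simp add: jacobian_matrix_def[abs_def])
  then have "\<exists>B. (\<forall>i<n. \<forall>j<n. smooth_real_on n U (B i j)) \<and> (\<forall>x\<in>U. \<forall>i<n. \<forall>m<n.
      (\<Sum>j<n. jacobian_matrix r x i j * B j m x) = (if i = m then 1 else 0) \<and> \<bar>B i m x\<bar> \<le> real n + 1)"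
    by (intro smooth_inverse_matrix[OF U] near) auto
  then obtain B where
    B': "\<forall>i<n. \<forall>j<n. smooth_real_on n U (B i j)"
      "\<forall>x\<in>U. \<forall>i<n. \<forall>m<n. (\<Sum>j<n. jacobian_matrix r x i j * B j m x) = (if i = m then 1 else 0) \<and> \<bar>B i m x\<bar> \<le> real n + 1"
    by (elim exE conjE)
  then have B: "\<And>i j. i < n \<Longrightarrow> j < n \<Longrightarrow> smooth_real_on n U (B i j)"
    "\<And>x i m. x \<in> U \<Longrightarrow> i < n \<Longrightarrow> m < n \<Longrightarrow> (\<Sum>j<n. jacobian_matrix r x i j * B j m x) = (if i = m then 1 else 0)"
    "\<And>x i m. x \<in> U \<Longrightarrow> i < n \<Longrightarrow> m < n \<Longrightarrow> \<bar>B i m x\<bar> \<le> real n + 1"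
    by blast+
  define F where "F = {\<lambda>y. a (?k y) |a. smooth_real_on n U a}"
  have smooth: "smooth_real_on n (r ` U) f" if "f \<in> F" for f
  proof (rule smooth_real_on_coinduct[OF V _ _ that])
    fix f assume "f \<in> F"
    then obtain a where a: "f = (\<lambda>y. a (?k y))" "smooth_real_on n U a" unfolding F_def by blast
    show "continuous_on (r ` U) f"
      unfolding a(1)
      by (rule continuous_on_compose2[OF smooth_real_on_continuous[OF a(2)] continuous_on_injective_inverse[OF r inj]])
        (auto simp: inv_into_into)
    fix m assume m: "m < n"
    let ?f' = "\<lambda>y. (\<Sum>l<n. pderiv_at l a (?k y) * B l m (?k y))"
    have "smooth_real_on n U (\<lambda>x. \<Sum>l<n. pderiv_at l a x * B l m x)"
      using m by (intro smooth_real_on_sum U smooth_real_on_mult smooth_real_on_pderiv[OF a(2)] B(1)) auto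
    then have "?f' \<in> F"
      unfolding F_def by (intro CollectI exI[of _ "\<lambda>x. \<Sum>l<n. pderiv_at l a x * B l m x"] conjI refl)
    moreover have "((\<lambda>t. f (y(m := t))) has_real_derivative ?f' y) (at (y m))" if y: "y \<in> r ` U" for y
    proof -
      obtain x where x: "x \<in> U" "y = r x" using y by blast
      have k: "?k (y(m := y m)) = x" using x inj by simp
      have "\<forall>\<^sub>F t in at (y m). y(m := t) \<in> r ` U"
        using eventually_fun_upd_in[OF V y m] by (simp add: eventually_nhds_conv_at)
      then have "\<forall>\<^sub>F t in at (y m). ?k (y(m := t)) \<in> topspace (Euclidean_space n)"
        by eventually_elim (meson U inv_into_into openin_subset subsetD)
      moreover have "((\<lambda>t. ?k (y(m := t)) l) has_real_derivative B l m x) (at (y m))" if "l < n" for l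
        unfolding x(2) using inverse_has_pderiv[OF r inj near[OF x(1)] x(1), of "\<lambda>i j. B i j x"] B(2,3)[OF x(1)] m that
        by blast
      ultimately have "((\<lambda>t. a (?k (y(m := t)))) has_real_derivative
          (\<Sum>l<n. pderiv_at l a (?k (y(m := y m))) * B l m x)) (at (y m))"
        by (intro smooth_real_on_chain[OF a(2)]) (use k x in auto)
      then show ?thesis using k by (simp add: a(1))
    qed
    ultimately show "\<exists>f'\<in>F. \<forall>y\<in>r ` U. ((\<lambda>t. f (y(m := t))) has_real_derivative f' y) (at (y m))"
      by (intro bexI[of _ ?f'] ballI)
  qed
  show ?thesis
    unfolding smooth_on_def
  proof (intro conjI allI impI V)
    show "?k ` r ` U \<subseteq> topspace (Euclidean_space n)"
      using openin_subset[OF U] inj by auto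
    fix j assume "j < n"
    show "smooth_real_on n (r ` U) (\<lambda>y. ?k y j)"
      by (rule smooth) (use smooth_real_on_coord[OF U, of j] in \<open>auto simp: F_def\<close>)
  qed
qed


section \<open>Smooth maps into and between manifolds\<close>

lemma smooth_structure_atlas: "smooth_structure n X A \<Longrightarrow> smooth_atlas n X A"
  by (simp add: smooth_structure_def)

lemma atlas_chart: "smooth_atlas n X A \<Longrightarrow> c \<in> A \<Longrightarrow> is_chart n X c"
  by (simp add: smooth_atlas_def)

lemma atlas_cover:
  assumes "smooth_atlas n X A" "q \<in> topspace X"
  obtains U \<phi> where "(U, \<phi>) \<in> A" "q \<in> U"
proof -
  have "q \<in> \<Union> (fst ` A)" using assms by (simp add: smooth_atlas_def)
  then show ?thesis using that by (metis UN_E prod.collapse)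
qed

lemma atlas_transition:
  assumes "smooth_atlas n X A" "(U, \<phi>) \<in> A" "(V, \<psi>) \<in> A"
  shows "smooth_on n n (\<phi> ` (U \<inter> V)) (\<psi> \<circ> inv_into U \<phi>)"
proof -
  have "smoothly_compatible n (U, \<phi>) (V, \<psi>)"
    using assms unfolding smooth_atlas_def by blast
  then show ?thesis by (simp add: smoothly_compatible_def)
qed

lemma chart_open: "is_chart n X (U, \<phi>) \<Longrightarrow> openin X U"
  by (simp add: is_chart_def)

lemma chart_image_open: "is_chart n X (U, \<phi>) \<Longrightarrow> openin (Euclidean_space n) (\<phi> ` U)"
  by (simp add: is_chart_def)

lemma chart_homeomorphic_maps:
  assumes c: "is_chart n X (U, \<phi>)"
  shows "homeomorphic_maps (subtopology X U) (subtopology (Euclidean_space n) (\<phi> ` U)) \<phi> (inv_into U \<phi>)"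
proof -
  have U: "topspace (subtopology X U) = U" using is_chart_subset[OF c] by (simp add: Int_absorb1)
  obtain g where g: "homeomorphic_maps (subtopology X U) (subtopology (Euclidean_space n) (\<phi> ` U)) \<phi> g"
    using c unfolding is_chart_def homeomorphic_map_maps by auto
  have "\<phi> ` U \<subseteq> topspace (Euclidean_space n)" using openin_subset[OF chart_image_open[OF c]] .
  then have T: "topspace (subtopology (Euclidean_space n) (\<phi> ` U)) = \<phi> ` U" by (simp add: Int_absorb1)
  have "inv_into U \<phi> y = g y" if "y \<in> \<phi> ` U" for y
    using that g is_chart_inj_on[OF c] U unfolding homeomorphic_maps_def by auto
  with g show ?thesis
    by (elim homeomorphic_maps_eq) (simp_all add: T)
qed

lemma chart_inverse_continuous:
  assumes "is_chart n X (U, \<phi>)"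
  shows "continuous_map (subtopology (Euclidean_space n) (\<phi> ` U)) X (inv_into U \<phi>)"
  using chart_homeomorphic_maps[OF assms] unfolding homeomorphic_maps_def
  by (blast dest: continuous_map_into_fulltopology)

lemma chart_open_map:
  assumes c: "is_chart n X (U, \<phi>)" and V: "openin X V" "V \<subseteq> U"
  shows "openin (Euclidean_space n) (\<phi> ` V)"
proof -
  have "openin (subtopology X U) V" using V chart_open[OF c] by (simp add: openin_open_subtopology)
  moreover have "open_map (subtopology X U) (subtopology (Euclidean_space n) (\<phi> ` U)) \<phi>"
    using c by (simp add: is_chart_def homeomorphic_map_def homeomorphic_imp_open_map)
  ultimately have "openin (subtopology (Euclidean_space n) (\<phi> ` U)) (\<phi> ` V)"
    by (simp add: open_map_def)
  then show ?thesis using openin_open_subtopology[OF chart_image_open[OF c]] by blast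
qed

lemma chart_preimage_open:
  assumes c: "is_chart n X (U, \<phi>)" and S: "openin (Euclidean_space n) S"
  shows "openin X {q \<in> U. \<phi> q \<in> S}"
proof -
  have "continuous_map (subtopology X U) (Euclidean_space n) \<phi>"
    using chart_homeomorphic_maps[OF c] unfolding homeomorphic_maps_def
    by (blast dest: continuous_map_into_fulltopology)
  then have "openin (subtopology X U) {q \<in> topspace (subtopology X U). \<phi> q \<in> S}"
    using S by (rule openin_continuous_map_preimage)
  moreover have "topspace (subtopology X U) = U" using is_chart_subset[OF c] by (simp add: Int_absorb1)
  ultimately have "openin (subtopology X U) {q \<in> U. \<phi> q \<in> S}" by metis
  then show ?thesis using openin_open_subtopology[OF chart_open[OF c]] by blast
qed

lemma image_restrict_inv_into:
  assumes "inj_on \<phi> U"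
  shows "\<phi> ` (U \<inter> f -` V) = \<phi> ` U \<inter> (f \<circ> inv_into U \<phi>) -` V"
  using assms by auto

text \<open>
Smoothness of a map from an open subset of coordinate space to a manifold with atlas \<open>A\<close>. Openness of
the preimage of a chart domain, hence continuity, is part of \<open>smooth_on\<close>.
\<close>

definition smooth_into :: "nat \<Rightarrow> nat \<Rightarrow> 'a chart set \<Rightarrow> (nat \<Rightarrow> real) set \<Rightarrow> ((nat \<Rightarrow> real) \<Rightarrow> 'a) \<Rightarrow> bool" where
  "smooth_into m n A W R \<longleftrightarrow> openin (Euclidean_space m) W \<and>
     (\<forall>(U, \<phi>)\<in>A. smooth_on m n (W \<inter> R -` U) (\<lambda>z. \<phi> (R z)))"

lemma smooth_into_chart:
  "smooth_into m n A W R \<Longrightarrow> (U, \<phi>) \<in> A \<Longrightarrow> smooth_on m n (W \<inter> R -` U) (\<lambda>z. \<phi> (R z))"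
  unfolding smooth_into_def by blast

lemma smooth_into_open: "smooth_into m n A W R \<Longrightarrow> openin (Euclidean_space m) W"
  unfolding smooth_into_def by blast

lemma smooth_into_cong:
  assumes R: "smooth_into m n A W R" and eq: "\<And>x. x \<in> W \<Longrightarrow> R x = R' x"
  shows "smooth_into m n A W R'"
  unfolding smooth_into_def
proof (intro conjI ballI smooth_into_open[OF R])
  fix c assume "c \<in> A"
  moreover obtain U \<phi> where c: "c = (U, \<phi>)" by fastforce
  ultimately have "smooth_on m n (W \<inter> R -` U) (\<lambda>z. \<phi> (R z))" using smooth_into_chart[OF R] by blast
  moreover have "W \<inter> R -` U = W \<inter> R' -` U" using eq by auto
  ultimately have "smooth_on m n (W \<inter> R' -` U) (\<lambda>z. \<phi> (R z))" by simp
  then have "smooth_on m n (W \<inter> R' -` U) (\<lambda>z. \<phi> (R' z))"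
    by (rule smooth_on_cong) (use eq in auto)
  then show "case c of (U, \<phi>) \<Rightarrow> smooth_on m n (W \<inter> R' -` U) (\<lambda>z. \<phi> (R' z))"
    by (simp add: c)
qed

text \<open>
One chart near each point suffices, because the transition maps are smooth.
\<close>

lemma smooth_into_local:
  assumes A: "smooth_atlas n X A"
    and loc: "\<And>z. z \<in> W \<Longrightarrow> \<exists>U \<phi> V. (U, \<phi>) \<in> A \<and> z \<in> V \<and> V \<subseteq> W \<and> R ` V \<subseteq> U \<and> smooth_on m n V (\<lambda>z. \<phi> (R z))"
  shows "smooth_into m n A W R"
  unfolding smooth_into_def
proof (intro conjI ballI)
  show "openin (Euclidean_space m) W"
    using loc by (subst openin_subopen) (metis smooth_on_open)
  fix c assume c: "c \<in> A"
  obtain U' \<phi>' where c': "c = (U', \<phi>')" by fastforce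
  have "smooth_on m n (W \<inter> R -` U') (\<lambda>z. \<phi>' (R z))"
  proof (rule smooth_on_local)
    fix z assume z: "z \<in> W \<inter> R -` U'"
    then obtain U \<phi> V where V: "(U, \<phi>) \<in> A" "z \<in> V" "V \<subseteq> W" "R ` V \<subseteq> U" "smooth_on m n V (\<lambda>z. \<phi> (R z))"
      using loc[of z] by (elim IntE) blast
    have inj: "inj_on \<phi> U" using is_chart_inj_on[OF atlas_chart[OF A V(1)]] .
    have t: "smooth_on n n (\<phi> ` (U \<inter> U')) (\<phi>' \<circ> inv_into U \<phi>)"
      using atlas_transition[OF A V(1)] c c' by blast
    define V' where "V' = V \<inter> (\<lambda>z. \<phi> (R z)) -` (\<phi> ` (U \<inter> U'))"
    have V': "V' = V \<inter> R -` U'"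
      using V(4) inj unfolding V'_def by (auto simp: inj_on_eq_iff subset_iff)
    have o: "openin (Euclidean_space m) V'"
      unfolding V'_def by (rule smooth_on_preimage_open[OF V(5) smooth_on_open[OF t]])
    have "smooth_on m n V' (\<lambda>z. (\<phi>' \<circ> inv_into U \<phi>) (\<phi> (R z)))"
      by (rule smooth_on_compose[OF smooth_on_subset[OF V(5) o] t]) (auto simp: V'_def)
    then have "smooth_on m n V' (\<lambda>z. \<phi>' (R z))"
      by (rule smooth_on_cong) (use V(4) inj V' in auto)
    moreover have "z \<in> V'" "V' \<subseteq> W \<inter> R -` U'" using z V V' by auto
    ultimately show "\<exists>V. z \<in> V \<and> V \<subseteq> W \<inter> R -` U' \<and> smooth_on m n V (\<lambda>z. \<phi>' (R z))" by blast
  qed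
  then show "case c of (U, \<phi>) \<Rightarrow> smooth_on m n (W \<inter> R -` U) (\<lambda>z. \<phi> (R z))" by (simp add: c')
qed

lemma smooth_into_compose:
  assumes R: "smooth_into m n A W R" and k: "smooth_on l m V k" and kV: "k ` V \<subseteq> W"
  shows "smooth_into l n A V (\<lambda>x. R (k x))"
  unfolding smooth_into_def
proof (intro conjI ballI)
  show "openin (Euclidean_space l) V" by (rule smooth_on_open[OF k])
  fix c assume "c \<in> A"
  moreover obtain U \<phi> where c: "c = (U, \<phi>)" by fastforce
  ultimately have s: "smooth_on m n (W \<inter> R -` U) (\<lambda>z. \<phi> (R z))" using smooth_into_chart[OF R] by blast
  have eq: "V \<inter> (\<lambda>x. R (k x)) -` U = V \<inter> k -` (W \<inter> R -` U)" using kV by auto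
  have "smooth_on l n (V \<inter> k -` (W \<inter> R -` U)) (\<lambda>x. \<phi> (R (k x)))"
    by (rule smooth_on_compose[OF smooth_on_subset[OF k smooth_on_preimage_open[OF k smooth_on_open[OF s]]] s]) auto
  then show "case c of (U, \<phi>) \<Rightarrow> smooth_on l n (V \<inter> (\<lambda>x. R (k x)) -` U) (\<lambda>x. \<phi> (R (k x)))"
    by (simp add: c eq)
qed

lemma smooth_into_preimage_open:
  assumes A: "smooth_atlas n X A" and R: "smooth_into m n A W R" and RW: "R ` W \<subseteq> topspace X"
    and T: "openin X T"
  shows "openin (Euclidean_space m) (W \<inter> R -` T)"
proof (subst openin_subopen, intro ballI)
  fix z assume z: "z \<in> W \<inter> R -` T"
  then have "R z \<in> topspace X" using RW by auto
  then obtain U \<phi> where c: "(U, \<phi>) \<in> A" "R z \<in> U" by (rule atlas_cover[OF A])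
  have ch: "is_chart n X (U, \<phi>)" by (rule atlas_chart[OF A c(1)])
  have "openin (Euclidean_space n) (\<phi> ` (U \<inter> T))"
    by (rule chart_open_map[OF ch openin_Int[OF chart_open[OF ch] T]]) simp
  from smooth_on_preimage_open[OF smooth_into_chart[OF R c(1)] this]
  have "openin (Euclidean_space m) (W \<inter> R -` U \<inter> (\<lambda>z. \<phi> (R z)) -` \<phi> ` (U \<inter> T))" .
  moreover have "W \<inter> R -` U \<inter> (\<lambda>z. \<phi> (R z)) -` \<phi> ` (U \<inter> T) = W \<inter> R -` U \<inter> R -` T"
    using is_chart_inj_on[OF ch] by (auto simp: inj_on_eq_iff)
  ultimately show "\<exists>S. openin (Euclidean_space m) S \<and> z \<in> S \<and> S \<subseteq> W \<inter> R -` T"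
    using z c(2) by (intro exI[of _ "W \<inter> R -` U \<inter> R -` T"]) auto
qed

lemma smooth_into_chart_inverse:
  assumes A: "smooth_atlas n X A" and c: "(U, \<phi>) \<in> A"
  shows "smooth_into n n A (\<phi> ` U) (inv_into U \<phi>)"
proof (rule smooth_into_local[OF A])
  fix z assume z: "z \<in> \<phi> ` U"
  have "smooth_on n n (\<phi> ` U) (\<phi> \<circ> inv_into U \<phi>)" using atlas_transition[OF A c c] by simp
  then show "\<exists>V \<psi> S. (V, \<psi>) \<in> A \<and> z \<in> S \<and> S \<subseteq> \<phi> ` U \<and> inv_into U \<phi> ` S \<subseteq> V \<and> smooth_on n n S (\<lambda>z. \<psi> (inv_into U \<phi> z))"
    using z c by (intro exI[of _ U] exI[of _ \<phi>] exI[of _ "\<phi> ` U"]) (auto simp: comp_def inv_into_into)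
qed

text \<open>
A map of manifolds is smooth if its composites with the inverses of all charts are; continuity is then
automatic.
\<close>

lemma smooth_map_iff_smooth_into:
  assumes A: "smooth_atlas m X A" and B: "smooth_atlas n Y B" and f: "f ` topspace X \<subseteq> topspace Y"
  shows "smooth_map m n (X, A) (Y, B) f \<longleftrightarrow> (\<forall>(U, \<phi>)\<in>A. smooth_into m n B (\<phi> ` U) (\<lambda>z. f (inv_into U \<phi> z)))"
proof -
  have eq: "\<phi> ` (U \<inter> f -` V) = \<phi> ` U \<inter> (\<lambda>z. f (inv_into U \<phi> z)) -` V" if "(U, \<phi>) \<in> A" for U \<phi> V
    using image_restrict_inv_into[OF is_chart_inj_on[OF atlas_chart[OF A that]], of f V] by (simp add: comp_def)
  have charts: "(\<forall>(U, \<phi>)\<in>A. \<forall>(V, \<psi>)\<in>B. smooth_on m n (\<phi> ` (U \<inter> f -` V)) (\<psi> \<circ> f \<circ> inv_into U \<phi>)) \<longleftrightarrow>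
      (\<forall>(U, \<phi>)\<in>A. smooth_into m n B (\<phi> ` U) (\<lambda>z. f (inv_into U \<phi> z)))"
    unfolding smooth_into_def using eq chart_image_open[OF atlas_chart[OF A]] by (fastforce simp: comp_def)
  moreover have "continuous_map X Y f" if *: "\<forall>(U, \<phi>)\<in>A. smooth_into m n B (\<phi> ` U) (\<lambda>z. f (inv_into U \<phi> z))"
    unfolding continuous_map_def
  proof (intro conjI allI impI)
    show "f \<in> topspace X \<rightarrow> topspace Y" using f by auto
    fix T assume T: "openin Y T"
    show "openin X {q \<in> topspace X. f q \<in> T}"
    proof (subst openin_subopen, intro ballI)
      fix q assume q: "q \<in> {q \<in> topspace X. f q \<in> T}"
      then have "q \<in> topspace X" by simp
      then obtain U \<phi> where c: "(U, \<phi>) \<in> A" "q \<in> U" by (rule atlas_cover[OF A])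
      have ch: "is_chart m X (U, \<phi>)" by (rule atlas_chart[OF A c(1)])
      have U: "U \<subseteq> topspace X" by (rule is_chart_subset[OF ch])
      have "(\<lambda>z. f (inv_into U \<phi> z)) ` \<phi> ` U \<subseteq> topspace Y"
        using f U is_chart_inj_on[OF ch] by (simp add: image_image) blast
      from smooth_into_preimage_open[OF B _ this T] *
      have "openin (Euclidean_space m) (\<phi> ` U \<inter> (\<lambda>z. f (inv_into U \<phi> z)) -` T)" using c(1) by blast
      from chart_preimage_open[OF ch this]
      have "openin X {q \<in> U. \<phi> q \<in> \<phi> ` U \<inter> (\<lambda>z. f (inv_into U \<phi> z)) -` T}" .
      moreover have "{q \<in> U. \<phi> q \<in> \<phi> ` U \<inter> (\<lambda>z. f (inv_into U \<phi> z)) -` T} = {q \<in> U. f q \<in> T}"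
        using inv_into_f_f[OF is_chart_inj_on[OF ch]] by (intro Collect_cong conj_cong refl) simp
      ultimately show "\<exists>S. openin X S \<and> q \<in> S \<and> S \<subseteq> {q \<in> topspace X. f q \<in> T}"
        using q c U by (intro exI[of _ "{q \<in> U. f q \<in> T}"]) auto
    qed
  qed
  ultimately show ?thesis unfolding smooth_map_def by auto
qed

lemma smooth_map_local:
  assumes A: "smooth_atlas m X A" and B: "smooth_atlas n Y B" and f: "f ` topspace X \<subseteq> topspace Y"
    and loc: "\<And>q. q \<in> topspace X \<Longrightarrow> \<exists>U \<phi> S. (U, \<phi>) \<in> A \<and> q \<in> U \<and> \<phi> q \<in> S \<and> S \<subseteq> \<phi> ` U \<and>
        smooth_into m n B S (\<lambda>z. f (inv_into U \<phi> z))"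
  shows "smooth_map m n (X, A) (Y, B) f"
  unfolding smooth_map_iff_smooth_into[OF A B f]
proof (intro ballI)
  fix c assume "c \<in> A"
  moreover obtain U' \<phi>' where c': "c = (U', \<phi>')" by fastforce
  ultimately have c: "(U', \<phi>') \<in> A" by simp
  have ch': "is_chart m X (U', \<phi>')" by (rule atlas_chart[OF A c])
  have "smooth_into m n B (\<phi>' ` U') (\<lambda>z. f (inv_into U' \<phi>' z))"
  proof (rule smooth_into_local[OF B])
    fix z assume "z \<in> \<phi>' ` U'"
    then obtain q where q: "q \<in> U'" "z = \<phi>' q" by blast
    then have qX: "q \<in> topspace X" using is_chart_subset[OF ch'] by blast
    obtain U \<phi> S where d: "(U, \<phi>) \<in> A" "q \<in> U" "\<phi> q \<in> S" "S \<subseteq> \<phi> ` U" "smooth_into m n B S (\<lambda>z. f (inv_into U \<phi> z))"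
      using loc[OF qX] by (elim exE conjE)
    have ch: "is_chart m X (U, \<phi>)" by (rule atlas_chart[OF A d(1)])
    have t: "smooth_on m m (\<phi>' ` (U' \<inter> U)) (\<phi> \<circ> inv_into U' \<phi>')" by (rule atlas_transition[OF A c d(1)])
    define V where "V = \<phi>' ` (U' \<inter> U) \<inter> (\<phi> \<circ> inv_into U' \<phi>') -` S"
    have V: "openin (Euclidean_space m) V"
      unfolding V_def by (rule smooth_on_preimage_open[OF t smooth_into_open[OF d(5)]])
    have sV: "smooth_into m n B V (\<lambda>x. f (inv_into U \<phi> ((\<phi> \<circ> inv_into U' \<phi>') x)))"
      by (rule smooth_into_compose[OF d(5) smooth_on_subset[OF t V]]) (auto simp: V_def)
    have eq: "f (inv_into U \<phi> ((\<phi> \<circ> inv_into U' \<phi>') x)) = f (inv_into U' \<phi>' x)" if "x \<in> V" for x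
      using that is_chart_inj_on[OF ch] is_chart_inj_on[OF ch'] by (auto simp: V_def)
    have "f q \<in> topspace Y" using f qX by blast
    then obtain W \<psi> where W: "(W, \<psi>) \<in> B" "f q \<in> W" by (rule atlas_cover[OF B])
    define V' where "V' = V \<inter> (\<lambda>x. f (inv_into U \<phi> ((\<phi> \<circ> inv_into U' \<phi>') x))) -` W"
    have s: "smooth_on m n V' (\<lambda>x. \<psi> (f (inv_into U \<phi> ((\<phi> \<circ> inv_into U' \<phi>') x))))"
      unfolding V'_def by (rule smooth_into_chart[OF sV W(1)])
    have "smooth_on m n V' (\<lambda>x. \<psi> (f (inv_into U' \<phi>' x)))"
      by (rule smooth_on_cong[OF s]) (use eq in \<open>auto simp: V'_def\<close>)
    moreover have zV: "z \<in> V" using q d is_chart_inj_on[OF ch'] by (auto simp: V_def)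
    then have "z \<in> V'" using W eq[OF zV] q is_chart_inj_on[OF ch'] by (auto simp: V'_def)
    moreover have "V' \<subseteq> \<phi>' ` U'" by (auto simp: V'_def V_def)
    moreover have "(\<lambda>z. f (inv_into U' \<phi>' z)) ` V' \<subseteq> W" using eq by (force simp: V'_def)
    ultimately show "\<exists>W \<psi> V. (W, \<psi>) \<in> B \<and> z \<in> V \<and> V \<subseteq> \<phi>' ` U' \<and> (\<lambda>z. f (inv_into U' \<phi>' z)) ` V \<subseteq> W \<and>
        smooth_on m n V (\<lambda>z. \<psi> (f (inv_into U' \<phi>' z)))"
      using W(1) by blast
  qed
  then show "case c of (U, \<phi>) \<Rightarrow> smooth_into m n B (\<phi> ` U) (\<lambda>z. f (inv_into U \<phi> z))" by (simp add: c')
qed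

lemma smooth_map_in: "smooth_map m n (X, A) (Y, B) f \<Longrightarrow> f ` topspace X \<subseteq> topspace Y"
  unfolding smooth_map_def by (auto dest: continuous_map_image_subset_topspace)

lemma smooth_map_compose:
  assumes A: "smooth_atlas m X A" and B: "smooth_atlas n Y B" and C: "smooth_atlas l Z C"
    and f: "smooth_map m n (X, A) (Y, B) f" and g: "smooth_map n l (Y, B) (Z, C) g"
  shows "smooth_map m l (X, A) (Z, C) (\<lambda>x. g (f x))"
proof (rule smooth_map_local[OF A C])
  show "(\<lambda>x. g (f x)) ` topspace X \<subseteq> topspace Z" using smooth_map_in[OF f] smooth_map_in[OF g] by blast
  fix q assume q: "q \<in> topspace X"
  then obtain U \<phi> where U: "(U, \<phi>) \<in> A" "q \<in> U" by (rule atlas_cover[OF A])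
  have ch: "is_chart m X (U, \<phi>)" by (rule atlas_chart[OF A U(1)])
  have "f q \<in> topspace Y" using q smooth_map_in[OF f] by blast
  then obtain V \<psi> where V: "(V, \<psi>) \<in> B" "f q \<in> V" by (rule atlas_cover[OF B])
  have chV: "is_chart n Y (V, \<psi>)" by (rule atlas_chart[OF B V(1)])
  have sf: "smooth_into m n B (\<phi> ` U) (\<lambda>z. f (inv_into U \<phi> z))"
    using f U(1) unfolding smooth_map_iff_smooth_into[OF A B smooth_map_in[OF f]] by blast
  have sg: "smooth_into n l C (\<psi> ` V) (\<lambda>z. g (inv_into V \<psi> z))"
    using g V(1) unfolding smooth_map_iff_smooth_into[OF B C smooth_map_in[OF g]] by blast
  define S where "S = \<phi> ` U \<inter> (\<lambda>z. f (inv_into U \<phi> z)) -` V"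
  have s: "smooth_on m n S (\<lambda>z. \<psi> (f (inv_into U \<phi> z)))"
    unfolding S_def by (rule smooth_into_chart[OF sf V(1)])
  have "smooth_into m l C S (\<lambda>x. g (inv_into V \<psi> (\<psi> (f (inv_into U \<phi> x)))))"
    by (rule smooth_into_compose[OF sg s]) (auto simp: S_def)
  moreover have "g (inv_into V \<psi> (\<psi> (f (inv_into U \<phi> x)))) = g (f (inv_into U \<phi> x))" if "x \<in> S" for x
    using that is_chart_inj_on[OF chV] by (auto simp: S_def)
  ultimately have "smooth_into m l C S (\<lambda>x. g (f (inv_into U \<phi> x)))"
    by (rule smooth_into_cong)
  moreover have "\<phi> q \<in> S" using U V is_chart_inj_on[OF ch] by (auto simp: S_def)
  moreover have "S \<subseteq> \<phi> ` U" by (auto simp: S_def)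
  ultimately show "\<exists>U \<phi> S. (U, \<phi>) \<in> A \<and> q \<in> U \<and> \<phi> q \<in> S \<and> S \<subseteq> \<phi> ` U \<and> smooth_into m l C S (\<lambda>z. g (f (inv_into U \<phi> z)))"
    using U by blast
qed

lemma smooth_map_id:
  assumes A: "smooth_atlas n X A"
  shows "smooth_map n n (X, A) (X, A) (\<lambda>x. x)"
  using smooth_into_chart_inverse[OF A]
  by (subst smooth_map_iff_smooth_into[OF A A]) auto

lemma closed_manifold_atlas: "closed_manifold n (X, A) \<Longrightarrow> smooth_atlas n X A"
  by (simp add: closed_manifold_def smooth_manifold_def smooth_structure_def)

lemma diffeomorphic_refl: "closed_manifold n M \<Longrightarrow> diffeomorphic n M M"
  using smooth_map_id[OF closed_manifold_atlas, of n "fst M" "snd M"] unfolding diffeomorphic_def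
  by (intro exI[of _ "\<lambda>x. x"]) simp

lemma diffeomorphic_sym: "diffeomorphic n M N \<Longrightarrow> diffeomorphic n N M"
  unfolding diffeomorphic_def by blast

lemma diffeomorphic_trans:
  assumes cl: "closed_manifold n L" "closed_manifold n M" "closed_manifold n N"
    and LM: "diffeomorphic n L M" and MN: "diffeomorphic n M N"
  shows "diffeomorphic n L N"
proof -
  obtain X A Y B Z C where L: "L = (X, A)" and M: "M = (Y, B)" and N: "N = (Z, C)" by (metis surj_pair)
  have at: "smooth_atlas n X A" "smooth_atlas n Y B" "smooth_atlas n Z C"
    using cl closed_manifold_atlas unfolding L M N by blast+
  obtain f f' where f: "smooth_map n n (X, A) (Y, B) f" "smooth_map n n (Y, B) (X, A) f'"
      "\<forall>x\<in>topspace X. f' (f x) = x" "\<forall>y\<in>topspace Y. f (f' y) = y"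
    using LM unfolding L M diffeomorphic_def fst_conv by (elim exE conjE)
  obtain g g' where g: "smooth_map n n (Y, B) (Z, C) g" "smooth_map n n (Z, C) (Y, B) g'"
      "\<forall>x\<in>topspace Y. g' (g x) = x" "\<forall>y\<in>topspace Z. g (g' y) = y"
    using MN unfolding M N diffeomorphic_def fst_conv by (elim exE conjE)
  show ?thesis
    unfolding L N diffeomorphic_def fst_conv
  proof (intro exI conjI)
    show "smooth_map n n (X, A) (Z, C) (\<lambda>x. g (f x))" by (rule smooth_map_compose[OF at f(1) g(1)])
    show "smooth_map n n (Z, C) (X, A) (\<lambda>x. f' (g' x))"
      by (rule smooth_map_compose[OF at(3,2,1) g(2) f(2)])
    show "\<forall>x\<in>topspace X. f' (g' (g (f x))) = x" using f g smooth_map_in[OF f(1)] by (simp add: image_subset_iff)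
    show "\<forall>x\<in>topspace Z. g (f (f' (g' x))) = x" using f g smooth_map_in[OF g(2)] by (simp add: image_subset_iff)
  qed
qed


section \<open>Cubical atlases\<close>

lemma smooth_on_continuous_map:
  assumes f: "smooth_on m n U f" and fU: "f ` U \<subseteq> V"
  shows "continuous_map (subtopology (Euclidean_space m) U) (subtopology (Euclidean_space n) V) f"
proof -
  have "U \<subseteq> topspace (Euclidean_space m)" by (rule openin_subset[OF smooth_on_open[OF f]])
  then show ?thesis
    unfolding continuous_map_in_subtopology cm_Euclidean_space_iff_continuous_on
    using smooth_on_continuous[OF f] smooth_on_in[OF f] fU by (auto simp: Int_absorb1)
qed

text \<open>
A maximal atlas contains every chart obtained by restriction and a smooth change of coordinates.
\<close>

lemma chart_postcompose:
  assumes str: "smooth_structure n X A" and c: "(U0, \<phi>0) \<in> A"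
    and a: "smooth_on n n S a" and S: "S \<subseteq> \<phi>0 ` U0"
    and b: "smooth_on n n S' b" and aS: "a ` S = S'" and ba: "\<And>x. x \<in> S \<Longrightarrow> b (a x) = x"
  shows "({q \<in> U0. \<phi>0 q \<in> S}, \<lambda>q. a (\<phi>0 q)) \<in> A"
proof -
  define U where "U = {q \<in> U0. \<phi>0 q \<in> S}"
  have at: "smooth_atlas n X A" using str by (rule smooth_structure_atlas)
  have ch0: "is_chart n X (U0, \<phi>0)" by (rule atlas_chart[OF at c])
  have inj0: "inj_on \<phi>0 U0" by (rule is_chart_inj_on[OF ch0])
  have UU0: "U \<subseteq> U0" by (auto simp: U_def)
  have UX: "U \<subseteq> topspace X" using is_chart_subset[OF ch0] by (auto simp: U_def)
  have oU: "openin X U" unfolding U_def by (rule chart_preimage_open[OF ch0 smooth_on_open[OF a]])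
  have im0: "\<phi>0 ` U = S" using S by (auto simp: U_def)
  have im: "(\<lambda>q. a (\<phi>0 q)) ` U = S'" using im0 aS by (metis image_image)
  have bS: "b ` S' = S" using aS ba by force
  have inj: "inj_on (\<lambda>q. a (\<phi>0 q)) U"
    using inj0 ba by (auto simp: inj_on_def U_def) (metis)
  have inv: "inv_into U (\<lambda>q. a (\<phi>0 q)) y = inv_into U0 \<phi>0 (b y)" if "y \<in> S'" for y
  proof -
    from that have "y \<in> (\<lambda>q. a (\<phi>0 q)) ` U" unfolding im .
    then obtain q where q: "q \<in> U" "y = a (\<phi>0 q)" by (rule imageE)
    then have "inv_into U (\<lambda>q. a (\<phi>0 q)) y = q" using inv_into_f_f[OF inj q(1)] by simp
    moreover have "inv_into U0 \<phi>0 (b y) = q" using q ba inj0 by (simp add: U_def)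
    ultimately show ?thesis by simp
  qed
  have "continuous_map (subtopology X U) (subtopology (Euclidean_space n) S) \<phi>0"
  proof -
    have "continuous_map (subtopology X U0) (subtopology (Euclidean_space n) (\<phi>0 ` U0)) \<phi>0"
      using chart_homeomorphic_maps[OF ch0] by (simp add: homeomorphic_maps_def)
    then have "continuous_map (subtopology X U) (Euclidean_space n) \<phi>0"
      using continuous_map_from_subtopology_mono[OF continuous_map_into_fulltopology UU0] by blast
    then show ?thesis using im0 UX by (auto simp: continuous_map_in_subtopology)
  qed
  from continuous_map_compose[OF this smooth_on_continuous_map[OF a, of S']]
  have cont1: "continuous_map (subtopology X U) (subtopology (Euclidean_space n) S') (\<lambda>q. a (\<phi>0 q))"
    using aS by (simp add: comp_def)
  have "continuous_map (subtopology (Euclidean_space n) S') X (\<lambda>y. inv_into U0 \<phi>0 (b y))"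
    using continuous_map_compose[OF smooth_on_continuous_map[OF b, of "\<phi>0 ` U0"] chart_inverse_continuous[OF ch0]] bS S
    by (simp add: comp_def)
  moreover have "inv_into U0 \<phi>0 (b y) \<in> U" if "y \<in> S'" for y
    using that bS S inj0 by (auto simp: U_def inv_into_into f_inv_into_f subset_iff)
  moreover have "topspace (subtopology (Euclidean_space n) S') = S'"
    using openin_subset[OF smooth_on_open[OF b]] by (simp add: Int_absorb1)
  ultimately have cont2: "continuous_map (subtopology (Euclidean_space n) S') (subtopology X U) (\<lambda>y. inv_into U0 \<phi>0 (b y))"
    by (auto simp: continuous_map_in_subtopology)
  have "homeomorphic_maps (subtopology X U) (subtopology (Euclidean_space n) S') (\<lambda>q. a (\<phi>0 q)) (\<lambda>y. inv_into U0 \<phi>0 (b y))"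
    unfolding homeomorphic_maps_def
  proof (intro conjI ballI cont1 cont2)
    fix q assume "q \<in> topspace (subtopology X U)"
    then have "q \<in> U" by simp
    then show "inv_into U0 \<phi>0 (b (a (\<phi>0 q))) = q" using ba inj0 by (simp add: U_def)
  next
    fix y assume "y \<in> topspace (subtopology (Euclidean_space n) S')"
    then have y: "y \<in> S'" by simp
    then have "b y \<in> \<phi>0 ` U0" using bS S by blast
    moreover have "a (b y) = y" using y aS ba by auto
    ultimately show "a (\<phi>0 (inv_into U0 \<phi>0 (b y))) = y" by (simp add: f_inv_into_f)
  qed
  then have ch: "is_chart n X (U, \<lambda>q. a (\<phi>0 q))"
    using oU smooth_on_open[OF b] im by (auto simp: is_chart_def dest: homeomorphic_maps_imp_map)
  show ?thesis
    unfolding U_def[symmetric]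
  proof (rule smooth_structure_maximal[OF str ch])
    have "smooth_on n n S' ((\<lambda>q. a (\<phi>0 q)) \<circ> inv_into U (\<lambda>q. a (\<phi>0 q)))"
      by (rule smooth_on_cong[OF smooth_on_id[OF smooth_on_open[OF b]]]) (use f_inv_into_f[of _ "\<lambda>q. a (\<phi>0 q)" U] im in simp)
    then show "smoothly_compatible n (U, \<lambda>q. a (\<phi>0 q)) (U, \<lambda>q. a (\<phi>0 q))"
      using im by (simp add: smoothly_compatible_def)
    fix d assume d: "d \<in> A"
    obtain V \<psi> where d': "d = (V, \<psi>)" by fastforce
    have V: "(V, \<psi>) \<in> A" using d d' by simp
    have injV: "inj_on \<psi> V" by (rule is_chart_inj_on[OF atlas_chart[OF at V]])
    have t1: "smooth_on n n (\<phi>0 ` (U0 \<inter> V)) (\<psi> \<circ> inv_into U0 \<phi>0)" by (rule atlas_transition[OF at c V])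
    have t2: "smooth_on n n (\<psi> ` (V \<inter> U0)) (\<phi>0 \<circ> inv_into V \<psi>)" by (rule atlas_transition[OF at V c])
    have e1: "(\<lambda>q. a (\<phi>0 q)) ` (U \<inter> V) = S' \<inter> b -` (\<phi>0 ` (U0 \<inter> V))"
    proof (intro equalityI subsetI)
      fix y assume "y \<in> (\<lambda>q. a (\<phi>0 q)) ` (U \<inter> V)"
      then show "y \<in> S' \<inter> b -` (\<phi>0 ` (U0 \<inter> V))" using ba im by (auto simp: U_def)
    next
      fix y assume y: "y \<in> S' \<inter> b -` (\<phi>0 ` (U0 \<inter> V))"
      then obtain q where q: "q \<in> U0" "q \<in> V" "b y = \<phi>0 q" by auto
      obtain x where "x \<in> S" "y = a x" using y aS by blast
      then have "b y \<in> S" "a (b y) = y" using ba by simp_all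
      then show "y \<in> (\<lambda>q. a (\<phi>0 q)) ` (U \<inter> V)" using q by (intro image_eqI[of _ _ q]) (auto simp: U_def)
    qed
    have "smooth_on n n (S' \<inter> b -` (\<phi>0 ` (U0 \<inter> V))) (\<lambda>y. (\<psi> \<circ> inv_into U0 \<phi>0) (b y))"
      by (rule smooth_on_compose[OF smooth_on_subset[OF b smooth_on_preimage_open[OF b smooth_on_open[OF t1]]] t1]) auto
    then have s1: "smooth_on n n ((\<lambda>q. a (\<phi>0 q)) ` (U \<inter> V)) (\<psi> \<circ> inv_into U (\<lambda>q. a (\<phi>0 q)))"
      unfolding e1 by (rule smooth_on_cong) (simp add: inv)
    have e2: "\<psi> ` (U \<inter> V) = \<psi> ` (V \<inter> U0) \<inter> (\<phi>0 \<circ> inv_into V \<psi>) -` S"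
      using injV by (auto simp: U_def)
    have "smooth_on n n (\<psi> ` (V \<inter> U0) \<inter> (\<phi>0 \<circ> inv_into V \<psi>) -` S) (\<lambda>y. a ((\<phi>0 \<circ> inv_into V \<psi>) y))"
      by (rule smooth_on_compose[OF smooth_on_subset[OF t2 smooth_on_preimage_open[OF t2 smooth_on_open[OF a]]] a]) auto
    then have s2: "smooth_on n n (\<psi> ` (U \<inter> V)) ((\<lambda>q. a (\<phi>0 q)) \<circ> inv_into V \<psi>)"
      unfolding e2 by (simp add: comp_def)
    show "smoothly_compatible n (U, \<lambda>q. a (\<phi>0 q)) d"
      using s1 s2 by (simp add: smoothly_compatible_def d')
  qed
qed

lemma smooth_on_affine: "smooth_on n n (cube n c r) (\<lambda>x i. if i < n then x i * s + t i else 0)"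
  by (intro smooth_onI openin_cube smooth_real_on_add smooth_real_on_mult smooth_real_on_coord smooth_real_on_const)

text \<open>
Restrict a chart to the preimage of a small cube around the image of \<open>q\<close> and rescale affinely.
\<close>

lemma cubical_chart_exists:
  assumes str: "smooth_structure n X A" and q: "q \<in> topspace X"
  shows "\<exists>U \<phi>. (U, \<phi>) \<in> A \<and> q \<in> U \<and> \<phi> ` U = cube n (\<lambda>_. 0) 3 \<and> \<phi> q = (\<lambda>_. 0)"
proof -
  have at: "smooth_atlas n X A" using str by (rule smooth_structure_atlas)
  obtain U0 \<phi>0 where c: "(U0, \<phi>0) \<in> A" "q \<in> U0" using at q by (rule atlas_cover)
  have ch0: "is_chart n X (U0, \<phi>0)" by (rule atlas_chart[OF at c(1)])
  define c0 where "c0 = \<phi>0 q"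
  have c0E: "c0 \<in> topspace (Euclidean_space n)"
    using c(2) openin_subset[OF chart_image_open[OF ch0]] by (auto simp: c0_def)
  have "c0 \<in> \<phi>0 ` U0" using c by (simp add: c0_def)
  with chart_image_open[OF ch0] obtain r where r: "r > 0" "cube n c0 r \<subseteq> \<phi>0 ` U0" by (rule cube_nhd)
  define a where "a = (\<lambda>x i. if i < n then x i * (3 / r) + (- c0 i * (3 / r)) else 0)"
  define b where "b = (\<lambda>x i. if i < n then x i * (r / 3) + c0 i else 0)"
  have a_in: "a x \<in> cube n (\<lambda>_. 0) 3" and ba: "b (a x) = x" if x: "x \<in> cube n c0 r" for x
  proof -
    have "\<bar>a x i\<bar> < 3" if "i < n" for i
    proof -
      have e: "a x i = (x i - c0 i) * (3 / r)" using that by (simp add: a_def left_diff_distrib diff_divide_distrib)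
      have "\<bar>a x i\<bar> = \<bar>x i - c0 i\<bar> * (3 / r)" unfolding e abs_mult using r(1) by simp
      also have "\<dots> < r * (3 / r)" using x that r(1) by (intro mult_strict_right_mono) (auto simp: cube_def)
      finally show ?thesis using r(1) by simp
    qed
    then show "a x \<in> cube n (\<lambda>_. 0) 3" by (auto simp: cube_def topspace_Euclidean_space a_def)
    show "b (a x) = x"
      using x r(1) by (auto simp: a_def b_def fun_eq_iff cube_def topspace_Euclidean_space field_simps)
  qed
  have b_in: "b y \<in> cube n c0 r" and ab: "a (b y) = y" if y: "y \<in> cube n (\<lambda>_. 0) 3" for y
  proof -
    have "\<bar>b y i - c0 i\<bar> < r" if "i < n" for i
    proof -
      have "\<bar>b y i - c0 i\<bar> = \<bar>y i\<bar> * (r / 3)" using r(1) that by (simp add: b_def abs_mult)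
      also have "\<dots> < 3 * (r / 3)" using y that r(1) by (intro mult_strict_right_mono) (auto simp: cube_def)
      finally show ?thesis by simp
    qed
    then show "b y \<in> cube n c0 r" by (auto simp: cube_def topspace_Euclidean_space b_def)
    show "a (b y) = y"
      using y r(1) by (auto simp: a_def b_def fun_eq_iff cube_def topspace_Euclidean_space field_simps)
  qed
  have im: "a ` cube n c0 r = cube n (\<lambda>_. 0) 3"
  proof (intro equalityI subsetI)
    show "y \<in> a ` cube n c0 r" if "y \<in> cube n (\<lambda>_. 0) 3" for y
      using b_in[OF that] ab[OF that] by (intro image_eqI[of _ _ "b y"]) simp_all
  qed (use a_in in blast)
  have mem: "({q \<in> U0. \<phi>0 q \<in> cube n c0 r}, \<lambda>q. a (\<phi>0 q)) \<in> A"
    using smooth_on_affine[of n c0 r "3 / r" "\<lambda>i. - c0 i * (3 / r)"]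
      smooth_on_affine[of n "\<lambda>_. 0" 3 "r / 3" c0]
    by (intro chart_postcompose[OF str c(1) _ r(2) _ im, where b = b] ba) (simp_all add: a_def b_def)
  moreover have "q \<in> {q \<in> U0. \<phi>0 q \<in> cube n c0 r}"
    using c(2) centre_in_cube[OF c0E r(1)] by (simp add: c0_def)
  moreover have "\<phi>0 ` {q \<in> U0. \<phi>0 q \<in> cube n c0 r} = cube n c0 r" using r(2) by auto
  then have "(\<lambda>q. a (\<phi>0 q)) ` {q \<in> U0. \<phi>0 q \<in> cube n c0 r} = cube n (\<lambda>_. 0) 3"
    using im by (metis image_image)
  moreover have "a (\<phi>0 q) = (\<lambda>_. 0)" by (auto simp: a_def c0_def)
  ultimately show ?thesis by blast
qed

definition closed_cube :: "nat \<Rightarrow> real \<Rightarrow> (nat \<Rightarrow> real) set" where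
  "closed_cube n r = {x \<in> topspace (Euclidean_space n). \<forall>i<n. \<bar>x i\<bar> \<le> r}"

text \<open>
All charts have the same image, so that the parametrizations of different manifolds are maps on the
same domain. The unit cubes cover, which leaves the room up to radius \<open>3\<close> for cutting off and for
perturbations.
\<close>

definition cubical_atlas :: "nat \<Rightarrow> 'a topology \<Rightarrow> 'a chart set \<Rightarrow> nat \<Rightarrow> (nat \<Rightarrow> 'a set) \<Rightarrow> (nat \<Rightarrow> 'a \<Rightarrow> nat \<Rightarrow> real) \<Rightarrow> bool" where
  "cubical_atlas n X A k U \<phi> \<longleftrightarrow>
     (\<forall>i<k. (U i, \<phi> i) \<in> A \<and> \<phi> i ` U i = cube n (\<lambda>_. 0) 3) \<and>
     topspace X = (\<Union>i<k. {q \<in> U i. \<phi> i q \<in> closed_cube n 1})"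

lemma cubical_atlas_exists:
  assumes str: "smooth_structure n X A" and comp: "compact_space X"
  shows "\<exists>k U \<phi>. cubical_atlas n X A k U \<phi>"
proof -
  have at: "smooth_atlas n X A" using str by (rule smooth_structure_atlas)
  have "\<forall>q. \<exists>c. q \<in> topspace X \<longrightarrow> c \<in> A \<and> q \<in> fst c \<and> snd c ` fst c = cube n (\<lambda>_. 0) 3 \<and> snd c q = (\<lambda>_. 0)"
    using cubical_chart_exists[OF str] by (metis fst_conv snd_conv)
  from choice[OF this] obtain c where c: "\<And>q. q \<in> topspace X \<Longrightarrow>
      c q \<in> A \<and> q \<in> fst (c q) \<and> snd (c q) ` fst (c q) = cube n (\<lambda>_. 0) 3 \<and> snd (c q) q = (\<lambda>_. 0)"
    by blast
  define N where "N q = {x \<in> fst (c q). snd (c q) x \<in> cube n (\<lambda>_. 0) 1}" for q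
  have N: "openin X (N q)" if "q \<in> topspace X" for q
    unfolding N_def using c[OF that] atlas_chart[OF at, of "c q"]
    by (intro chart_preimage_open[of n X] openin_cube) simp
  have qN: "q \<in> N q" if "q \<in> topspace X" for q
    using c[OF that] by (auto simp: N_def cube_def topspace_Euclidean_space)
  have "compactin X (topspace X)" using comp by (simp add: compact_space_def)
  moreover have "topspace X \<subseteq> \<Union>(N ` topspace X)" using qN by blast
  moreover have "openin X V" if "V \<in> N ` topspace X" for V using N that by blast
  ultimately obtain \<F> where \<F>: "finite \<F>" "\<F> \<subseteq> N ` topspace X" "topspace X \<subseteq> \<Union>\<F>"
    using compactinD[of X "topspace X" "N ` topspace X"] by blast
  then obtain Q where Q: "Q \<subseteq> topspace X" "finite Q" "\<F> = N ` Q" by (meson finite_subset_image)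
  obtain q k where qk: "Q = q ` {i. i < (k::nat)}" using finite_imp_nat_seg_image_inj_on[OF Q(2)] by blast
  have qX: "q i \<in> topspace X" if "i < k" for i using qk Q(1) that by blast
  have "cubical_atlas n X A k (\<lambda>i. fst (c (q i))) (\<lambda>i. snd (c (q i)))"
    unfolding cubical_atlas_def
  proof (intro conjI allI impI)
    show "(fst (c (q i)), snd (c (q i))) \<in> A" if "i < k" for i using c[OF qX[OF that]] by simp
    show "snd (c (q i)) ` fst (c (q i)) = cube n (\<lambda>_. 0) 3" if "i < k" for i using c[OF qX[OF that]] by simp
    show "topspace X = (\<Union>i<k. {x \<in> fst (c (q i)). snd (c (q i)) x \<in> closed_cube n 1})"
    proof
      have "N (q i) \<subseteq> {x \<in> fst (c (q i)). snd (c (q i)) x \<in> closed_cube n 1}" for i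
        by (auto simp: N_def cube_def closed_cube_def intro: less_imp_le)
      moreover have "topspace X \<subseteq> (\<Union>i<k. N (q i))" using \<F>(3) Q(3) qk by auto
      ultimately show "topspace X \<subseteq> (\<Union>i<k. {x \<in> fst (c (q i)). snd (c (q i)) x \<in> closed_cube n 1})"
        by (meson UN_mono order_refl subset_trans)
      have sub: "fst (c (q i)) \<subseteq> topspace X" if "i < k" for i
        using c[OF qX[OF that]] is_chart_subset[of n X "fst (c (q i))" "snd (c (q i))"] atlas_chart[OF at] by simp
      show "(\<Union>i<k. {x \<in> fst (c (q i)). snd (c (q i)) x \<in> closed_cube n 1}) \<subseteq> topspace X"
      proof (rule UN_least)
        fix i assume "i \<in> {..<k}"
        then show "{x \<in> fst (c (q i)). snd (c (q i)) x \<in> closed_cube n 1} \<subseteq> topspace X"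
          using sub[of i] by (metis (no_types, lifting) lessThan_iff mem_Collect_eq subset_iff)
      qed
    qed
  qed
  then show ?thesis by blast
qed

lemma compact_closed_cube: "compact (closed_cube n r)"
proof -
  have eq: "closed_cube n r = (\<Pi>\<^sub>E i\<in>UNIV. if i < n then {-r..r} else {0})"
    by (auto simp: closed_cube_def topspace_Euclidean_space PiE_def Pi_iff abs_le_iff split: if_splits) (metis minus_le_iff)+
  have "compactin (product_topology (\<lambda>i::nat. euclideanreal) UNIV) (\<Pi>\<^sub>E i\<in>UNIV. if i < n then {-r..r} else {0})"
    by (auto simp: compactin_PiE)
  then show ?thesis unfolding eq by (simp add: euclidean_product_topology)
qed

lemma closed_cube_subset: "closed_cube n r \<subseteq> topspace (Euclidean_space n)"
  by (auto simp: closed_cube_def)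

lemma closed_cube_subset_cube: "r < s \<Longrightarrow> closed_cube n r \<subseteq> cube n (\<lambda>_. 0) s"
  by (auto simp: closed_cube_def cube_def intro: le_less_trans)

lemma compactin_Euclidean_subspace:
  assumes "compact K" "K \<subseteq> U" "U \<subseteq> topspace (Euclidean_space n)"
  shows "compactin (subtopology (Euclidean_space n) U) K"
  using assms by (subst Euclidean_space_eq_top_of_set) (auto simp: compactin_subtopology)

lemma chart_inverse_compact_closed:
  assumes c: "is_chart n X (U, \<phi>)" and K: "compact K" "K \<subseteq> \<phi> ` U" and H: "Hausdorff_space X"
  shows "closedin X (inv_into U \<phi> ` K)"
proof -
  have "compactin X (inv_into U \<phi> ` K)"
    by (rule image_compactin[OF compactin_Euclidean_subspace[OF K openin_subset[OF chart_image_open[OF c]]] chart_inverse_continuous[OF c]])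
  then show ?thesis using H compactin_imp_closedin by blast
qed


section \<open>An embedding with a smooth retraction\<close>

text \<open>
Equal to \<open>1\<close> on the closed unit cube and to \<open>0\<close> outside the closed cube of radius \<open>2\<close>.
\<close>

definition bump :: "nat \<Rightarrow> (nat \<Rightarrow> real) \<Rightarrow> real" where
  "bump n x = (\<Prod>i<n. smooth_step (2 - x i) * smooth_step (2 + x i))"

lemma bump_smooth:
  assumes U: "openin (Euclidean_space n) U"
  shows "smooth_real_on n U (bump n)"
proof -
  have "smooth_real_on n U (\<lambda>x. \<Prod>i<n. smooth_step (2 - x i) * smooth_step (2 + x i))"
    by (intro smooth_real_on_prod smooth_real_on_mult smooth_real_on_smooth_step smooth_real_on_diff
        smooth_real_on_add smooth_real_on_const smooth_real_on_coord U)
  then show ?thesis by (simp add: bump_def[abs_def])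
qed

lemma bump_eq_1: "x \<in> closed_cube n 1 \<Longrightarrow> bump n x = 1"
  unfolding bump_def by (rule prod.neutral) (auto simp: closed_cube_def abs_le_iff smooth_step_values)

lemma bump_eq_0:
  assumes x: "x \<in> topspace (Euclidean_space n)" "x \<notin> closed_cube n 2"
  shows "bump n x = 0"
proof -
  obtain i where i: "i < n" "\<not> \<bar>x i\<bar> \<le> 2" using x by (auto simp: closed_cube_def)
  then have "smooth_step (2 - x i) = 0 \<or> smooth_step (2 + x i) = 0" by (auto simp: smooth_step_values abs_le_iff)
  then show ?thesis using i unfolding bump_def by (auto intro!: prod_zero)
qed

definition extend_by_zero :: "'a set \<Rightarrow> ('a \<Rightarrow> nat \<Rightarrow> real) \<Rightarrow> ((nat \<Rightarrow> real) \<Rightarrow> real) \<Rightarrow> 'a \<Rightarrow> real" where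
  "extend_by_zero U \<phi> s q = (if q \<in> U then s (\<phi> q) else 0)"

text \<open>
Outside \<open>U\<close> the extension vanishes locally: the closed cube of radius \<open>2\<close> corresponds to a compact, hence
closed, subset of \<open>X\<close> that contains the support.
\<close>

lemma extend_by_zero_smooth:
  assumes A: "smooth_atlas n X A" and H: "Hausdorff_space X" and c: "(U, \<phi>) \<in> A"
    and im: "\<phi> ` U = cube n (\<lambda>_. 0) 3" and s: "smooth_real_on n (cube n (\<lambda>_. 0) 3) s"
    and s0: "\<And>x. x \<in> cube n (\<lambda>_. 0) 3 \<Longrightarrow> x \<notin> closed_cube n 2 \<Longrightarrow> s x = 0"
    and V: "(V, \<psi>) \<in> A"
  shows "smooth_real_on n (\<psi> ` V) (\<lambda>y. extend_by_zero U \<phi> s (inv_into V \<psi> y))"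
proof (rule smooth_real_on_local)
  fix y assume "y \<in> \<psi> ` V"
  then obtain q where q: "q \<in> V" "y = \<psi> q" by blast
  have ch: "is_chart n X (U, \<phi>)" by (rule atlas_chart[OF A c])
  have chV: "is_chart n X (V, \<psi>)" by (rule atlas_chart[OF A V])
  have inj: "inj_on \<psi> V" by (rule is_chart_inj_on[OF chV])
  show "\<exists>S. y \<in> S \<and> S \<subseteq> \<psi> ` V \<and> smooth_real_on n S (\<lambda>y. extend_by_zero U \<phi> s (inv_into V \<psi> y))"
  proof (cases "q \<in> U")
    case True
    have t: "smooth_on n n (\<psi> ` (V \<inter> U)) (\<phi> \<circ> inv_into V \<psi>)" by (rule atlas_transition[OF A V c])
    have "smooth_real_on n (\<psi> ` (V \<inter> U)) (\<lambda>y. s ((\<phi> \<circ> inv_into V \<psi>) y))"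
      by (rule smooth_real_on_compose[OF t s]) (use im inj in auto)
    then have "smooth_real_on n (\<psi> ` (V \<inter> U)) (\<lambda>y. extend_by_zero U \<phi> s (inv_into V \<psi> y))"
      by (rule smooth_real_on_cong) (use inj in \<open>auto simp: extend_by_zero_def\<close>)
    then show ?thesis using q True by (intro exI[of _ "\<psi> ` (V \<inter> U)"]) auto
  next
    case False
    define K where "K = inv_into U \<phi> ` closed_cube n 2"
    have sub: "closed_cube n 2 \<subseteq> \<phi> ` U" using closed_cube_subset_cube[of 2 3 n] im by simp
    have K: "closedin X K"
      unfolding K_def by (rule chart_inverse_compact_closed[OF ch compact_closed_cube sub H])
    have "K \<subseteq> U" using sub by (auto simp: K_def inv_into_into subset_iff)
    then have qK: "q \<notin> K" using False by blast
    have "openin (Euclidean_space n) (\<psi> ` (V - K))"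
      by (rule chart_open_map[OF chV openin_diff[OF chart_open[OF chV] K]]) auto
    then have "smooth_real_on n (\<psi> ` (V - K)) (\<lambda>y. 0)" by (rule smooth_real_on_const)
    then have "smooth_real_on n (\<psi> ` (V - K)) (\<lambda>y. extend_by_zero U \<phi> s (inv_into V \<psi> y))"
    proof (rule smooth_real_on_cong)
      fix y assume "y \<in> \<psi> ` (V - K)"
      then obtain r where r: "r \<in> V" "r \<notin> K" "y = \<psi> r" by blast
      have "s (\<phi> r) = 0" if "r \<in> U"
      proof (rule s0)
        show "\<phi> r \<in> cube n (\<lambda>_. 0) 3" using that im by blast
        show "\<phi> r \<notin> closed_cube n 2"
          using that r(2) is_chart_inj_on[OF ch] unfolding K_def by (metis image_eqI inv_into_f_f)
      qed
      then show "0 = extend_by_zero U \<phi> s (inv_into V \<psi> y)" using r inj by (simp add: extend_by_zero_def)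
    qed
    then show ?thesis using q qK by (intro exI[of _ "\<psi> ` (V - K)"]) auto
  qed
qed

text \<open>
Coordinates come in \<open>k\<close> blocks of length \<open>n + 1\<close>. In block \<open>i\<close>, the last entry is the bump function of
chart \<open>i\<close>, and the entries before it are the chart coordinates multiplied by this bump function.
\<close>

definition atlas_embedding :: "nat \<Rightarrow> nat \<Rightarrow> (nat \<Rightarrow> 'a set) \<Rightarrow> (nat \<Rightarrow> 'a \<Rightarrow> nat \<Rightarrow> real) \<Rightarrow> 'a \<Rightarrow> nat \<Rightarrow> real" where
  "atlas_embedding n k U \<phi> q = (\<lambda>m. if m < k * (n + 1) then
     extend_by_zero (U (m div (n + 1))) (\<phi> (m div (n + 1)))
       (\<lambda>x. bump n x * (if m mod (n + 1) < n then x (m mod (n + 1)) else 1)) q else 0)"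

lemma block_index:
  fixes i k l n :: nat
  assumes "i < k" "l \<le> n"
  shows "i * (n + 1) + l < k * (n + 1)" "(i * (n + 1) + l) div (n + 1) = i" "(i * (n + 1) + l) mod (n + 1) = l"
proof -
  have "i * (n + 1) + l < (i + 1) * (n + 1)" using assms by (simp add: algebra_simps)
  also have "\<dots> \<le> k * (n + 1)" using assms by (intro mult_right_mono) auto
  finally show "i * (n + 1) + l < k * (n + 1)" .
  show "(i * (n + 1) + l) div (n + 1) = i"
    using div_mult_self3[of "n + 1" i l] assms by (simp add: add.commute)
  show "(i * (n + 1) + l) mod (n + 1) = l"
    using mod_mult_self3[of i "n + 1" l] assms by (simp add: add.commute)
qed

lemma atlas_embedding_weight:
  assumes "i < k" shows "atlas_embedding n k U \<phi> q (i * (n + 1) + n) = extend_by_zero (U i) (\<phi> i) (bump n) q"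
  unfolding atlas_embedding_def using block_index[OF assms, of n n] by (simp add: extend_by_zero_def)

lemma atlas_embedding_coord:
  assumes "i < k" "l < n"
  shows "atlas_embedding n k U \<phi> q (i * (n + 1) + l) = extend_by_zero (U i) (\<phi> i) (\<lambda>x. bump n x * x l) q"
  unfolding atlas_embedding_def using block_index[OF assms(1), of l n] assms(2) by (simp add: extend_by_zero_def)

lemma atlas_embedding_smooth:
  assumes str: "smooth_structure n X A" and H: "Hausdorff_space X" and cub: "cubical_atlas n X A k U \<phi>"
    and V: "(V, \<psi>) \<in> A"
  shows "smooth_on n (k * (n + 1)) (\<psi> ` V) (\<lambda>y. atlas_embedding n k U \<phi> (inv_into V \<psi> y))"
proof -
  have A: "smooth_atlas n X A" using str by (rule smooth_structure_atlas)
  have "smooth_real_on n (\<psi> ` V) (\<lambda>y. extend_by_zero (U (m div (n + 1))) (\<phi> (m div (n + 1)))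
       (\<lambda>x. bump n x * (if m mod (n + 1) < n then x (m mod (n + 1)) else 1)) (inv_into V \<psi> y))"
    if m: "m < k * (n + 1)" for m
  proof (rule extend_by_zero_smooth[OF A H _ _ _ _ V])
    have "m div (n + 1) < k" using m by (metis div_less_iff_less_mult zero_less_Suc Suc_eq_plus1)
    then show "(U (m div (n + 1)), \<phi> (m div (n + 1))) \<in> A"
      "\<phi> (m div (n + 1)) ` U (m div (n + 1)) = cube n (\<lambda>_. 0) 3"
      using cub by (auto simp: cubical_atlas_def)
    have "smooth_real_on n (cube n (\<lambda>_. 0) 3) (\<lambda>x. if m mod (n + 1) < n then x (m mod (n + 1)) else 1)"
      by (cases "m mod (n + 1) < n") (simp_all add: smooth_real_on_const smooth_real_on_coord openin_cube)
    then show "smooth_real_on n (cube n (\<lambda>_. 0) 3) (\<lambda>x. bump n x * (if m mod (n + 1) < n then x (m mod (n + 1)) else 1))"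
      by (intro smooth_real_on_mult bump_smooth openin_cube)
    fix x assume "x \<in> cube n (\<lambda>_. 0) 3" "x \<notin> closed_cube n 2"
    then have "bump n x = 0" using bump_eq_0 cube_subset by blast
    then show "bump n x * (if m mod (n + 1) < n then x (m mod (n + 1)) else 1) = 0" by simp
  qed
  then show ?thesis
    unfolding atlas_embedding_def by (intro smooth_onI chart_image_open[OF atlas_chart[OF A V]])
qed

lemma smooth_into_Un:
  assumes V: "smooth_into m n A V R" and W: "smooth_into m n A W R"
  shows "smooth_into m n A (V \<union> W) R"
  unfolding smooth_into_def
proof (intro conjI ballI)
  show "openin (Euclidean_space m) (V \<union> W)" using V W smooth_into_open by blast
  fix c assume c: "c \<in> A"
  obtain U \<phi> where c': "c = (U, \<phi>)" by fastforce
  have *: "smooth_on m n (V \<inter> R -` U) (\<lambda>z. \<phi> (R z))" "smooth_on m n (W \<inter> R -` U) (\<lambda>z. \<phi> (R z))"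
    using smooth_into_chart[OF V] smooth_into_chart[OF W] c c' by auto
  have "smooth_on m n ((V \<union> W) \<inter> R -` U) (\<lambda>z. \<phi> (R z))"
  proof (rule smooth_on_local)
    fix z assume z: "z \<in> (V \<union> W) \<inter> R -` U"
    show "\<exists>S. z \<in> S \<and> S \<subseteq> (V \<union> W) \<inter> R -` U \<and> smooth_on m n S (\<lambda>z. \<phi> (R z))"
    proof (cases "z \<in> V")
      case True
      then show ?thesis using z *(1) by (intro exI[of _ "V \<inter> R -` U"]) auto
    next
      case False
      then show ?thesis using z *(2) by (intro exI[of _ "W \<inter> R -` U"]) auto
    qed
  qed
  then show "case c of (U, \<phi>) \<Rightarrow> smooth_on m n ((V \<union> W) \<inter> R -` U) (\<lambda>z. \<phi> (R z))" by (simp add: c')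
qed

lemma smooth_real_on_preimage_open:
  assumes f: "smooth_real_on n U f" and T: "open T"
  shows "openin (Euclidean_space n) (U \<inter> f -` T)"
  using openin_Euclidean_trans[OF smooth_real_on_open[OF f] continuous_openin_preimage_gen[OF smooth_real_on_continuous[OF f] T]] .

lemma smooth_into_subset:
  assumes R: "smooth_into m n A W R" and V: "openin (Euclidean_space m) V" "V \<subseteq> W"
  shows "smooth_into m n A V R"
  using smooth_into_compose[OF R smooth_on_id[OF V(1)]] V(2) by simp

text \<open>
Where the bump coordinate \<open>\<alpha>\<close> of block \<open>i\<close> is positive, dividing by it recovers the chart coordinates \<open>\<beta>\<close>,
and \<open>\<rho> = \<phi>\<^sub>i\<^sup>-\<^sup>1 \<circ> \<beta>\<close> is a left inverse of the embedding. The new map is \<open>\<rho>\<close> where \<open>\<alpha> > 2/3\<close>, the given \<open>R\<close> where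
\<open>\<alpha> < 1/3\<close>, and a convex combination of both in the coordinates of chart \<open>i\<close> in between. On the image of the
embedding both maps agree, so every combination of them is a left inverse as well.
\<close>

lemma retraction_extend:
  assumes str: "smooth_structure n X A" and cub: "cubical_atlas n X A k U \<phi>" and i: "i < k"
    and R: "smooth_into (k * (n + 1)) n A W R" and RX: "R ` W \<subseteq> topspace X"
    and Re: "\<forall>q\<in>topspace X. atlas_embedding n k U \<phi> q \<in> W \<longrightarrow> R (atlas_embedding n k U \<phi> q) = q"
  shows "\<exists>W' R'. smooth_into (k * (n + 1)) n A W' R' \<and> R' ` W' \<subseteq> topspace X \<and>
    (\<forall>q\<in>topspace X. atlas_embedding n k U \<phi> q \<in> W \<or> q \<in> U i \<and> \<phi> i q \<in> closed_cube n 1 \<longrightarrow> atlas_embedding n k U \<phi> q \<in> W') \<and>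
    (\<forall>q\<in>topspace X. atlas_embedding n k U \<phi> q \<in> W' \<longrightarrow> R' (atlas_embedding n k U \<phi> q) = q)"
proof -
  define N where "N = k * (n + 1)"
  let ?E = "topspace (Euclidean_space N)"
  let ?Q = "cube n (\<lambda>_. 0) 3"
  let ?e = "atlas_embedding n k U \<phi>"
  have A: "smooth_atlas n X A" using str by (rule smooth_structure_atlas)
  have c: "(U i, \<phi> i) \<in> A" and im: "\<phi> i ` U i = ?Q" using cub i by (auto simp: cubical_atlas_def)
  have ch: "is_chart n X (U i, \<phi> i)" by (rule atlas_chart[OF A c])
  have UX: "U i \<subseteq> topspace X" by (rule is_chart_subset[OF ch])
  have inj: "inj_on (\<phi> i) (U i)" by (rule is_chart_inj_on[OF ch])
  define p where "p = inv_into (U i) (\<phi> i)"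
  have pU: "p x \<in> U i" if "x \<in> ?Q" for x
    using that unfolding im[symmetric] p_def by (rule inv_into_into)
  have p\<phi>: "p (\<phi> i q) = q" if "q \<in> U i" for q using inj that by (simp add: p_def)
  have sp: "smooth_into n n A ?Q p"
    using smooth_into_chart_inverse[OF A c] im by (simp add: p_def)
  have R': "smooth_into N n A W R" using R by (simp add: N_def)
  have oE: "openin (Euclidean_space N) ?E" by simp
  define \<alpha> where "\<alpha> z = z (i * (n + 1) + n)" for z :: "nat \<Rightarrow> real"
  define \<beta> where "\<beta> z = (\<lambda>l. if l < n then z (i * (n + 1) + l) / \<alpha> z else 0)" for z
  \<comment> \<open>The weight of \<open>\<rho>\<close>: it is \<open>0\<close> for \<open>\<alpha> \<le> 1/3\<close> and \<open>1\<close> for \<open>\<alpha> \<ge> 2/3\<close>.\<close>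
  define h where "h z = smooth_step (3 * \<alpha> z - 1)" for z
  have s\<alpha>: "smooth_real_on N S \<alpha>" if "openin (Euclidean_space N) S" for S
    unfolding \<alpha>_def[abs_def] by (rule smooth_real_on_coord[OF that])
  have sh: "smooth_real_on N S h" if "openin (Euclidean_space N) S" for S
    unfolding h_def[abs_def] by (intro smooth_real_on_smooth_step smooth_real_on_diff smooth_real_on_mult smooth_real_on_const s\<alpha> that)
  have h01: "0 \<le> h z" "h z \<le> 1" for z by (simp_all add: h_def smooth_step_values)
  define V0 where "V0 = ?E \<inter> \<alpha> -` {0<..}"
  have V0: "openin (Euclidean_space N) V0"
    unfolding V0_def by (rule smooth_real_on_preimage_open[OF s\<alpha>[OF oE]]) simp
  have s\<beta>0: "smooth_on N n V0 \<beta>"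
    unfolding \<beta>_def[abs_def]
    by (intro smooth_onI V0 smooth_real_on_divide smooth_real_on_coord s\<alpha>) (auto simp: V0_def)
  define V where "V = V0 \<inter> \<beta> -` ?Q"
  have V: "openin (Euclidean_space N) V" unfolding V_def by (rule smooth_on_preimage_open[OF s\<beta>0 openin_cube])
  have s\<beta>: "smooth_on N n V \<beta>" by (rule smooth_on_subset[OF s\<beta>0 V]) (auto simp: V_def)
  have e\<alpha>: "\<alpha> (?e q) = (if q \<in> U i then bump n (\<phi> i q) else 0)" for q
    using atlas_embedding_weight[OF i, of n U \<phi> q] by (simp add: \<alpha>_def extend_by_zero_def)
  have eE: "?e q \<in> ?E" for q by (simp add: atlas_embedding_def topspace_Euclidean_space N_def)
  have e\<beta>: "\<beta> (?e q) = \<phi> i q" and eV: "?e q \<in> V" and eU: "q \<in> U i" if "\<alpha> (?e q) > 0" for q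
  proof -
    show qU: "q \<in> U i" using that e\<alpha>[of q] by (auto split: if_splits)
    then have b: "bump n (\<phi> i q) \<noteq> 0" using that e\<alpha>[of q] by auto
    have "\<phi> i q \<in> ?Q" using qU im by blast
    then have "\<phi> i q \<in> topspace (Euclidean_space n)" using cube_subset by blast
    then show eq: "\<beta> (?e q) = \<phi> i q"
      using qU b e\<alpha>[of q] atlas_embedding_coord[OF i, of _ n U \<phi> q]
      by (auto simp: \<beta>_def fun_eq_iff extend_by_zero_def topspace_Euclidean_space)
    then show "?e q \<in> V" using that eE \<open>\<phi> i q \<in> ?Q\<close> by (simp add: V_def V0_def)
  qed
  define \<rho> where "\<rho> z = p (\<beta> z)" for z
  have s\<rho>: "smooth_into N n A V \<rho>"
    unfolding \<rho>_def[abs_def] by (rule smooth_into_compose[OF sp s\<beta>]) (auto simp: V_def)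
  \<comment> \<open>Here both \<open>\<rho>\<close> and \<open>R\<close> are defined with values in chart \<open>i\<close>, so that they can be interpolated.\<close>
  define W2 where "W2 = V \<inter> (W \<inter> R -` U i)"
  have sR: "smooth_on N n (W \<inter> R -` U i) (\<lambda>z. \<phi> i (R z))" by (rule smooth_into_chart[OF R' c])
  have W2: "openin (Euclidean_space N) W2" unfolding W2_def by (rule openin_Int[OF V smooth_on_open[OF sR]])
  define m where "m z = (\<lambda>l. h z * \<beta> z l + (1 - h z) * \<phi> i (R z) l)" for z
  have mQ: "m z \<in> ?Q" if z: "z \<in> W2" for z
  proof -
    have q: "\<beta> z \<in> ?Q" "\<phi> i (R z) \<in> ?Q" using z im by (auto simp: W2_def V_def)
    have "\<bar>m z l\<bar> < 3" if l: "l < n" for l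
    proof -
      have "\<beta> z l \<in> {-3<..<3}" "\<phi> i (R z) l \<in> {-3<..<3}" using q l by (auto simp: cube_def abs_less_iff)
      then have "h z *\<^sub>R \<beta> z l + (1 - h z) *\<^sub>R \<phi> i (R z) l \<in> {-3<..<3}"
        using h01[of z] convex_real_interval(8)[of "-3" "3::real"] by (intro convexD) auto
      then show ?thesis by (simp add: m_def abs_less_iff)
    qed
    then show ?thesis using q by (simp add: cube_def m_def topspace_Euclidean_space)
  qed
  have sm: "smooth_on N n W2 m"
    unfolding smooth_on_def
  proof (intro conjI allI impI W2)
    show "m ` W2 \<subseteq> topspace (Euclidean_space n)" using mQ cube_subset by blast
    fix l assume l: "l < n"
    have "smooth_real_on N W2 (\<lambda>z. \<beta> z l)"
      by (rule smooth_real_on_subset[OF smooth_on_component[OF s\<beta> l] W2]) (auto simp: W2_def)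
    moreover have "smooth_real_on N W2 (\<lambda>z. \<phi> i (R z) l)"
      by (rule smooth_real_on_subset[OF smooth_on_component[OF sR l] W2]) (auto simp: W2_def)
    ultimately show "smooth_real_on N W2 (\<lambda>z. m z l)"
      unfolding m_def by (intro smooth_real_on_add smooth_real_on_mult smooth_real_on_diff smooth_real_on_const sh W2)
  qed
  have smid: "smooth_into N n A W2 (\<lambda>z. p (m z))"
    by (rule smooth_into_compose[OF sp sm]) (use mQ in blast)
  define W1 where "W1 = W \<inter> (?E \<inter> \<alpha> -` {..<1/3})"
  define W3 where "W3 = V \<inter> (?E \<inter> \<alpha> -` {2/3<..})"
  have W1: "openin (Euclidean_space N) W1" and W3: "openin (Euclidean_space N) W3"
    unfolding W1_def W3_def
    by (intro openin_Int smooth_into_open[OF R'] V smooth_real_on_preimage_open[OF s\<alpha>[OF oE]]; simp)+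
  \<comment> \<open>The order of the cases is immaterial: on overlaps the weight is \<open>0\<close> or \<open>1\<close>, and the formulas agree.\<close>
  define R2 where "R2 z = (if z \<in> W3 then \<rho> z else if z \<in> W2 then p (m z) else R z)" for z
  have "smooth_into N n A W1 R2"
  proof (rule smooth_into_cong[OF smooth_into_subset[OF R' W1]])
    fix z assume z: "z \<in> W1"
    then have "h z = 0" by (simp add: h_def W1_def smooth_step_values)
    then have "p (m z) = R z" if "z \<in> W2" using that p\<phi> by (simp add: m_def W2_def)
    then show "R z = R2 z" using z by (auto simp: R2_def W1_def W3_def)
  qed (auto simp: W1_def)
  moreover have "smooth_into N n A W2 R2"
  proof (rule smooth_into_cong[OF smid])
    fix z assume z: "z \<in> W2"
    have "m z = \<beta> z" if "z \<in> W3"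
    proof -
      have "h z = 1" using that by (simp add: h_def W3_def smooth_step_values)
      then show ?thesis by (simp add: m_def)
    qed
    then show "p (m z) = R2 z" using z by (auto simp: R2_def \<rho>_def)
  qed
  moreover have "smooth_into N n A W3 R2"
    by (rule smooth_into_cong[OF smooth_into_subset[OF s\<rho> W3]]) (auto simp: R2_def W3_def)
  ultimately have sR2: "smooth_into N n A (W1 \<union> W2 \<union> W3) R2" by (intro smooth_into_Un)
  moreover have "R2 ` (W1 \<union> W2 \<union> W3) \<subseteq> topspace X"
  proof (rule image_subsetI)
    fix z assume z: "z \<in> W1 \<union> W2 \<union> W3"
    have "\<rho> z \<in> topspace X" if "z \<in> W3" using that pU UX by (auto simp: \<rho>_def W3_def V_def)
    moreover have "p (m z) \<in> topspace X" if "z \<in> W2" using that pU[OF mQ] UX by blast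
    moreover have "R z \<in> topspace X" if "z \<in> W1" using that RX by (auto simp: W1_def)
    ultimately show "R2 z \<in> topspace X" using z by (auto simp: R2_def)
  qed
  moreover have "?e q \<in> W1 \<union> W2 \<union> W3" if q: "q \<in> topspace X" and or: "?e q \<in> W \<or> q \<in> U i \<and> \<phi> i q \<in> closed_cube n 1" for q
  proof (cases "q \<in> U i \<and> \<phi> i q \<in> closed_cube n 1")
    case True
    then have "\<alpha> (?e q) = 1" by (simp add: e\<alpha> bump_eq_1)
    then show ?thesis using eV[of q] eE by (simp add: W3_def)
  next
    case False
    then have W: "?e q \<in> W" using or by blast
    show ?thesis
    proof (cases "\<alpha> (?e q) < 1/3")
      case True
      then show ?thesis using W eE by (simp add: W1_def)
    next
      case False
      then show ?thesis using W eV[of q] eU[of q] Re q W by (simp add: W2_def)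
    qed
  qed
  moreover have "R2 (?e q) = q" if q: "q \<in> topspace X" and e: "?e q \<in> W1 \<union> W2 \<union> W3" for q
  proof -
    have V1: "\<rho> (?e q) = q" "\<beta> (?e q) = \<phi> i q" if "?e q \<in> V"
    proof -
      have "\<alpha> (?e q) > 0" using that by (simp add: V_def V0_def)
      then show "\<beta> (?e q) = \<phi> i q" "\<rho> (?e q) = q" using e\<beta>[of q] eU[of q] p\<phi> by (simp_all add: \<rho>_def)
    qed
    have "p (m (?e q)) = q" if w: "?e q \<in> W2"
    proof -
      have "R (?e q) = q" using w Re q by (simp add: W2_def)
      moreover from this have "q \<in> U i" using w by (simp add: W2_def)
      moreover have "m (?e q) = \<phi> i q" using V1(2) w \<open>R (?e q) = q\<close> by (simp add: m_def W2_def algebra_simps)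
      ultimately show ?thesis using p\<phi> by simp
    qed
    then show ?thesis using e V1(1) Re q by (auto simp: R2_def W1_def W3_def)
  qed
  ultimately show ?thesis unfolding N_def by (intro exI[of _ "W1 \<union> W2 \<union> W3"] exI[of _ R2]) blast
qed

definition smooth_retraction :: "nat \<Rightarrow> 'a topology \<Rightarrow> 'a chart set \<Rightarrow> nat \<Rightarrow> (nat \<Rightarrow> 'a set) \<Rightarrow> (nat \<Rightarrow> 'a \<Rightarrow> nat \<Rightarrow> real)
    \<Rightarrow> (nat \<Rightarrow> real) set \<Rightarrow> ((nat \<Rightarrow> real) \<Rightarrow> 'a) \<Rightarrow> bool" where
  "smooth_retraction n X A k U \<phi> W R \<longleftrightarrow>
     smooth_into (k * (n + 1)) n A W R \<and> R ` W \<subseteq> topspace X \<and>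
     (\<forall>q\<in>topspace X. atlas_embedding n k U \<phi> q \<in> W \<and> R (atlas_embedding n k U \<phi> q) = q)"

text \<open>
Extend over the unit cubes of the charts one after the other, starting from the empty neighbourhood.
\<close>

lemma smooth_retraction_exists:
  assumes str: "smooth_structure n X A" and cub: "cubical_atlas n X A k U \<phi>"
  shows "\<exists>W R. smooth_retraction n X A k U \<phi> W R"
proof -
  have "\<exists>W R. smooth_into (k * (n + 1)) n A W R \<and> R ` W \<subseteq> topspace X \<and>
    (\<forall>i<s. \<forall>q\<in>U i. \<phi> i q \<in> closed_cube n 1 \<longrightarrow> atlas_embedding n k U \<phi> q \<in> W) \<and>
    (\<forall>q\<in>topspace X. atlas_embedding n k U \<phi> q \<in> W \<longrightarrow> R (atlas_embedding n k U \<phi> q) = q)" if "s \<le> k" for s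
    using that
  proof (induction s)
    case 0
    have "smooth_on (k * (n + 1)) n {} f" for f :: "(nat \<Rightarrow> real) \<Rightarrow> nat \<Rightarrow> real"
      by (rule smooth_on_local) auto
    then have "smooth_into (k * (n + 1)) n A {} undefined" by (auto simp: smooth_into_def)
    then show ?case by (intro exI[of _ "{}"] exI[of _ undefined]) auto
  next
    case (Suc s)
    then have "s \<le> k" by simp
    from Suc.IH[OF this] obtain W R where WR: "smooth_into (k * (n + 1)) n A W R" "R ` W \<subseteq> topspace X"
      "\<forall>i<s. \<forall>q\<in>U i. \<phi> i q \<in> closed_cube n 1 \<longrightarrow> atlas_embedding n k U \<phi> q \<in> W"
      "\<forall>q\<in>topspace X. atlas_embedding n k U \<phi> q \<in> W \<longrightarrow> R (atlas_embedding n k U \<phi> q) = q"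
      by (elim exE conjE)
    have s: "s < k" using Suc.prems by simp
    have UX: "U i \<subseteq> topspace X" if "i < k" for i
    proof -
      have "(U i, \<phi> i) \<in> A" using cub that by (simp add: cubical_atlas_def)
      then show ?thesis using is_chart_subset[OF atlas_chart[OF smooth_structure_atlas[OF str]]] by blast
    qed
    obtain W' R' where W': "smooth_into (k * (n + 1)) n A W' R'" "R' ` W' \<subseteq> topspace X"
      "\<forall>q\<in>topspace X. atlas_embedding n k U \<phi> q \<in> W \<or> q \<in> U s \<and> \<phi> s q \<in> closed_cube n 1 \<longrightarrow> atlas_embedding n k U \<phi> q \<in> W'"
      "\<forall>q\<in>topspace X. atlas_embedding n k U \<phi> q \<in> W' \<longrightarrow> R' (atlas_embedding n k U \<phi> q) = q"
      using retraction_extend[OF str cub s WR(1,2,4)] by (elim exE conjE)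
    have "atlas_embedding n k U \<phi> q \<in> W'" if "i < Suc s" "q \<in> U i" "\<phi> i q \<in> closed_cube n 1" for i q
    proof -
      have "q \<in> topspace X" using that UX[of i] s by (auto simp: less_Suc_eq)
      moreover have "atlas_embedding n k U \<phi> q \<in> W \<or> q \<in> U s \<and> \<phi> s q \<in> closed_cube n 1"
        using that WR(3) by (auto simp: less_Suc_eq)
      ultimately show ?thesis using W'(3) by blast
    qed
    then show ?case using W'(1,2,4) by (intro exI[of _ W'] exI[of _ R']) blast
  qed
  from this[OF order_refl] obtain W R where WR: "smooth_into (k * (n + 1)) n A W R" "R ` W \<subseteq> topspace X"
      "\<forall>i<k. \<forall>q\<in>U i. \<phi> i q \<in> closed_cube n 1 \<longrightarrow> atlas_embedding n k U \<phi> q \<in> W"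
      "\<forall>q\<in>topspace X. atlas_embedding n k U \<phi> q \<in> W \<longrightarrow> R (atlas_embedding n k U \<phi> q) = q"
    by (elim exE conjE)
  have "atlas_embedding n k U \<phi> q \<in> W" if "q \<in> topspace X" for q
  proof -
    have "q \<in> (\<Union>i<k. {q \<in> U i. \<phi> i q \<in> closed_cube n 1})" using that cub by (simp add: cubical_atlas_def)
    then show ?thesis using WR(3) by blast
  qed
  then show ?thesis unfolding smooth_retraction_def using WR by blast
qed


section \<open>Manifolds with close embeddings are diffeomorphic\<close>

lemma pderiv_at_compose:
  assumes k: "smooth_on n m U k" and a: "smooth_real_on m V a" and kU: "k ` U \<subseteq> V"
    and x: "x \<in> U" and i: "i < n"
  shows "pderiv_at i (\<lambda>x. a (k x)) x = (\<Sum>l<m. pderiv_at l a (k x) * pderiv_at i (\<lambda>x. k x l) x)"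
proof -
  have U: "openin (Euclidean_space n) U" by (rule smooth_on_open[OF k])
  have "\<forall>\<^sub>F t in at (x i). x(i := t) \<in> U"
    using eventually_fun_upd_in[OF U x i] by (simp add: eventually_nhds_conv_at)
  then have "\<forall>\<^sub>F t in at (x i). k (x(i := t)) \<in> topspace (Euclidean_space m)"
    by eventually_elim (use smooth_on_in[OF k] in auto)
  moreover have "((\<lambda>t. k (x(i := t)) l) has_real_derivative pderiv_at i (\<lambda>x. k x l) x) (at (x i))" if "l < m" for l
    by (rule smooth_real_on_has_pderiv[OF smooth_on_component[OF k that] i x])
  ultimately have "((\<lambda>t. a (k (x(i := t)))) has_real_derivative
      (\<Sum>l<m. pderiv_at l a (k x) * pderiv_at i (\<lambda>x. k x l) x)) (at (x i))"
    using smooth_real_on_chain[OF a, of "\<lambda>t. k (x(i := t))" "x i"] x kU by auto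
  then show ?thesis unfolding pderiv_at_def[of i "\<lambda>x. a (k x)"] by (rule DERIV_imp_deriv)
qed

definition embedded_param :: "nat \<Rightarrow> nat \<Rightarrow> (nat \<Rightarrow> 'a set) \<Rightarrow> (nat \<Rightarrow> 'a \<Rightarrow> nat \<Rightarrow> real) \<Rightarrow> nat \<Rightarrow> (nat \<Rightarrow> real) \<Rightarrow> nat \<Rightarrow> real" where
  "embedded_param n k U \<phi> j x = atlas_embedding n k U \<phi> (inv_into (U j) (\<phi> j) x)"

text \<open>
The values at irrelevant indices are set to \<open>0\<close>, so that this is continuous in \<open>x\<close> as an element of the
type \<open>nat \<Rightarrow> nat \<Rightarrow> real\<close>.
\<close>

definition first_partials :: "nat \<Rightarrow> nat \<Rightarrow> ((nat \<Rightarrow> real) \<Rightarrow> nat \<Rightarrow> real) \<Rightarrow> (nat \<Rightarrow> real) \<Rightarrow> nat \<Rightarrow> nat \<Rightarrow> real" where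
  "first_partials n N f x = (\<lambda>i m. if i < n \<and> m < N then pderiv_at i (\<lambda>x. f x m) x else 0)"

text \<open>
The Jacobian that the chain rule predicts for \<open>r \<circ> f\<close> when \<open>f\<close> has value \<open>z\<close> and partial derivatives \<open>D\<close>.
\<close>

definition pushed_jacobian :: "nat \<Rightarrow> ((nat \<Rightarrow> real) \<Rightarrow> nat \<Rightarrow> real) \<Rightarrow> (nat \<Rightarrow> real) \<Rightarrow> (nat \<Rightarrow> nat \<Rightarrow> real) \<Rightarrow> nat \<Rightarrow> nat \<Rightarrow> real" where
  "pushed_jacobian N r z D l i = (\<Sum>m<N. pderiv_at m (\<lambda>z. r z l) z * D i m)"

lemma near_identity_cong:
  assumes "\<And>i j. i < n \<Longrightarrow> j < n \<Longrightarrow> A i j = B i j"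
  shows "near_identity n A \<longleftrightarrow> near_identity n B"
  using assms by (simp add: near_identity_def)

lemma pushed_jacobian_first_partials:
  assumes f: "smooth_on n N U f" and r: "smooth_on N n V r" and fU: "f ` U \<subseteq> V" and x: "x \<in> U"
    and li: "l < n" "i < n"
  shows "pushed_jacobian N r (f x) (first_partials n N f x) l i = jacobian_matrix (\<lambda>x. r (f x)) x l i"
  unfolding jacobian_matrix_def pderiv_at_compose[OF f smooth_on_component[OF r li(1)] fU x li(2)]
  by (simp add: pushed_jacobian_def first_partials_def li)

lemma cubical_atlas_chart: "cubical_atlas n X A k U \<phi> \<Longrightarrow> j < k \<Longrightarrow> (U j, \<phi> j) \<in> A"
  by (simp add: cubical_atlas_def)

lemma cubical_atlas_image: "cubical_atlas n X A k U \<phi> \<Longrightarrow> j < k \<Longrightarrow> \<phi> j ` U j = cube n (\<lambda>_. 0) 3"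
  by (simp add: cubical_atlas_def)

lemma cubical_atlas_cover:
  assumes "cubical_atlas n X A k U \<phi>" "q \<in> topspace X"
  obtains j where "j < k" "q \<in> U j" "\<phi> j q \<in> closed_cube n 1"
  using assms unfolding cubical_atlas_def by blast

lemma embedded_param_smooth:
  assumes str: "smooth_structure n X A" and H: "Hausdorff_space X" and cub: "cubical_atlas n X A k U \<phi>" and j: "j < k"
  shows "smooth_on n (k * (n + 1)) (cube n (\<lambda>_. 0) 3) (embedded_param n k U \<phi> j)"
  using atlas_embedding_smooth[OF str H cub cubical_atlas_chart[OF cub j]] cubical_atlas_image[OF cub j]
  by (simp add: embedded_param_def[abs_def])

lemma connected_cube: "connectedin (Euclidean_space n) (cube n (\<lambda>_. 0) r)"
proof -
  have eq: "cube n (\<lambda>_. 0) r = (\<Pi>\<^sub>E i\<in>UNIV. if i < n then {-r<..<r} else {0})"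
    unfolding cube_def topspace_Euclidean_space PiE_UNIV_domain by (auto simp: Pi_iff abs_less_iff split: if_splits) (metis minus_less_iff)+
  have "connectedin (product_topology (\<lambda>i::nat. euclideanreal) UNIV) (\<Pi>\<^sub>E i\<in>UNIV. if i < n then {-r<..<r} else {0})"
    by (auto simp: connectedin_PiE)
  then have "connected (cube n (\<lambda>_. 0) r)" unfolding eq by (simp add: euclidean_product_topology)
  then show ?thesis
    using cube_subset by (subst Euclidean_space_eq_top_of_set) (simp add: connectedin_subtopology)
qed

text \<open>
The diffeomorphism is \<open>g = R \<circ> e'\<close>, where \<open>e'\<close> is the embedding of \<open>X'\<close>. In the \<open>j\<close>-th charts it is a map
\<open>G j\<close> on the cube of radius \<open>2\<close> whose Jacobian is near the identity, so it is injective there with open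
image and smooth inverse. If two points have the same image, \<open>overlap\<close> puts them into one cube of
radius \<open>2\<close>, where injectivity is known. The image of \<open>g\<close> is open, and closed by compactness, and meets
each of the connected sets \<open>U j\<close>, which cover \<open>X\<close>.
\<close>

lemma diffeomorphic_of_close:
  fixes X :: "'a topology" and X' :: "'b topology"
  assumes str: "smooth_structure n X A" and H: "Hausdorff_space X" and cub: "cubical_atlas n X A k U \<phi>"
    and ret: "smooth_retraction n X A k U \<phi> W R"
    and str': "smooth_structure n X' A'" and H': "Hausdorff_space X'" and comp': "compact_space X'"
    and cub': "cubical_atlas n X' A' k U' \<phi>'"
    and close: "\<And>j x. j < k \<Longrightarrow> x \<in> closed_cube n 2 \<Longrightarrow>
        embedded_param n k U' \<phi>' j x \<in> W \<inter> R -` U j \<and>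
        near_identity n (pushed_jacobian (k * (n + 1)) (\<lambda>z. \<phi> j (R z)) (embedded_param n k U' \<phi>' j x) (first_partials n (k * (n + 1)) (embedded_param n k U' \<phi>' j) x))"
    and overlap: "\<And>i j x y. i < k \<Longrightarrow> j < k \<Longrightarrow> x \<in> closed_cube n 1 \<Longrightarrow> y \<in> closed_cube n 1 \<Longrightarrow>
        R (embedded_param n k U' \<phi>' i x) = R (embedded_param n k U' \<phi>' j y) \<Longrightarrow>
        inv_into (U' j) (\<phi>' j) y \<in> inv_into (U' i) (\<phi>' i) ` cube n (\<lambda>_. 0) 2"
  shows "diffeomorphic n (X, A) (X', A')"
proof -
  define N where "N = k * (n + 1)"
  define e where "e = atlas_embedding n k U' \<phi>'"
  define f where "f = embedded_param n k U' \<phi>'"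
  define p where "p j = inv_into (U' j) (\<phi>' j)" for j
  define p0 where "p0 j = inv_into (U j) (\<phi> j)" for j
  let ?Q2 = "cube n (\<lambda>_. 0) 2" let ?Q3 = "cube n (\<lambda>_. 0) 3"
  define G where "G j x = \<phi> j (R (f j x))" for j x
  define g where "g q = R (e q)" for q
  have A: "smooth_atlas n X A" and A': "smooth_atlas n X' A'" using str str' by (simp_all add: smooth_structure_atlas)
  have f_eq: "f j x = e (p j x)" for j x by (simp add: f_def e_def p_def embedded_param_def)
  have Q23: "?Q2 \<subseteq> ?Q3" and Q2c: "?Q2 \<subseteq> closed_cube n 2" and c1Q2: "closed_cube n 1 \<subseteq> ?Q2"
    by (auto simp: cube_def closed_cube_def)
  have R: "smooth_into N n A W R" and RX: "R ` W \<subseteq> topspace X"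
    using ret by (auto simp: smooth_retraction_def N_def)
  have sf3: "smooth_on n N ?Q3 (f j)" if "j < k" for j
    unfolding f_def N_def by (rule embedded_param_smooth[OF str' H' cub' that])
  have sf: "smooth_on n N ?Q2 (f j)" if "j < k" for j
    by (rule smooth_on_subset[OF sf3[OF that] openin_cube Q23])
  have fW: "f j x \<in> W" and RU: "R (f j x) \<in> U j" if "j < k" "x \<in> ?Q2" for j x
    using close[OF that(1), of x] that(2) Q2c by (auto simp: f_def)
  have sr: "smooth_on N n (W \<inter> R -` U j) (\<lambda>z. \<phi> j (R z))" if "j < k" for j
    by (rule smooth_into_chart[OF R cubical_atlas_chart[OF cub that]])
  have sG: "smooth_on n n ?Q2 (G j)" if "j < k" for j
    unfolding G_def[abs_def] by (rule smooth_on_compose[OF sf sr]) (use fW RU that in auto)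
  have near: "near_identity n (jacobian_matrix (G j) x)" if j: "j < k" and x: "x \<in> ?Q2" for j x
  proof -
    have "near_identity n (pushed_jacobian N (\<lambda>z. \<phi> j (R z)) (f j x) (first_partials n N (f j) x))"
      using close[OF j, of x] x Q2c by (auto simp: f_def N_def)
    moreover have "f j ` ?Q2 \<subseteq> W \<inter> R -` U j" using fW[OF j] RU[OF j] by blast
    note pushed_jacobian_first_partials[OF sf[OF j] sr[OF j] this x]
    ultimately show ?thesis unfolding G_def[abs_def] using near_identity_cong by metis
  qed
  have injG: "inj_on (G j) ?Q2" if "j < k" for j
    by (rule near_identity_imp_inj_on[OF sG near]) (use that in auto)
  have sGinv: "smooth_on n n (G j ` ?Q2) (inv_into ?Q2 (G j))" if "j < k" for j
    by (rule smooth_on_inverse[OF sG injG near]) (use that in auto)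
  have ch: "is_chart n X (U j, \<phi> j)" and ch': "is_chart n X' (U' j, \<phi>' j)" if "j < k" for j
    using atlas_chart[OF A cubical_atlas_chart[OF cub that]] atlas_chart[OF A' cubical_atlas_chart[OF cub' that]] by auto
  have pU: "p j x \<in> U' j" and \<phi>p: "\<phi>' j (p j x) = x" if "j < k" "x \<in> ?Q3" for j x
    using that cubical_atlas_image[OF cub' that(1)] unfolding p_def by (simp_all add: inv_into_into f_inv_into_f)
  have p\<phi>: "p j (\<phi>' j q) = q" if "j < k" "q \<in> U' j" for j q
    using inv_into_f_f[OF is_chart_inj_on[OF ch'[OF that(1)]] that(2)] by (simp add: p_def)
  have p0\<phi>: "p0 j (\<phi> j q) = q" if "j < k" "q \<in> U j" for j q
    using inv_into_f_f[OF is_chart_inj_on[OF ch[OF that(1)]] that(2)] by (simp add: p0_def)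
  have gp: "g (p j x) = p0 j (G j x)" if "j < k" "x \<in> ?Q2" for j x
    unfolding g_def G_def f_eq[symmetric] by (rule p0\<phi>[OF that(1) RU[OF that], symmetric])
  have cover: "\<exists>j x. j < k \<and> x \<in> closed_cube n 1 \<and> q = p j x \<and> q \<in> U' j \<and> \<phi>' j q = x" if "q \<in> topspace X'" for q
  proof -
    from cubical_atlas_cover[OF cub' that] obtain j where j: "j < k" "q \<in> U' j" "\<phi>' j q \<in> closed_cube n 1" .
    then show ?thesis using p\<phi>[OF j(1,2)] by (intro exI[of _ j] exI[of _ "\<phi>' j q"]) simp
  qed
  have gX: "g ` topspace X' \<subseteq> topspace X"
  proof (rule image_subsetI)
    fix q assume "q \<in> topspace X'"
    then obtain j x where j: "j < k" "x \<in> closed_cube n 1" "q = p j x" using cover by blast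
    then have "f j x \<in> W" using fW[OF j(1), of x] c1Q2 by auto
    then show "g q \<in> topspace X" using RX j by (auto simp: g_def f_eq)
  qed
  have gsm: "smooth_map n n (X', A') (X, A) g"
  proof (rule smooth_map_local[OF A' A gX])
    fix q assume "q \<in> topspace X'"
    then obtain j x where j: "j < k" "x \<in> closed_cube n 1" "q = p j x" "q \<in> U' j" "\<phi>' j q = x" using cover by blast
    have "smooth_into n n A ?Q2 (\<lambda>x. R (f j x))"
      by (rule smooth_into_compose[OF R sf[OF j(1)]]) (use fW[OF j(1)] in auto)
    then have "smooth_into n n A ?Q2 (\<lambda>x. g (inv_into (U' j) (\<phi>' j) x))"
      by (simp add: f_eq g_def p_def)
    moreover have "?Q2 \<subseteq> \<phi>' j ` U' j" using cubical_atlas_image[OF cub' j(1)] Q23 by simp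
    moreover have "\<phi>' j q \<in> ?Q2" using j(2,5) c1Q2 by auto
    ultimately show "\<exists>U \<phi> S. (U, \<phi>) \<in> A' \<and> q \<in> U \<and> \<phi> q \<in> S \<and> S \<subseteq> \<phi> ` U \<and> smooth_into n n A S (\<lambda>z. g (inv_into U \<phi> z))"
      using cubical_atlas_chart[OF cub' j(1)] j(4) by (intro exI[of _ "U' j"] exI[of _ "\<phi>' j"] exI[of _ ?Q2]) simp
  qed
  have injg: "inj_on g (topspace X')"
  proof (rule inj_onI)
    fix q1 q2 assume q: "q1 \<in> topspace X'" "q2 \<in> topspace X'" "g q1 = g q2"
    obtain i x where i: "i < k" "x \<in> closed_cube n 1" "q1 = p i x" using cover[OF q(1)] by blast
    obtain j y where j: "j < k" "y \<in> closed_cube n 1" "q2 = p j y" using cover[OF q(2)] by blast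
    have "R (f i x) = R (f j y)" using q(3) i j by (simp add: g_def f_eq)
    then have "p j y \<in> p i ` ?Q2" using overlap[OF i(1) j(1) i(2) j(2)] by (simp add: f_def p_def)
    then obtain x' where x': "x' \<in> ?Q2" "q2 = p i x'" using j(3) by blast
    then have "G i x = G i x'" using q(3) i by (simp add: g_def f_eq G_def)
    then have "x = x'" using injG[OF i(1)] x'(1) i(2) c1Q2 by (meson inj_onD subsetD)
    then show "q1 = q2" using x' i by simp
  qed
  have Gim: "G j ` ?Q2 \<subseteq> \<phi> j ` U j" if "j < k" for j
    using RU[OF that] by (auto simp: G_def)
  have open_g: "openin X (g ` topspace X')"
  proof (subst openin_subopen, intro ballI)
    fix q assume "q \<in> g ` topspace X'"
    then obtain q' where q': "q' \<in> topspace X'" "q = g q'" by blast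
    then obtain j x where j: "j < k" "x \<in> closed_cube n 1" "q' = p j x" using cover by blast
    have x: "x \<in> ?Q2" using j(2) c1Q2 by auto
    define T where "T = {q \<in> U j. \<phi> j q \<in> G j ` ?Q2}"
    have "openin X T"
      unfolding T_def by (rule chart_preimage_open[OF ch[OF j(1)] smooth_on_open[OF sGinv[OF j(1)]]])
    moreover have "q = R (f j x)" using q'(2) j by (simp add: g_def f_eq)
    then have "q \<in> T" using RU[OF j(1) x] x by (auto simp: T_def G_def)
    moreover have "T \<subseteq> g ` topspace X'"
    proof
      fix q assume q: "q \<in> T"
      then obtain y where y: "y \<in> ?Q2" "\<phi> j q = G j y" by (auto simp: T_def)
      then have "q = g (p j y)" using gp[OF j(1) y(1)] p0\<phi>[OF j(1), of q] q by (simp add: T_def)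
      moreover have "p j y \<in> topspace X'" using pU[OF j(1), of y] y(1) Q23 is_chart_subset[OF ch'[OF j(1)]] by blast
      ultimately show "q \<in> g ` topspace X'" by blast
    qed
    ultimately show "\<exists>T. openin X T \<and> q \<in> T \<and> T \<subseteq> g ` topspace X'" by blast
  qed
  have contg: "continuous_map X' X g" using gsm by (simp add: smooth_map_def)
  have closed_g: "closedin X (g ` topspace X')"
    using image_compactin[OF _ contg] comp' H compactin_imp_closedin unfolding compact_space_def by blast
  have surj: "g ` topspace X' = topspace X"
  proof (rule equalityI[OF gX], rule subsetI)
    fix q assume "q \<in> topspace X"
    then obtain j where j: "j < k" "q \<in> U j" by (rule cubical_atlas_cover[OF cub])
    have "connectedin (subtopology (Euclidean_space n) (\<phi> j ` U j)) ?Q3"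
      using connected_cube[of n 3] cubical_atlas_image[OF cub j(1)] by (simp add: connectedin_subtopology)
    then have "connectedin X (p0 j ` ?Q3)"
      unfolding p0_def by (rule connectedin_continuous_map_image[OF chart_inverse_continuous[OF ch[OF j(1)]]])
    moreover have "p0 j ` ?Q3 = U j"
      unfolding cubical_atlas_image[OF cub j(1), symmetric] p0_def using is_chart_inj_on[OF ch[OF j(1)]] by simp
    ultimately have "connectedin X (U j)" by simp
    then have "U j \<subseteq> g ` topspace X' \<or> disjnt (U j) (g ` topspace X')"
      using open_g closed_g connectedin_clopen_cases by blast
    moreover have "g (p j (\<lambda>_. 0)) \<in> U j \<and> p j (\<lambda>_. 0) \<in> topspace X'"
    proof -
      have 0: "(\<lambda>_. 0) \<in> ?Q2" by (simp add: cube_def topspace_Euclidean_space)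
      show ?thesis
        using RU[OF j(1) 0] pU[OF j(1), of "\<lambda>_. 0"] 0 Q23 is_chart_subset[OF ch'[OF j(1)]] by (auto simp: g_def f_eq)
    qed
    ultimately show "q \<in> g ` topspace X'" using j(2) by (auto simp: disjnt_iff)
  qed
  define h where "h = inv_into (topspace X') g"
  have hg: "h (g q) = q" if "q \<in> topspace X'" for q using injg that by (simp add: h_def)
  have gh: "g (h q) = q" if "q \<in> topspace X" for q using surj that by (simp add: h_def f_inv_into_f)
  have hX: "h ` topspace X \<subseteq> topspace X'"
    unfolding h_def surj[symmetric] by (auto simp: inv_into_into)
  have hsm: "smooth_map n n (X, A) (X', A') h"
  proof (rule smooth_map_local[OF A A' hX])
    fix q assume q: "q \<in> topspace X"
    then have "q \<in> g ` topspace X'" unfolding surj .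
    then obtain q' where q': "q' \<in> topspace X'" "q = g q'" by blast
    then obtain j x where j: "j < k" "x \<in> closed_cube n 1" "q' = p j x" using cover by blast
    have x: "x \<in> ?Q2" using j(2) c1Q2 by auto
    have sp: "smooth_into n n A' ?Q3 (p j)"
      using smooth_into_chart_inverse[OF A' cubical_atlas_chart[OF cub' j(1)]] cubical_atlas_image[OF cub' j(1)] by (simp add: p_def)
    have "smooth_into n n A' (G j ` ?Q2) (\<lambda>y. p j (inv_into ?Q2 (G j) y))"
      by (rule smooth_into_compose[OF sp sGinv[OF j(1)]]) (use injG[OF j(1)] Q23 in auto)
    moreover have "p j (inv_into ?Q2 (G j) y) = h (inv_into (U j) (\<phi> j) y)" if "y \<in> G j ` ?Q2" for y
    proof -
      obtain v where v: "v \<in> ?Q2" "y = G j v" using \<open>y \<in> G j ` ?Q2\<close> by blast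
      have "p j v \<in> topspace X'" using pU[OF j(1), of v] v(1) Q23 is_chart_subset[OF ch'[OF j(1)]] by blast
      then have "h (p0 j y) = p j v" using hg gp[OF j(1) v(1)] v(2) by metis
      then show ?thesis using v injG[OF j(1)] by (simp add: p0_def)
    qed
    ultimately have "smooth_into n n A' (G j ` ?Q2) (\<lambda>y. h (inv_into (U j) (\<phi> j) y))"
      by (rule smooth_into_cong)
    moreover have "q = R (f j x)" using q'(2) j by (simp add: g_def f_eq)
    then have "q \<in> U j" "\<phi> j q \<in> G j ` ?Q2" using RU[OF j(1) x] x by (auto simp: G_def)
    ultimately show "\<exists>U \<phi> S. (U, \<phi>) \<in> A \<and> q \<in> U \<and> \<phi> q \<in> S \<and> S \<subseteq> \<phi> ` U \<and> smooth_into n n A' S (\<lambda>z. h (inv_into U \<phi> z))"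
      using cubical_atlas_chart[OF cub j(1)] Gim[OF j(1)]
      by (intro exI[of _ "U j"] exI[of _ "\<phi> j"] exI[of _ "G j ` ?Q2"]) simp
  qed
  show ?thesis
    unfolding diffeomorphic_def fst_conv using gsm hsm hg gh by blast
qed


section \<open>Countably many witnesses\<close>

text \<open>
A compact subset of an open set is covered by finitely many basic open sets inside it. So some member of
this countable family fits between the two.
\<close>

definition countable_opens :: "'p::second_countable_topology set set" where
  "countable_opens = Union ` {F. finite F \<and> F \<subseteq> (SOME B. countable B \<and> topological_basis B)}"

lemma
  shows countable_countable_opens: "countable (countable_opens :: 'p::second_countable_topology set set)"
    and open_countable_opens: "T \<in> (countable_opens :: 'p set set) \<Longrightarrow> open T"
    and countable_opens_sandwich: "compact C \<Longrightarrow> open \<Omega> \<Longrightarrow> C \<subseteq> \<Omega> \<Longrightarrow> \<exists>T\<in>(countable_opens :: 'p set set). C \<subseteq> T \<and> T \<subseteq> \<Omega>"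
proof -
  define B where "B = (SOME B :: 'p set set. countable B \<and> topological_basis B)"
  have "\<exists>B :: 'p set set. countable B \<and> topological_basis B" using ex_countable_basis by blast
  then have B: "countable B" "topological_basis B"
    using someI_ex[of "\<lambda>B :: 'p set set. countable B \<and> topological_basis B"] by (auto simp: B_def)
  have eq: "(countable_opens :: 'p set set) = Union ` {F. finite F \<and> F \<subseteq> B}"
    by (simp add: countable_opens_def B_def)
  show "countable (countable_opens :: 'p set set)"
    unfolding eq using countable_Collect_finite_subset[OF B(1)] by (rule countable_image)
  show "open T" if T: "T \<in> (countable_opens :: 'p set set)"
  proof -
    obtain F where F: "F \<subseteq> B" "T = \<Union>F"
      using T unfolding eq by (elim imageE CollectE conjE) (rule that)
    have "open b" if "b \<in> F" for b using F(1) that by (intro topological_basis_open[OF B(2)]) auto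
    then show ?thesis unfolding F(2) by (intro open_Union) blast
  qed
  show "\<exists>T\<in>(countable_opens :: 'p set set). C \<subseteq> T \<and> T \<subseteq> \<Omega>" if C: "compact C" "open \<Omega>" "C \<subseteq> \<Omega>"
  proof -
    have "C \<subseteq> \<Union>{b \<in> B. b \<subseteq> \<Omega>}"
    proof
      fix x assume "x \<in> C"
      then have "x \<in> \<Omega>" using C(3) by blast
      from topological_basisE[OF B(2) C(2) this] obtain b where "b \<in> B" "x \<in> b" "b \<subseteq> \<Omega>" .
      then show "x \<in> \<Union>{b \<in> B. b \<subseteq> \<Omega>}" by blast
    qed
    moreover have "open b" if "b \<in> {b \<in> B. b \<subseteq> \<Omega>}" for b
      using that by (intro topological_basis_open[OF B(2)]) simp
    ultimately obtain F where F: "F \<subseteq> {b \<in> B. b \<subseteq> \<Omega>}" "finite F" "C \<subseteq> \<Union>F"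
      by (rule compactE[OF C(1)])
    then have "\<Union>F \<in> (countable_opens :: 'p set set)" unfolding eq by blast
    then show ?thesis using F by blast
  qed
qed

text \<open>
The projection to \<open>\<real>\<^sup>n\<close>. Pulling back along it turns relatively open sets of \<open>\<real>\<^sup>n\<close> into open sets of the type.
\<close>

definition truncate_to :: "nat \<Rightarrow> (nat \<Rightarrow> real) \<Rightarrow> nat \<Rightarrow> real" where
  "truncate_to n x = (\<lambda>i. if i < n then x i else 0)"

lemma truncate_to_in: "truncate_to n x \<in> topspace (Euclidean_space n)"
  by (simp add: truncate_to_def topspace_Euclidean_space)

lemma truncate_to_id: "x \<in> topspace (Euclidean_space n) \<Longrightarrow> truncate_to n x = x"
  by (auto simp: truncate_to_def topspace_Euclidean_space fun_eq_iff)

lemma continuous_on_coordinate: "continuous_on S (\<lambda>x::nat \<Rightarrow> real. x i)"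
  by (rule continuous_on_subset[OF continuous_on_product_coordinates]) simp

lemma continuous_on_truncate_to: "continuous_on S (truncate_to n)"
  unfolding truncate_to_def[abs_def]
proof (rule continuous_on_coordinatewise_then_product)
  show "continuous_on S (\<lambda>x. if i < n then x i else 0)" for i
    by (cases "i < n") (simp_all add: continuous_on_coordinate)
qed

lemma open_truncate_to_vimage:
  assumes "openin (Euclidean_space n) U"
  shows "open (truncate_to n -` U)"
proof -
  obtain T where T: "open T" "U = topspace (Euclidean_space n) \<inter> T"
    using assms unfolding openin_Euclidean_iff by blast
  have "truncate_to n -` U = truncate_to n -` T" using T(2) truncate_to_in by auto
  then show ?thesis using open_vimage[OF T(1) continuous_on_truncate_to] by simp
qed

text \<open>
For derivatives and for overlaps, the index of a chart is recorded as a real coordinate, so that the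
finitely many charts are treated in one space. The open conditions allow the index an error below \<open>1 / 2\<close>, from which it
is still recovered.
\<close>

definition jet_graph where
  "jet_graph n k U \<phi> = (\<Union>j<k. (\<lambda>x. (real j, embedded_param n k U \<phi> j x, first_partials n (k * (n + 1)) (embedded_param n k U \<phi> j) x)) ` closed_cube n 2)"

text \<open>
The first requirement of \<open>diffeomorphic_of_close\<close>, as a condition on values and first derivatives.
\<close>

definition close_jets where
  "close_jets n k U \<phi> W R = (\<Union>j<k. {(u, z, D). \<bar>u - real j\<bar> < 1 / 2 \<and>
      truncate_to (k * (n + 1)) z \<in> W \<inter> R -` U j \<and>
      near_identity n (pushed_jacobian (k * (n + 1)) (\<lambda>z. \<phi> j (R z)) (truncate_to (k * (n + 1)) z) D)})"

text \<open>
The places where closed unit cubes overlap. The widened version, in which the second cube is enlarged to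
radius \<open>2\<close>, is open and contains it.
\<close>

definition overlaps where
  "overlaps n k U \<phi> = (\<Union>i<k. \<Union>j<k. (\<lambda>y. (real i, real j, y)) `
      {y \<in> closed_cube n 1. inv_into (U j) (\<phi> j) y \<in> inv_into (U i) (\<phi> i) ` closed_cube n 1})"

definition wide_overlaps where
  "wide_overlaps n k U \<phi> = (\<Union>i<k. \<Union>j<k. {(u, v, y). \<bar>u - real i\<bar> < 1 / 2 \<and> \<bar>v - real j\<bar> < 1 / 2 \<and>
      truncate_to n y \<in> cube n (\<lambda>_. 0) 3 \<and>
      inv_into (U j) (\<phi> j) (truncate_to n y) \<in> inv_into (U i) (\<phi> i) ` cube n (\<lambda>_. 0) 2})"

text \<open>
If \<open>T\<close> contains the overlaps, then the pairs that it leaves over belong to different points of the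
manifold. They form a compact set, and so do their images under the embedding.
\<close>

definition separated_pairs where
  "separated_pairs n k U \<phi> T = (\<Union>i<k. \<Union>j<k. (\<lambda>(x, y). (embedded_param n k U \<phi> i x, embedded_param n k U \<phi> j y)) `
      {(x, y). x \<in> closed_cube n 1 \<and> y \<in> closed_cube n 1 \<and> (real i, real j, y) \<notin> T})"

definition separated_values where
  "separated_values N W R = {(z, w). truncate_to N z \<in> W \<and> truncate_to N w \<in> W \<and> R (truncate_to N z) \<noteq> R (truncate_to N w)}"

lemma compact_jet_graph:
  assumes str: "smooth_structure n X A" and H: "Hausdorff_space X" and cub: "cubical_atlas n X A k U \<phi>"
  shows "compact (jet_graph n k U \<phi>)"
  unfolding jet_graph_def
proof (intro compact_UN compact_continuous_image compact_closed_cube)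
  fix j assume "j \<in> {..<k}"
  then have f: "smooth_on n (k * (n + 1)) (cube n (\<lambda>_. 0) 3) (embedded_param n k U \<phi> j)"
    using embedded_param_smooth[OF str H cub] by simp
  have sub: "closed_cube n 2 \<subseteq> cube n (\<lambda>_. 0) 3" by (rule closed_cube_subset_cube) simp
  have "continuous_on (closed_cube n 2) (first_partials n (k * (n + 1)) (embedded_param n k U \<phi> j))"
    unfolding first_partials_def[abs_def]
  proof (intro continuous_on_coordinatewise_then_product)
    fix i m
    show "continuous_on (closed_cube n 2) (\<lambda>x. if i < n \<and> m < k * (n + 1) then pderiv_at i (\<lambda>x. embedded_param n k U \<phi> j x m) x else 0)"
    proof (cases "i < n \<and> m < k * (n + 1)")
      case True
      then have "continuous_on (cube n (\<lambda>_. 0) 3) (pderiv_at i (\<lambda>x. embedded_param n k U \<phi> j x m))"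
        using smooth_real_on_continuous smooth_real_on_pderiv smooth_on_component[OF f] by blast
      then show ?thesis using True continuous_on_subset[OF _ sub] by simp
    qed auto
  qed
  then show "continuous_on (closed_cube n 2) (\<lambda>x. (real j, embedded_param n k U \<phi> j x, first_partials n (k * (n + 1)) (embedded_param n k U \<phi> j) x))"
    by (intro continuous_on_Pair continuous_on_const continuous_on_subset[OF smooth_on_continuous[OF f] sub])
qed simp

lemma open_near_identity:
  assumes S: "open S" and F: "\<And>i j. i < n \<Longrightarrow> j < n \<Longrightarrow> continuous_on S (F i j)"
  shows "open {p \<in> S. near_identity n (\<lambda>i j. F i j p)}"
proof -
  have "open (S \<inter> (\<lambda>p. F i j p - (if i = j then 1 else 0)) -` {- (1 / (real n + 1)) <..< 1 / (real n + 1)})"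
    if "i < n" "j < n" for i j
    by (rule continuous_open_preimage[OF _ S]) (auto intro!: continuous_intros F that)
  then have "open (S \<inter> (\<Inter>(i, j)\<in>{..<n} \<times> {..<n}. S \<inter> (\<lambda>p. F i j p - (if i = j then 1 else 0)) -` {- (1 / (real n + 1)) <..< 1 / (real n + 1)}))"
    by (intro open_Int S open_INT) auto
  moreover have "{p \<in> S. near_identity n (\<lambda>i j. F i j p)} =
      S \<inter> (\<Inter>(i, j)\<in>{..<n} \<times> {..<n}. S \<inter> (\<lambda>p. F i j p - (if i = j then 1 else 0)) -` {- (1 / (real n + 1)) <..< 1 / (real n + 1)})"
    unfolding near_identity_def abs_less_iff by (auto simp: minus_less_iff)
  ultimately show ?thesis by simp
qed

lemma open_close_jets:
  assumes cub: "cubical_atlas n X A k U \<phi>" and ret: "smooth_retraction n X A k U \<phi> W R"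
  shows "open (close_jets n k U \<phi> W R)"
  unfolding close_jets_def
proof (intro open_UN ballI)
  fix j assume "j \<in> {..<k}"
  then have j: "j < k" by simp
  define N where "N = k * (n + 1)"
  define V where "V = W \<inter> R -` U j"
  define r where "r = (\<lambda>z. \<phi> j (R z))"
  have sr: "smooth_on N n V r"
    unfolding V_def r_def N_def using ret cubical_atlas_chart[OF cub j]
    by (intro smooth_into_chart) (auto simp: smooth_retraction_def)
  define S where "S = {u::real. \<bar>u - real j\<bar> < 1 / 2} \<times> (truncate_to N -` V) \<times> (UNIV :: (nat \<Rightarrow> nat \<Rightarrow> real) set)"
  have S: "open S"
    unfolding S_def
    by (intro open_Times open_truncate_to_vimage smooth_on_open[OF sr] open_UNIV open_Collect_less continuous_intros)
  have ct: "continuous_on S (\<lambda>p. truncate_to N (fst (snd p)))"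
    by (rule continuous_on_compose2[OF continuous_on_truncate_to[of UNIV]])
      (intro continuous_on_fst continuous_on_snd continuous_on_id, simp)
  have "continuous_on S (\<lambda>p. pushed_jacobian N r (truncate_to N (fst (snd p))) (snd (snd p)) l i)" if "l < n" "i < n" for l i
    unfolding pushed_jacobian_def
  proof (intro continuous_on_sum continuous_on_mult)
    fix m assume "m \<in> {..<N}"
    then have "continuous_on V (\<lambda>z. pderiv_at m (\<lambda>z. r z l) z)"
      using smooth_real_on_continuous[OF smooth_real_on_pderiv[OF smooth_on_component[OF sr \<open>l < n\<close>]]] by simp
    then show "continuous_on S (\<lambda>p. pderiv_at m (\<lambda>z. r z l) (truncate_to N (fst (snd p))))"
      by (rule continuous_on_compose2[where f = "\<lambda>p. truncate_to N (fst (snd p))"])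
        (use ct in \<open>auto simp: S_def\<close>)
    show "continuous_on S (\<lambda>p. snd (snd p) i m)"
      by (rule continuous_on_product_then_coordinatewise, rule continuous_on_product_then_coordinatewise)
        (intro continuous_on_snd continuous_on_id)
  qed
  from open_near_identity[OF S, of n "\<lambda>l i p. pushed_jacobian N r (truncate_to N (fst (snd p))) (snd (snd p)) l i", OF this]
  have "open {p \<in> S. near_identity n (pushed_jacobian N r (truncate_to N (fst (snd p))) (snd (snd p)))}" by simp
  moreover have "{p \<in> S. near_identity n (pushed_jacobian N r (truncate_to N (fst (snd p))) (snd (snd p)))} =
      {(u, z, D). \<bar>u - real j\<bar> < 1 / 2 \<and> truncate_to N z \<in> V \<and> near_identity n (pushed_jacobian N r (truncate_to N z) D)}"
    by (auto simp: S_def)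
  ultimately show "open {(u, z, D). \<bar>u - real j\<bar> < 1 / 2 \<and> truncate_to (k * (n + 1)) z \<in> W \<inter> R -` U j \<and>
      near_identity n (pushed_jacobian (k * (n + 1)) (\<lambda>z. \<phi> j (R z)) (truncate_to (k * (n + 1)) z) D)}"
    by (simp add: N_def V_def r_def)
qed

text \<open>
For the manifold itself, \<open>R\<close> undoes the embedding, and the Jacobian in question is the identity.
\<close>

lemma jet_graph_subset_close_jets:
  assumes str: "smooth_structure n X A" and H: "Hausdorff_space X" and cub: "cubical_atlas n X A k U \<phi>"
    and ret: "smooth_retraction n X A k U \<phi> W R"
  shows "jet_graph n k U \<phi> \<subseteq> close_jets n k U \<phi> W R"
  unfolding jet_graph_def close_jets_def
proof (intro UN_mono order_refl image_subsetI)
  fix j x assume "j \<in> {..<k}" and x: "x \<in> closed_cube n 2"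
  then have j: "j < k" by simp
  define N where "N = k * (n + 1)"
  let ?Q3 = "cube n (\<lambda>_. 0) 3"
  let ?f = "embedded_param n k U \<phi> j"
  have A: "smooth_atlas n X A" by (rule smooth_structure_atlas[OF str])
  have ch: "is_chart n X (U j, \<phi> j)" by (rule atlas_chart[OF A cubical_atlas_chart[OF cub j]])
  have f: "smooth_on n N ?Q3 ?f" unfolding N_def by (rule embedded_param_smooth[OF str H cub j])
  have xQ: "x \<in> ?Q3" using x closed_cube_subset_cube[of 2 3 n] by auto
  have sr: "smooth_on N n (W \<inter> R -` U j) (\<lambda>z. \<phi> j (R z))"
    unfolding N_def using ret cubical_atlas_chart[OF cub j]
    by (intro smooth_into_chart) (auto simp: smooth_retraction_def)
  have val: "?f y \<in> W \<and> R (?f y) = inv_into (U j) (\<phi> j) y \<and> R (?f y) \<in> U j \<and> \<phi> j (R (?f y)) = y" if y: "y \<in> ?Q3" for y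
  proof -
    have y': "y \<in> \<phi> j ` U j" using y cubical_atlas_image[OF cub j] by simp
    then have U: "inv_into (U j) (\<phi> j) y \<in> U j" by (rule inv_into_into)
    then have "inv_into (U j) (\<phi> j) y \<in> topspace X" using is_chart_subset[OF ch] by blast
    then have "?f y \<in> W \<and> R (?f y) = inv_into (U j) (\<phi> j) y"
      using ret unfolding smooth_retraction_def embedded_param_def by blast
    then show ?thesis using U f_inv_into_f[OF y'] by simp
  qed
  have fQ: "?f ` ?Q3 \<subseteq> W \<inter> R -` U j" using val by blast
  have "near_identity n (jacobian_matrix (\<lambda>x. \<phi> j (R (?f x))) x)"
  proof -
    have "jacobian_matrix (\<lambda>x. \<phi> j (R (?f x))) x l i = (if l = i then 1 else 0)" if "l < n" "i < n" for l i
    proof -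
      have "\<forall>\<^sub>F t in nhds (x i). \<phi> j (R (?f (x(i := t)))) l = (x(i := t)) l"
        using eventually_fun_upd_in[OF openin_cube xQ that(2)] by eventually_elim (use val in metis)
      then have "jacobian_matrix (\<lambda>x. \<phi> j (R (?f x))) x l i = deriv (\<lambda>t. (x(i := t)) l) (x i)"
        unfolding jacobian_matrix_def pderiv_at_def by (rule deriv_cong_ev) simp
      moreover have "((\<lambda>t. (x(i := t)) l) has_real_derivative (if l = i then 1 else 0)) (at (x i))"
        by (cases "l = i") (auto intro!: derivative_eq_intros)
      ultimately show ?thesis using DERIV_imp_deriv by metis
    qed
    then show ?thesis by (simp add: near_identity_def)
  qed
  then have "near_identity n (pushed_jacobian N (\<lambda>z. \<phi> j (R z)) (?f x) (first_partials n N ?f x))"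
    using near_identity_cong[of n "pushed_jacobian N (\<lambda>z. \<phi> j (R z)) (?f x) (first_partials n N ?f x)", OF pushed_jacobian_first_partials[OF f sr fQ xQ]]
    by blast
  moreover have "truncate_to N (?f x) = ?f x" by (rule truncate_to_id[OF smooth_on_in[OF f xQ]])
  ultimately show "(real j, ?f x, first_partials n (k * (n + 1)) ?f x) \<in> {(u, z, D). \<bar>u - real j\<bar> < 1 / 2 \<and>
      truncate_to (k * (n + 1)) z \<in> W \<inter> R -` U j \<and>
      near_identity n (pushed_jacobian (k * (n + 1)) (\<lambda>z. \<phi> j (R z)) (truncate_to (k * (n + 1)) z) D)}"
    using val[OF xQ, THEN conjunct1] val[OF xQ, THEN conjunct2, THEN conjunct2, THEN conjunct1] by (simp add: N_def)
qed

lemma closed_cube_1_subset: "closed_cube n 1 \<subseteq> cube n (\<lambda>_. 0) 3"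
  by (rule closed_cube_subset_cube) simp

lemma overlap_preimage_open:
  assumes str: "smooth_structure n X A" and cub: "cubical_atlas n X A k U \<phi>" and j: "j < k" and T: "openin X T"
  shows "openin (Euclidean_space n) (cube n (\<lambda>_. 0) 3 \<inter> inv_into (U j) (\<phi> j) -` T)"
proof -
  have A: "smooth_atlas n X A" by (rule smooth_structure_atlas[OF str])
  have c: "(U j, \<phi> j) \<in> A" by (rule cubical_atlas_chart[OF cub j])
  have "inv_into (U j) (\<phi> j) ` cube n (\<lambda>_. 0) 3 \<subseteq> topspace X"
    unfolding cubical_atlas_image[OF cub j, symmetric]
    using is_chart_subset[OF atlas_chart[OF A c]] by (auto simp: inv_into_into)
  then show ?thesis
    using smooth_into_preimage_open[OF A smooth_into_chart_inverse[OF A c] _ T] cubical_atlas_image[OF cub j] by simp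
qed

text \<open>
The set is closed in the cube because the image of the other cube is compact, hence closed, in \<open>X\<close>.
\<close>

lemma compact_overlaps:
  assumes str: "smooth_structure n X A" and H: "Hausdorff_space X" and cub: "cubical_atlas n X A k U \<phi>"
  shows "compact (overlaps n k U \<phi>)"
  unfolding overlaps_def
proof (intro compact_UN compact_continuous_image)
  fix i j assume "i \<in> {..<k}" "j \<in> {..<k}"
  then have ij: "i < k" "j < k" by auto
  let ?S = "{y \<in> closed_cube n 1. inv_into (U j) (\<phi> j) y \<in> inv_into (U i) (\<phi> i) ` closed_cube n 1}"
  show "continuous_on ?S (\<lambda>y. (real i, real j, y))" by (intro continuous_intros)
  have ch: "is_chart n X (U i, \<phi> i)"
    by (rule atlas_chart[OF smooth_structure_atlas[OF str] cubical_atlas_chart[OF cub ij(1)]])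
  have K: "closedin X (inv_into (U i) (\<phi> i) ` closed_cube n 1)"
    using cubical_atlas_image[OF cub ij(1)] closed_cube_1_subset[of n]
    by (intro chart_inverse_compact_closed[OF ch compact_closed_cube _ H]) simp
  from overlap_preimage_open[OF str cub ij(2), OF openin_diff[OF openin_topspace K]]
  obtain T where T: "open T" "cube n (\<lambda>_. 0) 3 \<inter> inv_into (U j) (\<phi> j) -` (topspace X - inv_into (U i) (\<phi> i) ` closed_cube n 1)
      = topspace (Euclidean_space n) \<inter> T"
    unfolding openin_Euclidean_iff by (elim exE conjE)
  have "?S = closed_cube n 1 - T"
  proof (intro equalityI subsetI)
    fix y assume y: "y \<in> ?S"
    then have "y \<in> topspace (Euclidean_space n)" using closed_cube_subset by blast
    then show "y \<in> closed_cube n 1 - T" using y T(2) by blast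
  next
    fix y assume y: "y \<in> closed_cube n 1 - T"
    then have Q: "y \<in> cube n (\<lambda>_. 0) 3" using closed_cube_1_subset by blast
    then have "inv_into (U j) (\<phi> j) y \<in> U j"
      using cubical_atlas_image[OF cub ij(2)] by (simp add: inv_into_into)
    then have "inv_into (U j) (\<phi> j) y \<in> topspace X"
      using is_chart_subset[OF atlas_chart[OF smooth_structure_atlas[OF str] cubical_atlas_chart[OF cub ij(2)]]] by blast
    then show "y \<in> ?S" using y Q T(2) cube_subset by blast
  qed
  then show "compact ?S" using compact_diff[OF compact_closed_cube T(1)] by simp
qed auto

lemma open_wide_overlaps:
  assumes str: "smooth_structure n X A" and cub: "cubical_atlas n X A k U \<phi>"
  shows "open (wide_overlaps n k U \<phi>)"
  unfolding wide_overlaps_def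
proof (intro open_UN ballI)
  fix i j assume "i \<in> {..<k}" "j \<in> {..<k}"
  then have ij: "i < k" "j < k" by auto
  let ?P = "inv_into (U i) (\<phi> i) ` cube n (\<lambda>_. 0) 2"
  have ch: "is_chart n X (U i, \<phi> i)"
    by (rule atlas_chart[OF smooth_structure_atlas[OF str] cubical_atlas_chart[OF cub ij(1)]])
  have "?P = {q \<in> U i. \<phi> i q \<in> cube n (\<lambda>_. 0) 2}"
  proof (intro equalityI subsetI)
    fix q assume "q \<in> ?P"
    then obtain x where x: "x \<in> cube n (\<lambda>_. 0) 2" "q = inv_into (U i) (\<phi> i) x" by blast
    then have "x \<in> \<phi> i ` U i" using cubical_atlas_image[OF cub ij(1)] by (auto simp: cube_def)
    then show "q \<in> {q \<in> U i. \<phi> i q \<in> cube n (\<lambda>_. 0) 2}" using x by (simp add: inv_into_into f_inv_into_f)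
  next
    fix q assume "q \<in> {q \<in> U i. \<phi> i q \<in> cube n (\<lambda>_. 0) 2}"
    then show "q \<in> ?P" using is_chart_inj_on[OF ch] by (intro image_eqI[of _ _ "\<phi> i q"]) auto
  qed
  then have "openin X ?P" using chart_preimage_open[OF ch openin_cube] by simp
  from open_truncate_to_vimage[OF overlap_preimage_open[OF str cub ij(2) this]]
  have "open ({u::real. \<bar>u - real i\<bar> < 1 / 2} \<times> {v::real. \<bar>v - real j\<bar> < 1 / 2} \<times>
      (truncate_to n -` (cube n (\<lambda>_. 0) 3 \<inter> inv_into (U j) (\<phi> j) -` ?P)))"
    by (intro open_Times) (auto intro!: open_Collect_less continuous_intros)
  moreover have "{u::real. \<bar>u - real i\<bar> < 1 / 2} \<times> {v::real. \<bar>v - real j\<bar> < 1 / 2} \<times>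
      (truncate_to n -` (cube n (\<lambda>_. 0) 3 \<inter> inv_into (U j) (\<phi> j) -` ?P)) =
    {(u, v, y). \<bar>u - real i\<bar> < 1 / 2 \<and> \<bar>v - real j\<bar> < 1 / 2 \<and> truncate_to n y \<in> cube n (\<lambda>_. 0) 3 \<and>
      inv_into (U j) (\<phi> j) (truncate_to n y) \<in> ?P}" by auto
  ultimately show "open {(u, v, y). \<bar>u - real i\<bar> < 1 / 2 \<and> \<bar>v - real j\<bar> < 1 / 2 \<and> truncate_to n y \<in> cube n (\<lambda>_. 0) 3 \<and>
      inv_into (U j) (\<phi> j) (truncate_to n y) \<in> ?P}" by simp
qed

lemma overlaps_subset_wide_overlaps: "overlaps n k U \<phi> \<subseteq> wide_overlaps n k U \<phi>"
  unfolding overlaps_def wide_overlaps_def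
proof (intro UN_mono order_refl image_subsetI)
  fix i j y assume y: "y \<in> {y \<in> closed_cube n 1. inv_into (U j) (\<phi> j) y \<in> inv_into (U i) (\<phi> i) ` closed_cube n 1}"
  have "truncate_to n y = y" using y closed_cube_subset truncate_to_id by blast
  moreover have "y \<in> cube n (\<lambda>_. 0) 3" using y closed_cube_1_subset by blast
  moreover have "closed_cube n 1 \<subseteq> cube n (\<lambda>_. 0) 2" by (rule closed_cube_subset_cube) simp
  ultimately show "(real i, real j, y) \<in> {(u, v, y). \<bar>u - real i\<bar> < 1 / 2 \<and> \<bar>v - real j\<bar> < 1 / 2 \<and>
      truncate_to n y \<in> cube n (\<lambda>_. 0) 3 \<and>
      inv_into (U j) (\<phi> j) (truncate_to n y) \<in> inv_into (U i) (\<phi> i) ` cube n (\<lambda>_. 0) 2}"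
    using y by auto
qed

lemma compact_separated_pairs:
  assumes str: "smooth_structure n X A" and H: "Hausdorff_space X" and cub: "cubical_atlas n X A k U \<phi>" and T: "open T"
  shows "compact (separated_pairs n k U \<phi> T)"
  unfolding separated_pairs_def
proof (intro compact_UN compact_continuous_image)
  fix i j assume "i \<in> {..<k}" "j \<in> {..<k}"
  then have ij: "i < k" "j < k" by auto
  let ?S = "{(x, y). x \<in> closed_cube n 1 \<and> y \<in> closed_cube n 1 \<and> (real i, real j, y) \<notin> T}"
  have "open ((\<lambda>y. (real i, real j, y)) -` T)" by (intro open_vimage[OF T] continuous_intros)
  then have "compact (closed_cube n 1 \<times> (closed_cube n 1 - (\<lambda>y. (real i, real j, y)) -` T))"
    by (intro compact_Times compact_diff compact_closed_cube)
  moreover have "?S = closed_cube n 1 \<times> (closed_cube n 1 - (\<lambda>y. (real i, real j, y)) -` T)" by auto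
  ultimately show "compact ?S" by simp
  have cont: "continuous_on (closed_cube n 1) (embedded_param n k U \<phi> l)" if "l < k" for l
    using continuous_on_subset[OF smooth_on_continuous[OF embedded_param_smooth[OF str H cub that]] closed_cube_1_subset] .
  have "continuous_on ?S (\<lambda>p. (embedded_param n k U \<phi> i (fst p), embedded_param n k U \<phi> j (snd p)))"
    by (intro continuous_on_Pair continuous_on_compose2[OF cont[OF ij(1)]] continuous_on_compose2[OF cont[OF ij(2)]] continuous_intros)
      auto
  then show "continuous_on ?S (\<lambda>(x, y). (embedded_param n k U \<phi> i x, embedded_param n k U \<phi> j y))"
    by (simp add: case_prod_unfold)
qed auto

text \<open>
Distinct points of a Hausdorff space have disjoint neighbourhoods, and \<open>R\<close> is continuous.
\<close>

lemma open_separated_values: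
  assumes A: "smooth_atlas n X A" and H: "Hausdorff_space X" and R: "smooth_into N n A W R" and RX: "R ` W \<subseteq> topspace X"
  shows "open (separated_values N W R)"
proof (subst open_subopen, intro ballI)
  fix p assume "p \<in> separated_values N W R"
  then obtain z w where p: "p = (z, w)" "truncate_to N z \<in> W" "truncate_to N w \<in> W" "R (truncate_to N z) \<noteq> R (truncate_to N w)"
    by (auto simp: separated_values_def)
  then have "R (truncate_to N z) \<in> topspace X" "R (truncate_to N w) \<in> topspace X" using RX by auto
  then obtain O1 O2 where sep: "openin X O1" "openin X O2" "R (truncate_to N z) \<in> O1" "R (truncate_to N w) \<in> O2" "disjnt O1 O2"
    using H p(4) unfolding Hausdorff_space_def by metis
  define V where "V = (truncate_to N -` (W \<inter> R -` O1)) \<times> (truncate_to N -` (W \<inter> R -` O2))"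
  have "open V"
    unfolding V_def
    by (intro open_Times open_truncate_to_vimage smooth_into_preimage_open[OF A R RX] sep)
  moreover have "p \<in> V" using p sep by (simp add: V_def)
  moreover have "V \<subseteq> separated_values N W R" using sep(5) by (auto simp: V_def separated_values_def disjnt_iff)
  ultimately show "\<exists>V. open V \<and> p \<in> V \<and> V \<subseteq> separated_values N W R" by (intro exI conjI)
qed

lemma separated_pairs_subset:
  assumes str: "smooth_structure n X A" and H: "Hausdorff_space X" and cub: "cubical_atlas n X A k U \<phi>"
    and ret: "smooth_retraction n X A k U \<phi> W R" and T: "overlaps n k U \<phi> \<subseteq> T"
  shows "separated_pairs n k U \<phi> T \<subseteq> separated_values (k * (n + 1)) W R"
proof
  fix p assume "p \<in> separated_pairs n k U \<phi> T"
  then obtain i j x y where ij: "i < k" "j < k" and xy: "x \<in> closed_cube n 1" "y \<in> closed_cube n 1" "(real i, real j, y) \<notin> T"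
    and p: "p = (embedded_param n k U \<phi> i x, embedded_param n k U \<phi> j y)"
    unfolding separated_pairs_def by auto
  have val: "truncate_to (k * (n + 1)) (embedded_param n k U \<phi> l v) = embedded_param n k U \<phi> l v \<and> embedded_param n k U \<phi> l v \<in> W \<and>
      R (embedded_param n k U \<phi> l v) = inv_into (U l) (\<phi> l) v" if l: "l < k" and v: "v \<in> closed_cube n 1" for l v
  proof -
    have vQ: "v \<in> cube n (\<lambda>_. 0) 3" using v closed_cube_1_subset by blast
    then have "inv_into (U l) (\<phi> l) v \<in> U l" using cubical_atlas_image[OF cub l] by (simp add: inv_into_into)
    then have "inv_into (U l) (\<phi> l) v \<in> topspace X"
      using is_chart_subset[OF atlas_chart[OF smooth_structure_atlas[OF str] cubical_atlas_chart[OF cub l]]] by blast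
    moreover have "truncate_to (k * (n + 1)) (embedded_param n k U \<phi> l v) = embedded_param n k U \<phi> l v"
      by (rule truncate_to_id[OF smooth_on_in[OF embedded_param_smooth[OF str H cub l] vQ]])
    ultimately show ?thesis using ret unfolding smooth_retraction_def embedded_param_def by simp
  qed
  have "inv_into (U j) (\<phi> j) y \<noteq> inv_into (U i) (\<phi> i) x"
  proof
    assume "inv_into (U j) (\<phi> j) y = inv_into (U i) (\<phi> i) x"
    then have "(real i, real j, y) \<in> overlaps n k U \<phi>" using ij xy by (auto simp: overlaps_def)
    then show False using T xy(3) by blast
  qed
  then show "p \<in> separated_values (k * (n + 1)) W R"
    using val[OF ij(1) xy(1)] val[OF ij(2) xy(2)] by (auto simp: p separated_values_def)
qed

text \<open>
The number of charts and three open sets: for derivatives, for overlaps, and for separated pairs.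
\<close>

type_synonym witness =
  "nat \<times> (real \<times> (nat \<Rightarrow> real) \<times> (nat \<Rightarrow> nat \<Rightarrow> real)) set \<times> (real \<times> real \<times> (nat \<Rightarrow> real)) set \<times> ((nat \<Rightarrow> real) \<times> (nat \<Rightarrow> real)) set"

text \<open>
Each of the three open sets lies between a compact set and an open set given by the manifold. The third
pair depends on the choice of the second set \<open>T2\<close>.
\<close>

definition has_witness :: "nat \<Rightarrow> 'a manifold \<Rightarrow> witness \<Rightarrow> bool" where
  "has_witness n M = (\<lambda>(k, T1, T2, T3). \<exists>U \<phi> W R.
     cubical_atlas n (fst M) (snd M) k U \<phi> \<and> smooth_retraction n (fst M) (snd M) k U \<phi> W R \<and>
     jet_graph n k U \<phi> \<subseteq> T1 \<and> T1 \<subseteq> close_jets n k U \<phi> W R \<and>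
     overlaps n k U \<phi> \<subseteq> T2 \<and> T2 \<subseteq> wide_overlaps n k U \<phi> \<and>
     separated_pairs n k U \<phi> T2 \<subseteq> T3 \<and> T3 \<subseteq> separated_values (k * (n + 1)) W R)"

lemma witness_exists:
  assumes M: "closed_manifold n M"
  shows "\<exists>w \<in> UNIV \<times> countable_opens \<times> countable_opens \<times> countable_opens. has_witness n M w"
proof -
  obtain X A where XA: "M = (X, A)" by fastforce
  have str: "smooth_structure n X A" and H: "Hausdorff_space X" and comp: "compact_space X"
    using M by (auto simp: XA closed_manifold_def smooth_manifold_def)
  obtain k U \<phi> where cub: "cubical_atlas n X A k U \<phi>" using cubical_atlas_exists[OF str comp] by blast
  obtain W R where ret: "smooth_retraction n X A k U \<phi> W R" using smooth_retraction_exists[OF str cub] by blast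
  obtain T1 where T1: "T1 \<in> countable_opens" "jet_graph n k U \<phi> \<subseteq> T1" "T1 \<subseteq> close_jets n k U \<phi> W R"
    using countable_opens_sandwich[OF compact_jet_graph[OF str H cub] open_close_jets[OF cub ret] jet_graph_subset_close_jets[OF str H cub ret]]
    by blast
  obtain T2 where T2: "T2 \<in> countable_opens" "overlaps n k U \<phi> \<subseteq> T2" "T2 \<subseteq> wide_overlaps n k U \<phi>"
    using countable_opens_sandwich[OF compact_overlaps[OF str H cub] open_wide_overlaps[OF str cub] overlaps_subset_wide_overlaps]
    by blast
  have o: "open (separated_values (k * (n + 1)) W R)"
    using ret by (intro open_separated_values[OF smooth_structure_atlas[OF str] H]) (auto simp: smooth_retraction_def)
  obtain T3 where T3: "T3 \<in> countable_opens" "separated_pairs n k U \<phi> T2 \<subseteq> T3" "T3 \<subseteq> separated_values (k * (n + 1)) W R"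
    using countable_opens_sandwich[OF compact_separated_pairs[OF str H cub open_countable_opens[OF T2(1)]] o separated_pairs_subset[OF str H cub ret T2(2)]]
    by blast
  have "has_witness n M (k, T1, T2, T3)"
    unfolding has_witness_def XA using cub ret T1 T2 T3 by auto
  then show ?thesis using T1(1) T2(1) T3(1) by blast
qed

lemma half_distance_eq: "\<bar>real i - real j\<bar> < 1 / 2 \<Longrightarrow> i = j"
  by linarith

text \<open>
The sets \<open>T1\<close> and \<open>T3\<close> transfer what the retraction of \<open>M\<close> requires to the embedding of \<open>M'\<close>, while \<open>T2\<close>
is used on the side of \<open>M'\<close>: points of \<open>M'\<close> that the retraction of \<open>M\<close> identifies cannot form a pair
separated by \<open>T2\<close>, hence overlap in \<open>M'\<close>.
\<close>

proposition same_witness_diffeomorphic: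
  assumes M: "closed_manifold n M" and M': "closed_manifold n M'"
    and w: "has_witness n M w" and w': "has_witness n M' w"
  shows "diffeomorphic n M M'"
proof -
  obtain X A X' A' where XA: "M = (X, A)" "M' = (X', A')" by (metis surj_pair)
  have str: "smooth_structure n X A" and H: "Hausdorff_space X"
    and str': "smooth_structure n X' A'" and H': "Hausdorff_space X'" and comp': "compact_space X'"
    using M M' by (auto simp: XA closed_manifold_def smooth_manifold_def)
  obtain k T1 T2 T3 where w_eq: "w = (k, T1, T2, T3)" by (metis surj_pair)
  obtain U \<phi> W R where cub: "cubical_atlas n X A k U \<phi>" and ret: "smooth_retraction n X A k U \<phi> W R"
    and T1: "T1 \<subseteq> close_jets n k U \<phi> W R" and T3: "T3 \<subseteq> separated_values (k * (n + 1)) W R"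
    using w unfolding has_witness_def w_eq XA by auto
  obtain U' \<phi>' W' R' where cub': "cubical_atlas n X' A' k U' \<phi>'"
    and T1': "jet_graph n k U' \<phi>' \<subseteq> T1" and T2': "T2 \<subseteq> wide_overlaps n k U' \<phi>'"
    and T3': "separated_pairs n k U' \<phi>' T2 \<subseteq> T3"
    using w' unfolding has_witness_def w_eq XA by auto
  define N where "N = k * (n + 1)"
  have tr: "truncate_to N (embedded_param n k U' \<phi>' j x) = embedded_param n k U' \<phi>' j x" if "j < k" "x \<in> closed_cube n 2" for j x
  proof -
    have "x \<in> cube n (\<lambda>_. 0) 3" using that(2) closed_cube_subset_cube[of 2 3 n] by auto
    then show ?thesis unfolding N_def by (intro truncate_to_id smooth_on_in[OF embedded_param_smooth[OF str' H' cub' that(1)]])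
  qed
  show ?thesis
    unfolding XA
  proof (rule diffeomorphic_of_close[OF str H cub ret str' H' comp' cub'])
    fix j x assume j: "j < k" and x: "x \<in> closed_cube n 2"
    have "(real j, embedded_param n k U' \<phi>' j x, first_partials n N (embedded_param n k U' \<phi>' j) x) \<in> jet_graph n k U' \<phi>'"
      using j x by (auto simp: jet_graph_def N_def)
    then have "(real j, embedded_param n k U' \<phi>' j x, first_partials n N (embedded_param n k U' \<phi>' j) x) \<in> close_jets n k U \<phi> W R"
      using T1' T1 by blast
    then obtain l where l: "l < k" "\<bar>real j - real l\<bar> < 1 / 2" "truncate_to N (embedded_param n k U' \<phi>' j x) \<in> W \<inter> R -` U l"
      "near_identity n (pushed_jacobian N (\<lambda>z. \<phi> l (R z)) (truncate_to N (embedded_param n k U' \<phi>' j x)) (first_partials n N (embedded_param n k U' \<phi>' j) x))"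
      unfolding close_jets_def N_def by auto
    have "l = j" using half_distance_eq[OF l(2)] by simp
    then show "embedded_param n k U' \<phi>' j x \<in> W \<inter> R -` U j \<and>
        near_identity n (pushed_jacobian (k * (n + 1)) (\<lambda>z. \<phi> j (R z)) (embedded_param n k U' \<phi>' j x) (first_partials n (k * (n + 1)) (embedded_param n k U' \<phi>' j) x))"
      using l tr[OF j x] by (simp add: N_def)
  next
    fix i j x y assume ij: "i < k" "j < k" and xy: "x \<in> closed_cube n 1" "y \<in> closed_cube n 1"
      and eq: "R (embedded_param n k U' \<phi>' i x) = R (embedded_param n k U' \<phi>' j y)"
    have sub: "closed_cube n 1 \<subseteq> closed_cube n 2" by (auto simp: closed_cube_def)
    have "(real i, real j, y) \<in> T2"
    proof (rule ccontr)
      assume "(real i, real j, y) \<notin> T2"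
      then have "(embedded_param n k U' \<phi>' i x, embedded_param n k U' \<phi>' j y) \<in> separated_pairs n k U' \<phi>' T2"
        unfolding separated_pairs_def using ij xy
        by (intro UN_I[of i] UN_I[of j] image_eqI[of _ _ "(x, y)"]) simp_all
      then have "(embedded_param n k U' \<phi>' i x, embedded_param n k U' \<phi>' j y) \<in> separated_values N W R" using T3' T3 N_def by blast
      then show False
        using eq tr[OF ij(1) subsetD[OF sub xy(1)]] tr[OF ij(2) subsetD[OF sub xy(2)]] by (simp add: separated_values_def)
    qed
    then have "(real i, real j, y) \<in> wide_overlaps n k U' \<phi>'" using T2' by blast
    then obtain i' j' where i'j': "\<bar>real i - real i'\<bar> < 1 / 2" "\<bar>real j - real j'\<bar> < 1 / 2"
      "inv_into (U' j') (\<phi>' j') (truncate_to n y) \<in> inv_into (U' i') (\<phi>' i') ` cube n (\<lambda>_. 0) 2"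
      unfolding wide_overlaps_def by auto
    have "truncate_to n y = y" using xy(2) closed_cube_subset truncate_to_id by blast
    then show "inv_into (U' j) (\<phi>' j) y \<in> inv_into (U' i) (\<phi>' i) ` cube n (\<lambda>_. 0) 2"
      using i'j' half_distance_eq[OF i'j'(1)] half_distance_eq[OF i'j'(2)] by simp
  qed
qed

text \<open>
Choosing a witness of some representative maps the classes injectively to the countable set of
witnesses.
\<close>

lemma countable_closed_diffeo_classes: "countable (closed_diffeo_classes n :: 'a manifold set set)"
proof -
  let ?M = "{M :: 'a manifold. closed_manifold n M}"
  let ?r = "{(M :: 'a manifold, N :: 'a manifold). closed_manifold n M \<and> closed_manifold n N \<and> diffeomorphic n M N}"
  let ?Wit = "UNIV \<times> countable_opens \<times> countable_opens \<times> countable_opens :: witness set"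
  have "countable ?Wit" by (intro countable_SIGMA countable_countable_opens countableI_type)
  moreover have "\<exists>f. inj_on f (closed_diffeo_classes n :: 'a manifold set set) \<and> f ` closed_diffeo_classes n \<subseteq> ?Wit"
  proof -
    have "\<forall>c. \<exists>w. c \<in> (closed_diffeo_classes n :: 'a manifold set set) \<longrightarrow>
        w \<in> ?Wit \<and> (\<exists>M. closed_manifold n M \<and> c = ?r `` {M} \<and> has_witness n M w)"
    proof
      fix c
      show "\<exists>w. c \<in> (closed_diffeo_classes n :: 'a manifold set set) \<longrightarrow>
        w \<in> ?Wit \<and> (\<exists>M. closed_manifold n M \<and> c = ?r `` {M} \<and> has_witness n M w)"
      proof (cases "c \<in> (closed_diffeo_classes n :: 'a manifold set set)")
        case True
        then obtain M where "M \<in> ?M" and c: "c = ?r `` {M}"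
          unfolding closed_diffeo_classes_def by (rule quotientE)
        then have M: "closed_manifold n M" "c = ?r `` {M}" by simp_all
        obtain w where "w \<in> ?Wit" "has_witness n M w" using witness_exists[OF M(1)] by (elim bexE)
        then show ?thesis using M by (intro exI[of _ w] impI conjI exI[of _ M])
      qed simp
    qed
    from choice[OF this] obtain f where f: "\<And>c. c \<in> (closed_diffeo_classes n :: 'a manifold set set) \<Longrightarrow>
        f c \<in> ?Wit \<and> (\<exists>M. closed_manifold n M \<and> c = ?r `` {M} \<and> has_witness n M (f c))" by blast
    have "inj_on f (closed_diffeo_classes n :: 'a manifold set set)"
    proof (rule inj_onI)
      fix c d assume c: "c \<in> (closed_diffeo_classes n :: 'a manifold set set)" and d: "d \<in> (closed_diffeo_classes n :: 'a manifold set set)"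
        and eq: "f c = f d"
      obtain M where M: "closed_manifold n M" "c = ?r `` {M}" "has_witness n M (f c)" using f[OF c] by blast
      obtain N where N: "closed_manifold n N" "d = ?r `` {N}" "has_witness n N (f c)" using f[OF d] eq by auto
      have MN: "diffeomorphic n M N" by (rule same_witness_diffeomorphic[OF M(1) N(1) M(3) N(3)])
      have NM: "diffeomorphic n N M" by (rule diffeomorphic_sym[OF MN])
      have "L \<in> c \<longleftrightarrow> L \<in> d" for L
        using diffeomorphic_trans[OF M(1) N(1), of L] diffeomorphic_trans[OF N(1) M(1), of L] MN NM M(1) N(1)
        by (auto simp: M(2) N(2))
      then show "c = d" by blast
    qed
    moreover have "f ` closed_diffeo_classes n \<subseteq> ?Wit" using f by blast
    ultimately show ?thesis by blast
  qed
  ultimately show ?thesis by (meson countable_subset countable_image_inj_on)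
qed


section \<open>Maximal atlases\<close>

lemma smoothly_compatible_via_atlas:
  assumes A: "smooth_atlas n X A" and c: "is_chart n X (U, \<phi>)" and d: "is_chart n X (V, \<psi>)"
    and cA: "\<And>a. a \<in> A \<Longrightarrow> smoothly_compatible n (U, \<phi>) a" and dA: "\<And>a. a \<in> A \<Longrightarrow> smoothly_compatible n (V, \<psi>) a"
  shows "smooth_on n n (\<phi> ` (U \<inter> V)) (\<psi> \<circ> inv_into U \<phi>)"
proof (rule smooth_on_local)
  fix y assume "y \<in> \<phi> ` (U \<inter> V)"
  then obtain q where q: "q \<in> U" "q \<in> V" "y = \<phi> q" by blast
  then have "q \<in> topspace X" using is_chart_subset[OF c] by blast
  with A obtain W \<theta> where W: "(W, \<theta>) \<in> A" "q \<in> W" by (rule atlas_cover)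
  have w: "is_chart n X (W, \<theta>)" by (rule atlas_chart[OF A W(1)])
  have inj: "inj_on \<phi> U" "inj_on \<psi> V" "inj_on \<theta> W" using c d w is_chart_inj_on by blast+
  have t1: "smooth_on n n (\<phi> ` (U \<inter> W)) (\<theta> \<circ> inv_into U \<phi>)"
    using cA[OF W(1)] by (simp add: smoothly_compatible_def)
  have t2: "smooth_on n n (\<theta> ` (V \<inter> W)) (\<psi> \<circ> inv_into W \<theta>)"
    using dA[OF W(1)] by (simp add: smoothly_compatible_def Int_commute)
  let ?S = "\<phi> ` (U \<inter> V \<inter> W)"
  have S: "openin (Euclidean_space n) ?S"
    by (rule chart_open_map[OF c openin_Int[OF openin_Int[OF chart_open[OF c] chart_open[OF d]] chart_open[OF w]]]) blast
  have "smooth_on n n ?S (\<lambda>y. (\<psi> \<circ> inv_into W \<theta>) ((\<theta> \<circ> inv_into U \<phi>) y))"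
    by (rule smooth_on_compose[OF smooth_on_subset[OF t1 S] t2]) (use inj in auto)
  then have "smooth_on n n ?S (\<psi> \<circ> inv_into U \<phi>)"
    by (rule smooth_on_cong) (use inj in auto)
  moreover have "y \<in> ?S" using q W by blast
  ultimately show "\<exists>S. y \<in> S \<and> S \<subseteq> \<phi> ` (U \<inter> V) \<and> smooth_on n n S (\<psi> \<circ> inv_into U \<phi>)"
    by (intro exI[of _ ?S]) auto
qed

text \<open>
The maximal atlas consists of the charts compatible with all charts of \<open>A\<close>. Two of these are compatible
with each other because their transition map factors locally through a chart of \<open>A\<close>.
\<close>

lemma smooth_atlas_extends:
  assumes A: "smooth_atlas n X A"
  shows "\<exists>B. A \<subseteq> B \<and> smooth_structure n X B"
proof -
  define B where "B = {c. is_chart n X c \<and> (\<forall>a\<in>A. smoothly_compatible n c a)}"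
  have AB: "A \<subseteq> B" using A by (auto simp: B_def smooth_atlas_def)
  have compat: "smoothly_compatible n c d" if "c \<in> B" "d \<in> B" for c d
  proof -
    obtain U \<phi> V \<psi> where [simp]: "c = (U, \<phi>)" "d = (V, \<psi>)" by fastforce
    have "smooth_on n n (\<phi> ` (U \<inter> V)) (\<psi> \<circ> inv_into U \<phi>)" "smooth_on n n (\<psi> ` (V \<inter> U)) (\<phi> \<circ> inv_into V \<psi>)"
      using that by (auto simp: B_def intro!: smoothly_compatible_via_atlas[OF A])
    then show ?thesis by (simp add: smoothly_compatible_def Int_commute)
  qed
  have "smooth_atlas n X B"
    unfolding smooth_atlas_def
  proof (intro conjI ballI compat)
    show "is_chart n X c" if "c \<in> B" for c using that by (simp add: B_def)
    have "fst c \<subseteq> topspace X" if "c \<in> B" for c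
      using that is_chart_subset[of n X "fst c" "snd c"] by (simp add: B_def)
    moreover have "topspace X \<subseteq> \<Union> (fst ` B)" using A AB unfolding smooth_atlas_def by blast
    ultimately show "\<Union> (fst ` B) = topspace X" by blast
  qed
  moreover have "C = B" if C: "smooth_atlas n X C" "B \<subseteq> C" for C
  proof
    show "C \<subseteq> B"
    proof
      fix c assume c: "c \<in> C"
      have "is_chart n X c" by (rule atlas_chart[OF C(1) c])
      moreover have "smoothly_compatible n c a" if "a \<in> A" for a
        using C c that AB unfolding smooth_atlas_def by (meson subsetD)
      ultimately show "c \<in> B" by (simp add: B_def)
    qed
  qed (rule C(2))
  ultimately show ?thesis using AB unfolding smooth_structure_def by blast
qed


section \<open>Disjoint unions of spheres\<close>

text \<open>
The unit sphere of \<open>\<real>\<^sup>n\<^sup>+\<^sup>1\<close> in \<open>K\<close> copies, distinguished by a second component.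
\<close>

definition spheres :: "nat \<Rightarrow> nat \<Rightarrow> ((nat \<Rightarrow> real) \<times> real) set" where
  "spheres n K = {(x, u). x \<in> topspace (Euclidean_space (n + 1)) \<and> (\<Sum>i<n. x i * x i) + x n * x n = 1 \<and> u \<in> real ` {..<K}}"

definition stereo_dom :: "nat \<Rightarrow> nat \<Rightarrow> nat \<Rightarrow> real \<Rightarrow> ((nat \<Rightarrow> real) \<times> real) set" where
  "stereo_dom n K j s = {(x, u). (x, u) \<in> spheres n K \<and> u = real j \<and> x n \<noteq> s}"

text \<open>
Stereographic projection from the pole whose last coordinate is \<open>s\<close>, with \<open>s = 1\<close> or \<open>s = - 1\<close>. Both cases
are treated together through \<open>s * s = 1\<close>.
\<close>

definition stereo :: "nat \<Rightarrow> real \<Rightarrow> (nat \<Rightarrow> real) \<times> real \<Rightarrow> nat \<Rightarrow> real" where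
  "stereo n s p = (\<lambda>i. if i < n then fst p i / (1 - s * fst p n) else 0)"

definition sq_norm :: "nat \<Rightarrow> (nat \<Rightarrow> real) \<Rightarrow> real" where
  "sq_norm n y = (\<Sum>i<n. y i * y i)"

definition stereo_inv :: "nat \<Rightarrow> nat \<Rightarrow> real \<Rightarrow> (nat \<Rightarrow> real) \<Rightarrow> (nat \<Rightarrow> real) \<times> real" where
  "stereo_inv n j s y = ((\<lambda>i. if i < n then 2 * y i / (sq_norm n y + 1)
     else if i = n then s * (sq_norm n y - 1) / (sq_norm n y + 1) else 0), real j)"

lemma sq_norm_nonneg: "sq_norm n y \<ge> 0"
  unfolding sq_norm_def by (intro sum_nonneg) simp

lemma stereo_stereo_inv:
  assumes s: "s * s = 1" and y: "y \<in> topspace (Euclidean_space n)"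
  shows "stereo n s (stereo_inv n j s y) = y"
proof -
  have p: "sq_norm n y + 1 > 0" using sq_norm_nonneg[of n y] by simp
  have "1 - s * (s * (sq_norm n y - 1) / (sq_norm n y + 1)) = 1 - (s * s) * (sq_norm n y - 1) / (sq_norm n y + 1)" by simp
  also have "\<dots> = 2 / (sq_norm n y + 1)" using p s by (simp add: field_simps)
  finally have "1 - s * fst (stereo_inv n j s y) n = 2 / (sq_norm n y + 1)" by (simp add: stereo_inv_def)
  then show ?thesis
    using p y by (auto simp: stereo_def fun_eq_iff topspace_Euclidean_space) (simp add: stereo_inv_def)
qed

lemma stereo_inv_in:
  assumes s: "s * s = 1" and j: "j < K" and y: "y \<in> topspace (Euclidean_space n)"
  shows "stereo_inv n j s y \<in> stereo_dom n K j s"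
proof -
  define q where "q = sq_norm n y"
  have p: "q + 1 > 0" using sq_norm_nonneg[of n y] by (simp add: q_def)
  have "(\<Sum>i<n. (2 * y i / (q + 1)) * (2 * y i / (q + 1))) = 4 * q / ((q + 1) * (q + 1))"
    unfolding q_def sq_norm_def[of n y] sum_distrib_left sum_divide_distrib by (intro sum.cong) (simp_all add: q_def)
  moreover have "(s * (q - 1) / (q + 1)) * (s * (q - 1) / (q + 1)) = (q - 1) * (q - 1) / ((q + 1) * (q + 1))"
  proof -
    have "(s * (q - 1) / (q + 1)) * (s * (q - 1) / (q + 1)) = (s * s) * ((q - 1) * (q - 1)) / ((q + 1) * (q + 1))"
      by simp
    then show ?thesis unfolding s by simp
  qed
  moreover have "4 * q / ((q + 1) * (q + 1)) + (q - 1) * (q - 1) / ((q + 1) * (q + 1)) = 1"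
  proof -
    have "4 * q + (q - 1) * (q - 1) = (q + 1) * (q + 1)" by (simp add: algebra_simps)
    then show ?thesis using p by (simp flip: add_divide_distrib)
  qed
  ultimately have "(\<Sum>i<n. (2 * y i / (q + 1)) * (2 * y i / (q + 1))) + (s * (q - 1) / (q + 1)) * (s * (q - 1) / (q + 1)) = 1"
    by (simp only:)
  moreover have "s * (q - 1) / (q + 1) \<noteq> s"
  proof
    assume "s * (q - 1) / (q + 1) = s"
    then have "s * (q - 1) = s * (q + 1)" using p by (simp add: field_simps)
    then show False using s by auto
  qed
  ultimately show ?thesis
    using j by (simp add: stereo_dom_def spheres_def stereo_inv_def topspace_Euclidean_space q_def)
qed

lemma stereo_in: "stereo n s p \<in> topspace (Euclidean_space n)"
  by (simp add: stereo_def topspace_Euclidean_space)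

lemma stereo_inv_stereo:
  assumes s: "s * s = 1" and p: "p \<in> stereo_dom n K j s"
  shows "stereo_inv n j s (stereo n s p) = p"
proof -
  obtain x u where xu: "p = (x, u)" by fastforce
  have x: "x \<in> topspace (Euclidean_space (n + 1))" "(\<Sum>i<n. x i * x i) + x n * x n = 1" "u = real j" "x n \<noteq> s"
    using p by (auto simp: xu stereo_dom_def spheres_def)
  define d where "d = 1 - s * x n"
  have d: "d \<noteq> 0"
  proof
    assume "d = 0"
    then have "s * (s * x n) = s" by (simp add: d_def)
    then have "x n = s" using s by (simp add: mult.assoc[symmetric])
    then show False using x by simp
  qed
  have "sq_norm n (stereo n s p) = (\<Sum>i<n. x i * x i) / (d * d)"
    unfolding sq_norm_def sum_divide_distrib by (intro sum.cong) (simp_all add: stereo_def xu d_def)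
  also have "(\<Sum>i<n. x i * x i) = 1 - (s * s) * (x n * x n)" using x(2) s by simp
  also have "\<dots> = d * (1 + s * x n)" by (simp add: d_def algebra_simps)
  finally have q: "sq_norm n (stereo n s p) = (1 + s * x n) / d" using d by simp
  have q1: "sq_norm n (stereo n s p) + 1 = 2 / d" unfolding q using d by (simp add: field_simps) (simp add: d_def)
  have q2: "sq_norm n (stereo n s p) - 1 = 2 * s * x n / d" unfolding q using d by (simp add: field_simps) (simp add: d_def)
  have "fst (stereo_inv n j s (stereo n s p)) i = x i" for i
  proof -
    consider "i < n" | "i = n" | "i > n" by linarith
    then show ?thesis
    proof cases
      case 1
      then have "fst (stereo_inv n j s (stereo n s p)) i = 2 * (x i / d) / (2 / d)"
        unfolding stereo_inv_def q1 by (simp add: stereo_def xu d_def)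
      then show ?thesis using d by simp
    next
      case 2
      then have "fst (stereo_inv n j s (stereo n s p)) i = s * (2 * s * x n / d) / (2 / d)"
        unfolding stereo_inv_def q1 q2 by simp
      also have "\<dots> = (s * s) * x n" using d by simp
      finally show ?thesis using s 2 by simp
    next
      case 3
      then show ?thesis using x(1) by (simp add: stereo_inv_def topspace_Euclidean_space)
    qed
  qed
  then have "fst (stereo_inv n j s (stereo n s p)) = x" by blast
  moreover have "snd (stereo_inv n j s (stereo n s p)) = u" using x(3) by (simp add: stereo_inv_def)
  ultimately show ?thesis unfolding xu by (simp add: prod_eq_iff)
qed

lemma stereo_image:
  assumes "s * s = 1" "j < K"
  shows "stereo n s ` stereo_dom n K j s = topspace (Euclidean_space n)"
proof (intro equalityI subsetI)
  show "y \<in> stereo n s ` stereo_dom n K j s" if "y \<in> topspace (Euclidean_space n)" for y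
    using stereo_inv_in[OF assms that] stereo_stereo_inv[OF assms(1) that, of j] by (metis image_eqI)
qed (use stereo_in in auto)

lemma sq_norm_smooth: "openin (Euclidean_space n) S \<Longrightarrow> smooth_real_on n S (sq_norm n)"
  unfolding sq_norm_def[abs_def] by (intro smooth_real_on_sum smooth_real_on_mult smooth_real_on_coord)

lemma continuous_on_sq_norm: "continuous_on S (sq_norm n)"
  unfolding sq_norm_def[abs_def] by (intro continuous_on_sum continuous_on_mult continuous_on_coordinate)

lemma continuous_on_stereo_inv: "continuous_on S (stereo_inv n j s)"
  unfolding stereo_inv_def[abs_def]
proof (intro continuous_on_Pair continuous_on_const continuous_on_coordinatewise_then_product)
  have nz: "sq_norm n y + 1 \<noteq> 0" for y using sq_norm_nonneg[of n y] by linarith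
  fix i
  have "continuous_on S (\<lambda>y. 2 * y i / (sq_norm n y + 1))"
    by (intro continuous_on_divide continuous_on_mult continuous_on_const continuous_on_add continuous_on_sq_norm continuous_on_coordinate) (use nz in auto)
  moreover have "continuous_on S (\<lambda>y. s * (sq_norm n y - 1) / (sq_norm n y + 1))"
    by (intro continuous_on_divide continuous_on_mult continuous_on_const continuous_on_add continuous_on_diff continuous_on_sq_norm) (use nz in auto)
  ultimately show "continuous_on S (\<lambda>y. if i < n then 2 * y i / (sq_norm n y + 1)
     else if i = n then s * (sq_norm n y - 1) / (sq_norm n y + 1) else 0)"
    by (cases "i < n"; cases "i = n") simp_all
qed

lemma one_minus_ne_0: "s * s = (1::real) \<Longrightarrow> x \<noteq> s \<Longrightarrow> 1 - s * x \<noteq> 0"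
proof
  assume s: "s * s = 1" "x \<noteq> s" and "1 - s * x = 0"
  then have "s * (s * x) = s" by simp
  then have "x = s" using s by (simp add: mult.assoc[symmetric])
  with s show False by simp
qed

lemma continuous_on_stereo:
  assumes s: "s * s = 1"
  shows "continuous_on (stereo_dom n K j s) (stereo n s)"
  unfolding stereo_def[abs_def]
proof (rule continuous_on_coordinatewise_then_product)
  fix i
  have c: "continuous_on (stereo_dom n K j s) (\<lambda>p. fst p m)" for m
    by (rule continuous_on_product_then_coordinatewise) (intro continuous_on_fst continuous_on_id)
  have "continuous_on (stereo_dom n K j s) (\<lambda>p. fst p i / (1 - s * fst p n))"
    by (intro continuous_on_divide continuous_on_diff continuous_on_mult continuous_on_const c ballI one_minus_ne_0[OF s])
      (auto simp: stereo_dom_def)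
  then show "continuous_on (stereo_dom n K j s) (\<lambda>p. if i < n then fst p i / (1 - s * fst p n) else 0)"
    by (cases "i < n") simp_all
qed

lemma stereo_dom_subset: "stereo_dom n K j s \<subseteq> spheres n K"
  by (auto simp: stereo_dom_def)

lemma half_distance_iff: "\<bar>real i - real j\<bar> * 2 < 1 \<longleftrightarrow> i = j"
  using half_distance_eq[of i j] by auto

lemma openin_stereo_dom: "openin (top_of_set (spheres n K)) (stereo_dom n K j s)"
proof -
  have "open ({x :: nat \<Rightarrow> real. x n \<noteq> s} \<times> {u. \<bar>u - real j\<bar> < 1 / 2})"
    by (intro open_Times open_Collect_neq open_Collect_less continuous_on_coordinate continuous_intros)
  moreover have "stereo_dom n K j s = spheres n K \<inter> ({x :: nat \<Rightarrow> real. x n \<noteq> s} \<times> {u. \<bar>u - real j\<bar> < 1 / 2})"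
    by (auto simp: stereo_dom_def spheres_def half_distance_iff)
  ultimately show ?thesis unfolding openin_open by blast
qed

lemma stereo_homeomorphic_maps:
  assumes s: "s * s = 1" and j: "j < K"
  shows "homeomorphic_maps (top_of_set (stereo_dom n K j s)) (Euclidean_space n) (stereo n s) (stereo_inv n j s)"
  unfolding homeomorphic_maps_def
proof (intro conjI ballI)
  show "continuous_map (top_of_set (stereo_dom n K j s)) (Euclidean_space n) (stereo n s)"
    by (subst Euclidean_space_eq_top_of_set)
      (use continuous_on_stereo[OF s] stereo_in in \<open>auto simp: continuous_map_in_subtopology\<close>)
  show "continuous_map (Euclidean_space n) (top_of_set (stereo_dom n K j s)) (stereo_inv n j s)"
    by (subst Euclidean_space_eq_top_of_set)
      (use continuous_on_stereo_inv stereo_inv_in[OF s j] in \<open>auto simp: continuous_map_in_subtopology\<close>)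
qed (use stereo_inv_stereo[OF s] stereo_stereo_inv[OF s] in auto)

lemma stereo_is_chart:
  assumes s: "s * s = 1" and j: "j < K"
  shows "is_chart n (top_of_set (spheres n K)) (stereo_dom n K j s, stereo n s)"
proof -
  have "subtopology (top_of_set (spheres n K)) (stereo_dom n K j s) = top_of_set (stereo_dom n K j s)"
    using stereo_dom_subset by (simp add: subtopology_subtopology Int_absorb1)
  then show ?thesis
    using homeomorphic_maps_imp_map[OF stereo_homeomorphic_maps[OF s j, of n]] openin_stereo_dom
    unfolding is_chart_def prod.case stereo_image[OF s j] by (simp add: openin_topspace)
qed

text \<open>
Charts of the same copy with opposite poles are related by the inversion \<open>y \<mapsto> y / \<bar>y\<bar>\<^sup>2\<close>.
\<close>

lemma stereo_transition:
  assumes s: "s * s = 1" and t: "t * t = 1" and j: "j < K" and l: "l < K"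
  shows "smooth_on n n (stereo n s ` (stereo_dom n K j s \<inter> stereo_dom n K l t)) (stereo n t \<circ> inv_into (stereo_dom n K j s) (stereo n s))"
proof -
  let ?U = "stereo_dom n K j s" let ?V = "stereo_dom n K l t"
  let ?S = "stereo n s ` (?U \<inter> ?V)"
  have ch: "is_chart n (top_of_set (spheres n K)) (?U, stereo n s)" by (rule stereo_is_chart[OF s j])
  have inj: "inj_on (stereo n s) ?U" by (rule is_chart_inj_on[OF ch])
  have S: "openin (Euclidean_space n) ?S"
    by (rule chart_open_map[OF ch openin_Int[OF openin_stereo_dom openin_stereo_dom]]) blast
  have "s = t \<or> s = - t" using s t by (metis square_eq_iff)
  then consider "j \<noteq> l" | "s = t" "j = l" | "t = - s" "j = l" by fastforce
  then show ?thesis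
  proof cases
    case 1
    then have "?S = {}" by (auto simp: stereo_dom_def)
    then show ?thesis by (simp only:) (rule smooth_on_local, simp)
  next
    case 2
    show ?thesis by (rule smooth_on_cong[OF smooth_on_id[OF S]]) (use inj 2 in auto)
  next
    case 3
    have nz: "sq_norm n y \<noteq> 0" and eq: "stereo n t (inv_into ?U (stereo n s) y) = (\<lambda>i. if i < n then y i / sq_norm n y else 0)"
      if yS: "y \<in> ?S" for y
    proof -
      obtain p where p: "p \<in> ?U" "p \<in> ?V" "y = stereo n s p" using yS by blast
      have y: "y \<in> topspace (Euclidean_space n)" using p stereo_in by simp
      have inv: "inv_into ?U (stereo n s) y = p" using p inj by simp
      have p_eq: "p = stereo_inv n j s y" using stereo_inv_stereo[OF s p(1)] p(3) by simp
      define q where "q = sq_norm n y"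
      have q: "q + 1 > 0" using sq_norm_nonneg[of n y] by (simp add: q_def)
      have pn: "fst p n = s * (q - 1) / (q + 1)" unfolding p_eq by (simp add: stereo_inv_def q_def)
      have "fst p n \<noteq> - s" using p(2) 3 by (auto simp: stereo_dom_def)
      then have "q \<noteq> 0" unfolding pn by auto
      then show "sq_norm n y \<noteq> 0" by (simp add: q_def)
      have "1 - t * fst p n = 1 + (s * s) * (q - 1) / (q + 1)" unfolding pn 3(1) by simp
      also have "\<dots> = 2 * q / (q + 1)" using q s by (simp add: field_simps)
      finally have d: "1 - t * fst p n = 2 * q / (q + 1)" .
      have "fst p i / (1 - t * fst p n) = y i / q" if "i < n" for i
      proof -
        have "fst p i = 2 * y i / (q + 1)" unfolding p_eq using that by (simp add: stereo_inv_def q_def)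
        then show ?thesis unfolding d using q \<open>q \<noteq> 0\<close> by simp
      qed
      then show "stereo n t (inv_into ?U (stereo n s) y) = (\<lambda>i. if i < n then y i / sq_norm n y else 0)"
        unfolding inv by (auto simp: stereo_def q_def)
    qed
    have "smooth_on n n ?S (\<lambda>y i. if i < n then y i / sq_norm n y else 0)"
      by (intro smooth_onI S smooth_real_on_divide smooth_real_on_coord sq_norm_smooth nz)
    then show ?thesis by (rule smooth_on_cong) (simp add: eq)
  qed
qed

definition stereo_atlas :: "nat \<Rightarrow> nat \<Rightarrow> ((nat \<Rightarrow> real) \<times> real) chart set" where
  "stereo_atlas n K = {(stereo_dom n K j s, stereo n s) |j s. j < K \<and> s * s = 1}"

lemma spheres_cover:
  assumes "p \<in> spheres n K"
  shows "\<exists>j<K. \<exists>s\<in>{1, -1}. p \<in> stereo_dom n K j s"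
proof -
  obtain x u where xu: "p = (x, u)" by fastforce
  obtain j where j: "j < K" "u = real j" using assms by (auto simp: xu spheres_def)
  have "x n \<noteq> 1 \<or> x n \<noteq> -1" by auto
  then show ?thesis using assms j by (auto simp: xu stereo_dom_def)
qed

lemma stereo_smooth_atlas: "smooth_atlas n (top_of_set (spheres n K)) (stereo_atlas n K)"
  unfolding smooth_atlas_def
proof (intro conjI ballI)
  show "is_chart n (top_of_set (spheres n K)) c" if "c \<in> stereo_atlas n K" for c
    using that stereo_is_chart by (auto simp: stereo_atlas_def)
  show "smoothly_compatible n c d" if cd: "c \<in> stereo_atlas n K" "d \<in> stereo_atlas n K" for c d
  proof -
    obtain j s where c: "c = (stereo_dom n K j s, stereo n s)" "j < K" "s * s = 1"
      using cd(1) unfolding stereo_atlas_def by (elim CollectE exE conjE) (rule that)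
    obtain l t where d: "d = (stereo_dom n K l t, stereo n t)" "l < K" "t * t = 1"
      using cd(2) unfolding stereo_atlas_def by (elim CollectE exE conjE) (rule that)
    show ?thesis
      using stereo_transition[OF c(3) d(3) c(2) d(2)] stereo_transition[OF d(3) c(3) d(2) c(2)]
      by (simp add: smoothly_compatible_def c d Int_commute)
  qed
  show "\<Union> (fst ` stereo_atlas n K) = topspace (top_of_set (spheres n K))"
  proof (intro equalityI subsetI)
    fix p assume "p \<in> topspace (top_of_set (spheres n K))"
    then have "p \<in> spheres n K" by simp
    from spheres_cover[OF this] obtain j s where js: "j < K" "s \<in> {1, -1}" "p \<in> stereo_dom n K j s" by blast
    then have "(stereo_dom n K j s, stereo n s) \<in> stereo_atlas n K"
      unfolding stereo_atlas_def by (intro CollectI exI[of _ j] exI[of _ s]) auto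
    then show "p \<in> \<Union> (fst ` stereo_atlas n K)" using js(3) by force
  qed (auto simp: stereo_atlas_def stereo_dom_def)
qed

lemma compact_spheres: "compact (spheres n K)"
proof -
  have "compact (closed_cube (n + 1) 1 \<times> (real ` {..<K}))"
    by (intro compact_Times compact_closed_cube finite_imp_compact) simp
  moreover have "closed {p :: (nat \<Rightarrow> real) \<times> real. (\<Sum>i<n. fst p i * fst p i) + fst p n * fst p n = 1}"
  proof (rule closed_Collect_eq)
    have c: "continuous_on UNIV (\<lambda>p :: (nat \<Rightarrow> real) \<times> real. fst p m)" for m
      by (rule continuous_on_product_then_coordinatewise) (intro continuous_on_fst continuous_on_id)
    show "continuous_on UNIV (\<lambda>p :: (nat \<Rightarrow> real) \<times> real. (\<Sum>i<n. fst p i * fst p i) + fst p n * fst p n)"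
      by (intro continuous_on_add continuous_on_sum continuous_on_mult c)
  qed (rule continuous_on_const)
  moreover have "spheres n K = (closed_cube (n + 1) 1 \<times> (real ` {..<K})) \<inter> {p. (\<Sum>i<n. fst p i * fst p i) + fst p n * fst p n = 1}"
  proof -
    have "\<bar>x i\<bar> \<le> 1" if x: "(\<Sum>i<n. x i * x i) + x n * x n = 1" "i < n + 1" for x :: "nat \<Rightarrow> real" and i
    proof -
      have "(\<Sum>i<n. x i * x i) + x n * x n = (\<Sum>i<n + 1. x i * x i)" by simp
      then have "x i * x i \<le> 1" using member_le_sum[of i "{..<n + 1}" "\<lambda>i. x i * x i"] x by simp
      then show ?thesis by (simp add: abs_square_le_1 flip: power2_eq_square)
    qed
    then show ?thesis unfolding spheres_def closed_cube_def by auto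
  qed
  ultimately show ?thesis by (simp add: compact_Int_closed)
qed

lemma second_countable_euclidean: "second_countable (euclidean :: 'p::second_countable_topology topology)"
proof -
  obtain B :: "'p set set" where B: "countable B" "topological_basis B" using ex_countable_basis by blast
  have "openin euclidean V" if "V \<in> B" for V using topological_basis_open[OF B(2) that] by simp
  moreover have "\<exists>V\<in>B. x \<in> V \<and> V \<subseteq> U" if "openin euclidean U" "x \<in> U" for U and x :: 'p
    using topological_basisE[OF B(2) _ that(2)] that(1) by (metis open_openin)
  ultimately show ?thesis unfolding second_countable_def using B(1) by blast
qed

lemma spheres_closed_manifold:
  "\<exists>A. closed_manifold n (top_of_set (spheres n K), A)"
proof -
  obtain A where "smooth_structure n (top_of_set (spheres n K)) A"
    using smooth_atlas_extends[OF stereo_smooth_atlas] by blast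
  moreover have "Hausdorff_space (top_of_set (spheres n K))" by (simp add: Hausdorff_space_subtopology)
  moreover have "second_countable (top_of_set (spheres n K))"
    by (simp add: second_countable_subtopology second_countable_euclidean)
  moreover have "compact_space (top_of_set (spheres n K))" using compact_spheres by (simp add: compact_space_subtopology)
  ultimately show ?thesis by (auto simp: closed_manifold_def smooth_manifold_def)
qed


section \<open>Counting clopen pieces\<close>

definition open_partition :: "'a topology \<Rightarrow> nat \<Rightarrow> (nat \<Rightarrow> 'a set) \<Rightarrow> bool" where
  "open_partition X m F \<longleftrightarrow> (\<forall>i<m. openin X (F i) \<and> F i \<noteq> {}) \<and>
     (\<forall>i<m. \<forall>j<m. i \<noteq> j \<longrightarrow> F i \<inter> F j = {}) \<and> topspace X = (\<Union>i<m. F i)"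

text \<open>
Preimages of the pieces are nonempty by surjectivity. So the possible numbers of pieces are an invariant.
\<close>

lemma open_partition_pullback:
  assumes F: "open_partition X m F" and g: "continuous_map Y X g" and surj: "topspace X \<subseteq> g ` topspace Y"
  shows "open_partition Y m (\<lambda>i. {y \<in> topspace Y. g y \<in> F i})"
  unfolding open_partition_def
proof (intro conjI allI impI)
  fix i assume i: "i < m"
  show "openin Y {y \<in> topspace Y. g y \<in> F i}"
    using openin_continuous_map_preimage[OF g] F i by (simp add: open_partition_def)
  have "F i \<subseteq> topspace X" "F i \<noteq> {}" using F i openin_subset unfolding open_partition_def by blast+
  then show "{y \<in> topspace Y. g y \<in> F i} \<noteq> {}" using surj by blast
next
  show "{y \<in> topspace Y. g y \<in> F i} \<inter> {y \<in> topspace Y. g y \<in> F j} = {}" if "i < m" "j < m" "i \<noteq> j" for i j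
    using F that unfolding open_partition_def by blast
  show "topspace Y = (\<Union>i<m. {y \<in> topspace Y. g y \<in> F i})"
    using F continuous_map_image_subset_topspace[OF g] unfolding open_partition_def by blast
qed

lemma spheres_open_partition: "\<exists>F. open_partition (top_of_set (spheres n K)) K F"
proof (intro exI)
  define F where "F j = spheres n K \<inter> (UNIV \<times> {u. \<bar>u - real j\<bar> < 1 / 2})" for j
  have F: "F j = {p \<in> spheres n K. snd p = real j}" for j
    by (auto simp: F_def spheres_def half_distance_iff)
  show "open_partition (top_of_set (spheres n K)) K F"
    unfolding open_partition_def
  proof (intro conjI allI impI)
    fix j assume j: "j < K"
    have "open ((UNIV :: (nat \<Rightarrow> real) set) \<times> {u. \<bar>u - real j\<bar> < 1 / 2})"
      by (intro open_Times open_UNIV open_Collect_less continuous_intros)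
    then show "openin (top_of_set (spheres n K)) (F j)" unfolding F_def openin_open by blast
    have "(\<lambda>i. if i = n then 1 else 0, real j) \<in> F j"
      using j by (simp add: F spheres_def topspace_Euclidean_space)
    then show "F j \<noteq> {}" by blast
  next
    show "F i \<inter> F j = {}" if "i \<noteq> j" for i j using that by (auto simp: F)
    show "topspace (top_of_set (spheres n K)) = (\<Union>i<K. F i)" by (auto simp: F spheres_def)
  qed
qed

text \<open>
Every piece is open and closed, hence contains one of the \<open>2 K\<close> connected chart domains, and disjoint pieces
contain different ones.
\<close>

lemma spheres_partition_bound:
  assumes F: "open_partition (top_of_set (spheres n K)) m F"
  shows "m \<le> 2 * K"
proof -
  let ?X = "top_of_set (spheres n K)"
  have F1: "openin ?X (F i)" "F i \<noteq> {}" if "i < m" for i using F that unfolding open_partition_def by blast+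
  have F2: "F i \<inter> F j = {}" if "i < m" "j < m" "i \<noteq> j" for i j using F that unfolding open_partition_def by blast
  have F3: "spheres n K = (\<Union>i<m. F i)" using F by (simp add: open_partition_def)
  have closed: "closedin ?X (F i)" if i: "i < m" for i
  proof -
    have "openin ?X (\<Union>j\<in>{..<m} - {i}. F j)" using F1 by (intro openin_Union) auto
    moreover have "spheres n K - F i = (\<Union>j\<in>{..<m} - {i}. F j)" using F2 i unfolding F3 by fastforce
    moreover have "F i \<subseteq> spheres n K" using i unfolding F3 by blast
    ultimately show ?thesis by (simp add: closedin_def)
  qed
  have conn: "connectedin ?X (stereo_dom n K j s)" if "j < K" "s * s = 1" for j s
  proof -
    have "connected_space (Euclidean_space n)" by (rule connected_Euclidean_space)
    then have "connected_space (top_of_set (stereo_dom n K j s))"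
      using homeomorphic_connected_space[of "top_of_set (stereo_dom n K j s)" "Euclidean_space n"]
        stereo_homeomorphic_maps[OF that(2,1), of n] unfolding homeomorphic_space_def by blast
    then have "connected (stereo_dom n K j s)" by (simp flip: connectedin_iff_connected add: connectedin_def)
    then show ?thesis using stereo_dom_subset by (simp add: connectedin_subtopology)
  qed
  have "\<exists>c. c \<in> {..<K} \<times> {1, -1::real} \<and> stereo_dom n K (fst c) (snd c) \<subseteq> F i \<and> stereo_dom n K (fst c) (snd c) \<noteq> {}" if i: "i < m" for i
  proof -
    obtain p where p: "p \<in> F i" using F1(2)[OF i] by blast
    then have "p \<in> spheres n K" using i unfolding F3 by blast
    from spheres_cover[OF this] obtain j s where js: "j < K" "s \<in> {1, -1}" "p \<in> stereo_dom n K j s" by blast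
    have ss: "s * s = 1" using js(2) by auto
    have "stereo_dom n K j s \<subseteq> F i \<or> disjnt (stereo_dom n K j s) (F i)"
      by (rule connectedin_clopen_cases[OF conn[OF js(1) ss] closed[OF i] F1(1)[OF i]])
    then have "stereo_dom n K j s \<subseteq> F i" using p js(3) by (metis disjnt_iff)
    then show ?thesis using js by (intro exI[of _ "(j, s)"]) auto
  qed
  then obtain c where c: "\<And>i. i < m \<Longrightarrow> c i \<in> {..<K} \<times> {1, -1::real} \<and>
      stereo_dom n K (fst (c i)) (snd (c i)) \<subseteq> F i \<and> stereo_dom n K (fst (c i)) (snd (c i)) \<noteq> {}" by metis
  have "inj_on c {..<m}"
  proof (rule inj_onI)
    fix i j assume ij: "i \<in> {..<m}" "j \<in> {..<m}" "c i = c j"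
    show "i = j"
    proof (rule ccontr)
      assume "i \<noteq> j"
      then have "F i \<inter> F j = {}" using F2 ij by simp
      then show False using c[of i] c[of j] ij by auto
    qed
  qed
  then have "card {..<m} \<le> card ({..<K} \<times> {1, -1::real})"
    by (rule card_inj_on_le) (use c in \<open>blast, simp\<close>)
  then show ?thesis by simp
qed

lemma diffeomorphic_open_partition:
  assumes "diffeomorphic n M N" "open_partition (fst N) m F"
  shows "\<exists>F'. open_partition (fst M) m F'"
proof -
  obtain X A Y B where MN: "M = (X, A)" "N = (Y, B)" by (metis surj_pair)
  obtain f g where f: "smooth_map n n (X, A) (Y, B) f" "smooth_map n n (Y, B) (X, A) g" "\<forall>y\<in>topspace Y. f (g y) = y"
    using assms(1) unfolding MN diffeomorphic_def fst_conv by blast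
  have cont: "continuous_map X Y f" using f(1) by (simp add: smooth_map_def)
  have "topspace Y \<subseteq> f ` topspace X"
  proof
    fix y assume y: "y \<in> topspace Y"
    then have "g y \<in> topspace X" using smooth_map_in[OF f(2)] by blast
    then show "y \<in> f ` topspace X" using f(3) y by (metis image_eqI)
  qed
  from open_partition_pullback[OF _ cont this] assms(2) show ?thesis unfolding MN by auto
qed

text \<open>
If \<open>3\<^sup>a\<close> spheres were diffeomorphic to \<open>3\<^sup>b\<close> spheres with \<open>a < b\<close>, the former would split into \<open>3\<^sup>b > 2 \<cdot> 3\<^sup>a\<close>
open pieces. Representatives over the type \<open>'a\<close> exist because it is large enough.
\<close>

lemma infinite_closed_diffeo_classes:
  assumes "(UNIV :: real set) \<lesssim> (UNIV :: 'a set)"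
  shows "infinite (closed_diffeo_classes n :: 'a manifold set set)"
proof -
  let ?r = "{(M :: 'a manifold, N :: 'a manifold). closed_manifold n M \<and> closed_manifold n N \<and> diffeomorphic n M N}"
  have "\<exists>A. closed_manifold n (top_of_set (spheres n (3 ^ a)), A)" for a by (rule spheres_closed_manifold)
  then obtain A where A: "\<And>a. closed_manifold n (top_of_set (spheres n (3 ^ a)), A a)" by metis
  define S where "S a = (top_of_set (spheres n (3 ^ a)), A a)" for a
  have S: "closed_manifold n (S a)" for a using A by (simp add: S_def)
  have "\<exists>N :: 'a manifold. closed_manifold n N \<and> diffeomorphic n (S a) N" for a
    by (rule closed_manifold_represented[OF assms S])
  then obtain N :: "nat \<Rightarrow> 'a manifold" where N: "\<And>a. closed_manifold n (N a)" "\<And>a. diffeomorphic n (S a) (N a)" by metis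
  have bound: "b \<le> a" if ab: "diffeomorphic n (S a) (S b)" for a b
  proof (rule ccontr)
    assume "\<not> b \<le> a"
    then have le: "Suc a \<le> b" by simp
    obtain F where "open_partition (fst (S b)) (3 ^ b) F"
      using spheres_open_partition[of n "3 ^ b"] unfolding S_def fst_conv by (rule exE)
    from diffeomorphic_open_partition[OF ab this]
    have "(3::nat) ^ b \<le> 2 * 3 ^ a" unfolding S_def fst_conv using spheres_partition_bound by blast
    moreover have "(3::nat) ^ Suc a \<le> 3 ^ b" using le by (intro power_increasing) auto
    moreover have "(3::nat) ^ a > 0" by simp
    ultimately show False unfolding power_Suc by linarith
  qed
  have "inj (\<lambda>a. ?r `` {N a})"
  proof (rule injI)
    fix a b assume eq: "?r `` {N a} = ?r `` {N b}"
    have "N b \<in> ?r `` {N b}" using N(1)[of b] diffeomorphic_refl[OF N(1)[of b]] by simp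
    then have "N b \<in> ?r `` {N a}" using eq by simp
    then have ab: "diffeomorphic n (N a) (N b)" by simp
    have "diffeomorphic n (S a) (N b)" by (rule diffeomorphic_trans[OF S N(1) N(1) N(2) ab])
    then have "diffeomorphic n (S a) (S b)"
      by (rule diffeomorphic_trans[OF S N(1) S _ diffeomorphic_sym[OF N(2)]])
    then show "a = b" using bound diffeomorphic_sym by (meson order_antisym)
  qed
  then have "infinite (range (\<lambda>a. ?r `` {N a}))" by (rule range_inj_infinite)
  moreover have "range (\<lambda>a. ?r `` {N a}) \<subseteq> (closed_diffeo_classes n :: 'a manifold set set)"
    unfolding closed_diffeo_classes_def using N(1) by (intro image_subsetI quotientI) simp
  ultimately show ?thesis by (rule infinite_super[rotated])
qed

theorem proposition1p2:
  fixes n :: nat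
  assumes "(UNIV :: real set) \<lesssim> (UNIV :: 'a set)"
  shows "(closed_diffeo_classes n :: 'a manifold set set) \<approx> (UNIV :: nat set)"
  unfolding eqpoll_def
  using to_nat_on_infinite[OF countable_closed_diffeo_classes infinite_closed_diffeo_classes[OF assms]] by blast

end
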